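(* Let $m\geq 2$ be an integer and let $1\leq p\leq q<\infty$. Then $$\Pi_{(q;p)}^{m}(^{m}\ell_{1};\ell_{2})=\mathcal{L}(^{m}\ell_{1};\ell_{2})$$ if and only if $p\leq 2$ or $q>p>2$.
   Context: All spaces are over $\mathbb{K}=\mathbb{R}$ or $\mathbb{C}$. $\mathcal{L}(^m\ell_1;\ell_2)$ is the space of all bounded $m$-linear operators $T\colon\ell_1\times\cdots\times\ell_1\to\ell_2$ ($m$ factors). For a Banach space $E$ with dual unit ball $B_{E^*}$ and $p\in[1,\infty)$, $\ell_p^w(E)$ is the space of sequences $(x_j)_{j\ge1}$ in $E$ with $\|(x_j)\|_{w,p}:=\sup_{\varphi\in B_{E^*}}\left(\sum_{j}|\varphi(x_j)|^p\right)^{1/p}<\infty$. $\Pi^m_{(q;p)}(^m\ell_1;\ell_2)$ is the set of multiple $(q;p)$-summing operators, i.e. of those $T\in\mathcal{L}(^m\ell_1;\ell_2)$ for which there is $C>0$ with $$\left(\sum_{j_1,\dots,j_m=1}^\infty\left\|T(x^{(1)}_{j_1},\dots,x^{(m)}_{j_m})\right\|^q\right)^{1/q}\le C\prod_{k=1}^m\left\|(x^{(k)}_{j})_{j=1}^\infty\right\|_{w,p}$$ for all $(x^{(k)}_j)_j\in\ell_p^w(\ell_1)$, $k=1,\dots,m$. *)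

theory Defs
  imports "HOL-Analysis.Analysis" "HOL-Library.FuncSet"
begin

text \<open>
  The scalar field is the type parameter \<open>'k\<close>, to be instantiated with \<^typ>\<open>real\<close> or \<^typ>\<open>complex\<close>.
  The space \<open>\<ell>\<^sub>r\<close> (for \<open>1 \<le> r < \<infinity>\<close>) is a set of scalar sequences with pointwise operations;
  an \<open>m\<close>-tuple is an extensional function on \<open>{..<m}\<close>, and maps defined on a subset of a type are
  extensional functions, so that equality of maps is equality on their domain.
\<close>

definition ell :: "real \<Rightarrow> (nat \<Rightarrow> 'k::real_normed_field) set" where
  "ell r = {x. summable (\<lambda>i. norm (x i) powr r)}"

definition ell_norm :: "real \<Rightarrow> (nat \<Rightarrow> 'k::real_normed_field) \<Rightarrow> real" where
  "ell_norm r x = (\<Sum>i. norm (x i) powr r) powr (1 / r)"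

definition dual_unit_ball :: "real \<Rightarrow> ((nat \<Rightarrow> 'k::real_normed_field) \<Rightarrow> 'k) set" where
  "dual_unit_ball r = {\<phi> \<in> ell r \<rightarrow>\<^sub>E UNIV.
     (\<forall>x\<in>ell r. \<forall>y\<in>ell r. \<forall>a b. \<phi> (\<lambda>i. a * x i + b * y i) = a * \<phi> x + b * \<phi> y) \<and>
     (\<forall>x\<in>ell r. norm (\<phi> x) \<le> ell_norm r x)}"

text \<open>
  Sequences in \<open>\<ell>\<^sub>r\<close> with finite weak \<open>p\<close>-norm. Finiteness of the supremum (taken in \<open>[0, \<infinity>]\<close>) is
  spelled out: every sum converges and the values are bounded. For such sequences the real
  supremum \<open>weak_norm\<close> is the weak \<open>p\<close>-norm.
\<close>

definition weak_ell :: "real \<Rightarrow> real \<Rightarrow> (nat \<Rightarrow> nat \<Rightarrow> 'k::real_normed_field) set" where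
  "weak_ell p r = {x. (\<forall>j. x j \<in> ell r) \<and>
     (\<forall>\<phi>\<in>dual_unit_ball r. summable (\<lambda>j. norm (\<phi> (x j)) powr p)) \<and>
     bdd_above ((\<lambda>\<phi>. (\<Sum>j. norm (\<phi> (x j)) powr p) powr (1 / p)) ` dual_unit_ball r)}"

definition weak_norm :: "real \<Rightarrow> real \<Rightarrow> (nat \<Rightarrow> nat \<Rightarrow> 'k::real_normed_field) \<Rightarrow> real" where
  "weak_norm p r x = (SUP \<phi>\<in>dual_unit_ball r. (\<Sum>j. norm (\<phi> (x j)) powr p) powr (1 / p))"

text \<open>Bounded \<open>m\<close>-linear operators \<open>\<ell>\<^sub>r \<times> \<dots> \<times> \<ell>\<^sub>r \<rightarrow> \<ell>\<^sub>s\<close>.\<close>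

definition bounded_multilinear_ops ::
  "nat \<Rightarrow> real \<Rightarrow> real \<Rightarrow> ((nat \<Rightarrow> nat \<Rightarrow> 'k::real_normed_field) \<Rightarrow> nat \<Rightarrow> 'k) set" where
  "bounded_multilinear_ops m r s = {T \<in> ({..<m} \<rightarrow>\<^sub>E ell r) \<rightarrow>\<^sub>E ell s.
     (\<forall>x \<in> {..<m} \<rightarrow>\<^sub>E ell r. \<forall>k<m. \<forall>u\<in>ell r. \<forall>v\<in>ell r. \<forall>a b.
        T (x(k := \<lambda>i. a * u i + b * v i)) = (\<lambda>i. a * T (x(k := u)) i + b * T (x(k := v)) i)) \<and>
     (\<exists>C. \<forall>x \<in> {..<m} \<rightarrow>\<^sub>E ell r. ell_norm s (T x) \<le> C * (\<Prod>k<m. ell_norm r (x k)))}"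

text \<open>
  Multiple \<open>(q;p)\<close>-summing operators. Here \<open>x k\<close> is the \<open>k\<close>-th sequence in \<open>\<ell>\<^sub>r\<close>, and the sum runs over
  all multi-indices \<open>j = (j\<^sub>0, \<dots>, j\<^sub>m\<^sub>-\<^sub>1)\<close>; its finiteness is part of the inequality and
  is stated separately, as \<^const>\<open>infsum\<close> is \<open>0\<close> on families that are not summable.
\<close>

definition multiple_summing_ops ::
  "nat \<Rightarrow> real \<Rightarrow> real \<Rightarrow> real \<Rightarrow> real \<Rightarrow> ((nat \<Rightarrow> nat \<Rightarrow> 'k::real_normed_field) \<Rightarrow> nat \<Rightarrow> 'k) set" where
  "multiple_summing_ops m q p r s = {T \<in> bounded_multilinear_ops m r s.
     \<exists>C>0. \<forall>x. (\<forall>k<m. x k \<in> weak_ell p r) \<longrightarrow>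
       (\<lambda>j. ell_norm s (T (\<lambda>k\<in>{..<m}. x k (j k))) powr q) summable_on ({..<m} \<rightarrow>\<^sub>E UNIV) \<and>
       (\<Sum>\<^sub>\<infinity>j\<in>{..<m} \<rightarrow>\<^sub>E UNIV. ell_norm s (T (\<lambda>k\<in>{..<m}. x k (j k))) powr q) powr (1 / q)
         \<le> C * (\<Prod>k<m. weak_norm p r (x k))}"

end

theory Submission
  imports Defs
begin

text \<open>
  For \<open>p = q = 2\<close>, Grothendieck's inequality turns \<open>x \<mapsto> (T (x, y\<^sub>j))\<^sub>j\<close> into a bounded operator from
  \<open>\<ell>\<^sub>1\<close> into a Hilbert space, so that it may be applied to one variable after the other. For \<open>p < 2\<close>
  every weakly \<open>p\<close>-summable sequence in \<open>\<ell>\<^sub>1\<close> is of the form \<open>\<sigma>\<^sub>j y\<^sub>j\<close> with \<open>y\<close> weakly 2-summable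
  and \<open>\<sigma> \<in> \<ell>\<^sub>r\<close>, \<open>1/r = 1/p - 1/2\<close>, which reduces the claim to the case 2. For \<open>p > 2\<close> one variable
  costs an arbitrarily small increase of the exponent: an operator \<open>\<ell>\<^sub>1 \<rightarrow> \<ell>\<^sub>r\<close> lifts to \<open>L\<^sub>\<infinity>\<close>
      through
  random variables \<open>\<theta>\<^sub>l\<close> that behave like independent \<open>r'\<close>-stable ones, and these span \<open>\<ell>\<^sub>r\<^sub>'\<close> in
  \<open>L\<^sub>s\<^sub>'\<close> for every \<open>s > r\<close>. For \<open>p = q > 2\<close> the same variables, with \<open>p\<close> in place of \<open>r\<close>, are a
  weakly \<open>p\<close>-summable sequence on which a suitable bilinear form has sums that grow logarithmically
  without bound.
\<close>

subsection \<open>Grothendieck's inequality\<close>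

text \<open>The obstacle is the order of the exponents in the iteration. After some variables have
  been treated, the operator in the next variable takes values in l_r(l_2), the outer index being a
  multi-index, and its image of a weakly s-summable sequence has to be s-summable in the outer index
  as well. For r = s = 2 this target is a Hilbert space. For r > 2 it is not, and the method pays
  with s > r, because a 1/\<beta>-stable variable has moments only below the order 1/\<beta>. The
  total increase q - p is spread over the m variables, so it may be arbitrarily small. At the
  endpoint all dyadic scales contribute equally, and the bilinear form of the negative part adds up
  exactly these contributions: two independent values 2^(\<beta> i) and 2^(\<beta> i') meet at i +
  i' = R in R + 1 ways of comparable weight. Operators on l_1 are determined by the images of the
  unit vectors, which is why lifting single vectors suffices in each step. All constants are
  independent of the sizes of the finite matrices, and every moment bound is uniform in the
  truncation R.\<close>

lemma sum_PiE_insert: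
  fixes F :: "('i \<Rightarrow> 'b) \<Rightarrow> 'c::comm_monoid_add"
  assumes "i \<notin> I"
  shows "(\<Sum>w\<in>PiE (insert i I) B. F w) = (\<Sum>b\<in>B i. \<Sum>g\<in>PiE I B. F (g(i := b)))"
proof -
  have inj: "inj_on (\<lambda>(y, g). g(i := y)) (B i \<times> PiE I B)"
    using assms by (rule inj_combinator)
  have "(\<Sum>w\<in>PiE (insert i I) B. F w) = (\<Sum>w\<in>(\<lambda>(y, g). g(i := y)) ` (B i \<times> PiE I B). F w)"
    by (simp add: PiE_insert_eq)
  also have "\<dots> = (\<Sum>(y, g)\<in>B i \<times> PiE I B. F (g(i := y)))"
    by (subst sum.reindex[OF inj]) (simp add: case_prod_unfold)
  also have "\<dots> = (\<Sum>b\<in>B i. \<Sum>g\<in>PiE I B. F (g(i := b)))"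
    by (simp add: sum.cartesian_product)
  finally show ?thesis .
qed

text \<open>
  \<open>smean I\<close> is the mean over independent uniform signs indexed by \<open>I\<close>; all probability
  in this theory consists of finite sums.
\<close>

abbreviation signs :: "'i set \<Rightarrow> ('i \<Rightarrow> real) set" where
  "signs I \<equiv> I \<rightarrow>\<^sub>E {-1, 1}"

definition smean :: "'i set \<Rightarrow> (('i \<Rightarrow> real) \<Rightarrow> real) \<Rightarrow> real" where
  "smean I F = (\<Sum>e\<in>signs I. F e) / 2 ^ card I"

lemma card_signs: "finite I \<Longrightarrow> card (signs I) = 2 ^ card I"
  by (simp add: card_funcsetE numeral_2_eq_2)

lemma finite_signs: "finite I \<Longrightarrow> finite (signs I)"
  by (simp add: finite_PiE)

lemma smean_insert:
  assumes "finite I" "i \<notin> I"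
  shows "smean (insert i I) F = (smean I (\<lambda>e. F (e(i := 1))) + smean I (\<lambda>e. F (e(i := -1)))) / 2"
  using assms by (simp add: smean_def sum_PiE_insert add_divide_distrib)

lemma smean_empty: "smean {} F = F (\<lambda>_. undefined)"
  by (simp add: smean_def)

lemma smean_add: "smean I (\<lambda>e. F e + G e) = smean I F + smean I G"
  by (simp add: smean_def sum.distrib add_divide_distrib)

lemma smean_cmult: "smean I (\<lambda>e. c * F e) = c * smean I F"
  by (simp add: smean_def sum_distrib_left)

lemma smean_sum: "smean I (\<lambda>e. \<Sum>j\<in>J. F j e) = (\<Sum>j\<in>J. smean I (F j))"
  unfolding smean_def by (subst sum.swap) (simp add: sum_divide_distrib)

lemma smean_mono: "(\<And>e. e \<in> signs I \<Longrightarrow> F e \<le> G e) \<Longrightarrow> smean I F \<le> smean I G"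
  unfolding smean_def by (intro divide_right_mono sum_mono) auto

lemma smean_const: "finite I \<Longrightarrow> smean I (\<lambda>_. c) = c"
  by (simp add: smean_def card_signs)

lemma sum_insert_upd:
  fixes c :: "'i \<Rightarrow> real"
  assumes "finite I" "i \<notin> I"
  shows "(\<Sum>k\<in>insert i I. c k * (e(i := b)) k) = c i * b + (\<Sum>k\<in>I. c k * e k)"
proof -
  have "(\<Sum>k\<in>I. c k * (e(i := b)) k) = (\<Sum>k\<in>I. c k * e k)"
    using assms by (intro sum.cong) auto
  then show ?thesis using assms by simp
qed

text \<open>Orthonormality of independent signs: averaging over the sign of the new coordinate
  cancels the mixed terms and leaves \<open>c i * d i\<close>.\<close>

lemma smean_inner:
  assumes "finite I"
  shows "smean I (\<lambda>e. (\<Sum>i\<in>I. c i * e i) * (\<Sum>i\<in>I. d i * e i)) = (\<Sum>i\<in>I. c i * d i)"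
  using assms
proof (induction I rule: finite_induct)
  case empty
  then show ?case by (simp add: smean_empty)
next
  case (insert i I)
  let ?X = "\<lambda>e. (\<Sum>i\<in>I. c i * e i)" and ?Y = "\<lambda>e. (\<Sum>i\<in>I. d i * e i)"
  have "smean (insert i I) (\<lambda>e. (\<Sum>i\<in>insert i I. c i * e i) * (\<Sum>i\<in>insert i I. d i * e i))
     = (smean I (\<lambda>e. (c i * 1 + ?X e) * (d i * 1 + ?Y e)) + smean I (\<lambda>e. (c i * (-1) + ?X e) * (d
         i * (-1) + ?Y e))) / 2"
    unfolding smean_insert[OF insert(1,2)] sum_insert_upd[OF insert(1,2)] by (rule refl)
  also have "\<dots> = (1/2) * smean I (\<lambda>e. (c i * 1 + ?X e) * (d i * 1 + ?Y e) + (c i * (-1) + ?X e) *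
      (d i * (-1) + ?Y e))"
    by (simp only: smean_add)
  also have "\<dots> = smean I (\<lambda>e. ?X e * ?Y e + c i * d i)"
    unfolding smean_cmult[symmetric]
    by (intro arg_cong[where f = "smean I"] ext) (simp add: algebra_simps)
  also have "\<dots> = (\<Sum>i\<in>I. c i * d i) + c i * d i"
    using insert by (simp add: smean_add smean_const)
  finally show ?case using insert by simp
qed

text \<open>Khinchin's inequality with exponent 4. Only even powers of the new term survive the
  average over its sign, namely X^4 + 6 c^2 X^2 + c^4; enlarging c^4 to 3 c^4 completes the
  square.\<close>

lemma smean_fourth:
  assumes "finite I"
  shows "smean I (\<lambda>e. (\<Sum>i\<in>I. c i * e i) ^ 4) \<le> 3 * (\<Sum>i\<in>I. (c i)\<^sup>2)\<^sup>2"
  using assms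
proof (induction I rule: finite_induct)
  case empty
  then show ?case by (simp add: smean_empty)
next
  case (insert i I)
  let ?X = "\<lambda>e. (\<Sum>i\<in>I. c i * e i)" and ?S = "\<Sum>i\<in>I. (c i)\<^sup>2"
  have "smean (insert i I) (\<lambda>e. (\<Sum>i\<in>insert i I. c i * e i) ^ 4)
     = (smean I (\<lambda>e. (c i * 1 + ?X e) ^ 4) + smean I (\<lambda>e. (c i * (-1) + ?X e) ^ 4)) / 2"
    unfolding smean_insert[OF insert(1,2)] sum_insert_upd[OF insert(1,2)] by (rule refl)
  also have "\<dots> = (1/2) * smean I (\<lambda>e. (c i * 1 + ?X e) ^ 4 + (c i * (-1) + ?X e) ^ 4)"
    by (simp only: smean_add)
  also have "\<dots> = smean I (\<lambda>e. ?X e ^ 4 + (6 * (c i)\<^sup>2 * (?X e * ?X e) + c i ^ 4))"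
    unfolding smean_cmult[symmetric]
    by (intro arg_cong[where f = "smean I"] ext) (simp add: algebra_simps power4_eq_xxxx
        power2_eq_square)
  also have "\<dots> = smean I (\<lambda>e. ?X e ^ 4) + (6 * (c i)\<^sup>2 * ?S + c i ^ 4)"
    using insert by (simp add: smean_add smean_const smean_cmult smean_inner power2_eq_square)
  also have "\<dots> \<le> 3 * ?S\<^sup>2 + (6 * (c i)\<^sup>2 * ?S + 3 * c i ^ 4)"
    using insert by (intro add_mono) auto
  also have "\<dots> = 3 * (\<Sum>i\<in>insert i I. (c i)\<^sup>2)\<^sup>2"
    using insert by (simp add: power2_eq_square algebra_simps power4_eq_xxxx)
  finally show ?case .
qed

text \<open>
  The \<open>p\<close>-th power of the weak \<open>p\<close>-norm of \<open>x\<close> is at most \<open>W\<close>; testing against real \<open>\<phi>\<close> suffices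
  also for complex scalars, up to a constant.
\<close>

definition wkf :: "real \<Rightarrow> real \<Rightarrow> 'j set \<Rightarrow> 'a set \<Rightarrow> ('j \<Rightarrow> 'a \<Rightarrow> real) \<Rightarrow> bool" where
  "wkf p W J A x \<longleftrightarrow>
     (\<forall>\<phi>. (\<forall>a\<in>A. \<bar>\<phi> a\<bar> \<le> 1) \<longrightarrow> (\<Sum>j\<in>J. \<bar>\<Sum>a\<in>A. x j a * \<phi> a\<bar> powr p) \<le> W)"

lemma wkfD: "wkf p W J A x \<Longrightarrow> (\<And>a. a \<in> A \<Longrightarrow> \<bar>\<phi> a\<bar> \<le> 1) \<Longrightarrow>
    (\<Sum>j\<in>J. \<bar>\<Sum>a\<in>A. x j a * \<phi> a\<bar> powr p) \<le> W"
  by (auto simp: wkf_def)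

section \<open>Truncation and self-improvement in Grothendieck's inequality\<close>

definition clip :: "real \<Rightarrow> real \<Rightarrow> real" where
  "clip M x = max (- M) (min M x)"

text \<open>The remainder vanishes for |x| \<le> M, and beyond M one has x^2 \<le> x^4 / M^2. The
  third bound thus converts a fourth moment into a small L_2 norm.\<close>

lemma clip_bounds:
  assumes "M > 0"
  shows "\<bar>clip M x\<bar> \<le> M" "\<bar>clip M x\<bar> \<le> \<bar>x\<bar>" "(x - clip M x)\<^sup>2 \<le> x ^ 4 / M\<^sup>2"
proof -
  show "\<bar>clip M x\<bar> \<le> M" "\<bar>clip M x\<bar> \<le> \<bar>x\<bar>" using assms by (auto simp: clip_def)
  show "(x - clip M x)\<^sup>2 \<le> x ^ 4 / M\<^sup>2"
  proof (cases "\<bar>x\<bar> \<le> M")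
    case True
    then have "x - clip M x = 0" by (auto simp: clip_def)
    then show ?thesis by simp
  next
    case False
    then have "\<bar>x - clip M x\<bar> \<le> \<bar>x\<bar>" using assms by (auto simp: clip_def)
    then have "(x - clip M x)\<^sup>2 \<le> x\<^sup>2" by (simp add: abs_le_square_iff)
    moreover have "x\<^sup>2 * M\<^sup>2 \<le> x\<^sup>2 * x\<^sup>2"
      using False assms by (intro mult_left_mono) (auto simp flip: abs_le_square_iff)
    then have "x\<^sup>2 \<le> x ^ 4 / M\<^sup>2"
      using assms by (simp add: field_simps flip: power_add)
    ultimately show ?thesis by linarith
  qed
qed

text \<open>
  The values of the form \<open>x\<close> on unit vectors of Hilbert spaces of all finite dimensions. Allowing
      every
  dimension lets the truncation errors in the proof of Grothendieck's inequality be estimated by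
  the same supremum, with a factor below 1.
\<close>

definition form_values :: "'j set \<Rightarrow> 'a set \<Rightarrow> ('j \<Rightarrow> 'a \<Rightarrow> real) \<Rightarrow> real set" where
  "form_values J A x = {v. \<exists>(L::nat) t g. (\<forall>a\<in>A. (\<Sum>i<L. (t a i)\<^sup>2) \<le> 1) \<and> (\<forall>j\<in>J. (\<Sum>i<L. (g j i)\<^sup>2)
      \<le> 1) \<and>
     v = (\<Sum>j\<in>J. \<Sum>a\<in>A. x j a * (\<Sum>i<L. t a i * g j i))}"

text \<open>The bound comes from Cauchy-Schwarz and depends on \<open>x\<close>. Its purpose is that
  \<open>Sup\<close> is a genuine supremum, half of which can later be absorbed.\<close>

lemma form_values_bdd: "finite J \<Longrightarrow> finite A \<Longrightarrow> bdd_above (form_values J A x)"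
proof (rule bdd_aboveI)
  fix v assume "v \<in> form_values J A x"
  then obtain L :: nat and t g where
      "(\<forall>a\<in>A. (\<Sum>i<L. (t a i)\<^sup>2) \<le> 1) \<and> (\<forall>j\<in>J. (\<Sum>i<L. (g j i)\<^sup>2) \<le> 1) \<and>
        v = (\<Sum>j\<in>J. \<Sum>a\<in>A. x j a * (\<Sum>i<L. t a i * g j i))"
    unfolding form_values_def mem_Collect_eq by (elim exE) (rule that)
  then have t: "\<And>a. a \<in> A \<Longrightarrow> (\<Sum>i<L. (t a i)\<^sup>2) \<le> 1"
    and g: "\<And>j. j \<in> J \<Longrightarrow> (\<Sum>i<L. (g j i)\<^sup>2) \<le> 1"
    and v: "v = (\<Sum>j\<in>J. \<Sum>a\<in>A. x j a * (\<Sum>i<L. t a i * g j i))"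
    by auto
  have "\<bar>\<Sum>i<L. t a i * g j i\<bar> \<le> 1" if "a \<in> A" "j \<in> J" for a j
  proof -
    have "(\<Sum>i<L. t a i * g j i)\<^sup>2 \<le> (\<Sum>i<L. (t a i)\<^sup>2) * (\<Sum>i<L. (g j i)\<^sup>2)"
      by (rule Cauchy_Schwarz_ineq_sum)
    also have "\<dots> \<le> 1 * 1" using t[OF that(1)] g[OF that(2)] by (intro mult_mono) (auto intro:
        sum_nonneg)
    finally show ?thesis by (simp add: abs_square_le_1)
  qed
  then have "\<bar>x j a\<bar> * \<bar>\<Sum>i<L. t a i * g j i\<bar> \<le> \<bar>x j a\<bar> * 1" if "a \<in> A" "j \<in> J" for a j
    using that by (intro mult_left_mono) auto
  then have "x j a * (\<Sum>i<L. t a i * g j i) \<le> \<bar>x j a\<bar>" if "a \<in> A" "j \<in> J" for a j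
    using that by (auto simp: abs_mult[symmetric] intro: order.trans[OF abs_ge_self])
  then show "v \<le> (\<Sum>j\<in>J. \<Sum>a\<in>A. \<bar>x j a\<bar>)" unfolding v by (intro sum_mono)
qed

text \<open>Homogeneity in both families of vectors, with coordinates indexed by an arbitrary finite
  set, which is enumerated to fit the definition.\<close>

lemma form_values_scaled:
  assumes "finite J" "finite A" "finite I" "\<alpha> > 0" "\<beta> > 0"
    and t: "\<And>a. a \<in> A \<Longrightarrow> (\<Sum>i\<in>I. (t a i)\<^sup>2) \<le> \<alpha>\<^sup>2"
    and g: "\<And>j. j \<in> J \<Longrightarrow> (\<Sum>i\<in>I. (g j i)\<^sup>2) \<le> \<beta>\<^sup>2"
  shows "(\<Sum>j\<in>J. \<Sum>a\<in>A. x j a * (\<Sum>i\<in>I. t a i * g j i)) \<le> \<alpha> * \<beta> * Sup (form_values J A x)"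
proof -
  obtain h where h: "bij_betw h {..<card I} I"
    using assms(3) ex_bij_betw_nat_finite lessThan_atLeast0 by metis
  let ?t = "\<lambda>a i. t a (h i) / \<alpha>" and ?g = "\<lambda>j i. g j (h i) / \<beta>"
  have s: "(\<Sum>i<card I. F (h i)) = (\<Sum>i\<in>I. F i)" for F :: "_ \<Rightarrow> real"
    by (rule sum.reindex_bij_betw[OF h])
  have ta: "(\<Sum>i<card I. (?t a i)\<^sup>2) \<le> 1" if "a \<in> A" for a
  proof -
    have "(\<Sum>i<card I. (?t a i)\<^sup>2) = (\<Sum>i\<in>I. (t a i / \<alpha>)\<^sup>2)" by (rule s)
    also have "\<dots> = (\<Sum>i\<in>I. (t a i)\<^sup>2) / \<alpha>\<^sup>2" by (simp add: power_divide sum_divide_distrib)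
    also have "\<dots> \<le> 1" using t[OF that] assms by simp
    finally show ?thesis .
  qed
  have ga: "(\<Sum>i<card I. (?g j i)\<^sup>2) \<le> 1" if "j \<in> J" for j
  proof -
    have "(\<Sum>i<card I. (?g j i)\<^sup>2) = (\<Sum>i\<in>I. (g j i / \<beta>)\<^sup>2)" by (rule s)
    also have "\<dots> = (\<Sum>i\<in>I. (g j i)\<^sup>2) / \<beta>\<^sup>2" by (simp add: power_divide sum_divide_distrib)
    also have "\<dots> \<le> 1" using g[OF that] assms by simp
    finally show ?thesis .
  qed
  have "(\<Sum>j\<in>J. \<Sum>a\<in>A. x j a * (\<Sum>i<card I. ?t a i * ?g j i)) \<in> form_values J A x"
    unfolding form_values_def mem_Collect_eq
    by (intro exI[of _ "card I"] exI[of _ ?t] exI[of _ ?g] conjI ballI refl ta ga)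
  then have le: "(\<Sum>j\<in>J. \<Sum>a\<in>A. x j a * (\<Sum>i<card I. ?t a i * ?g j i)) \<le> Sup (form_values J A x)"
    using form_values_bdd[OF assms(1,2)] by (rule cSup_upper)
  have eq: "(\<Sum>i<card I. ?t a i * ?g j i) = (\<Sum>i\<in>I. t a i * g j i) / (\<alpha> * \<beta>)" for a j
  proof -
    have "(\<Sum>i<card I. ?t a i * ?g j i) = (\<Sum>i\<in>I. (t a i / \<alpha>) * (g j i / \<beta>))" by (rule s)
    also have "\<dots> = (\<Sum>i\<in>I. t a i * g j i) / (\<alpha> * \<beta>)" by (simp add: sum_divide_distrib)
    finally show ?thesis .
  qed
  have "(\<Sum>j\<in>J. \<Sum>a\<in>A. x j a * (\<Sum>i<card I. ?t a i * ?g j i))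
      = (\<Sum>j\<in>J. \<Sum>a\<in>A. x j a * ((\<Sum>i\<in>I. t a i * g j i) / (\<alpha> * \<beta>)))"
    by (intro sum.cong refl arg_cong2[where f = "(*)"] eq)
  also have "\<dots> = (\<Sum>j\<in>J. \<Sum>a\<in>A. x j a * (\<Sum>i\<in>I. t a i * g j i)) / (\<alpha> * \<beta>)"
    unfolding sum_divide_distrib[of _ J] sum_divide_distrib[of _ A] times_divide_eq_right by (rule
        refl)
  finally have "(\<Sum>j\<in>J. \<Sum>a\<in>A. x j a * (\<Sum>i\<in>I. t a i * g j i)) / (\<alpha> * \<beta>) \<le> Sup (form_values J A x)"
    using le by linarith
  moreover have c: "\<alpha> * \<beta> > 0" using assms by simp
  ultimately show ?thesis unfolding pos_divide_le_eq[OF c] by (subst mult.commute)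
qed

text \<open>Random variables on the signs are vectors of dimension \<open>2 ^ card I\<close>; the
  uniform weight is shared between the two factors through \<open>s\<close>.\<close>

lemma form_values_scaled_smean:
  assumes "finite J" "finite A" "finite I" "\<alpha> > 0" "\<beta> > 0"
    and t: "\<And>a. a \<in> A \<Longrightarrow> smean I (\<lambda>e. (t a e)\<^sup>2) \<le> \<alpha>\<^sup>2"
    and g: "\<And>j. j \<in> J \<Longrightarrow> smean I (\<lambda>e. (g j e)\<^sup>2) \<le> \<beta>\<^sup>2"
  shows "(\<Sum>j\<in>J. \<Sum>a\<in>A. x j a * smean I (\<lambda>e. t a e * g j e)) \<le> \<alpha> * \<beta> * Sup (form_values J A x)"
proof -
  define s where "s = sqrt (2 ^ card I)"
  have s: "s > 0" "s\<^sup>2 = 2 ^ card I" by (auto simp: s_def)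
  have r: "smean I F = (\<Sum>e\<in>signs I. F e / s\<^sup>2)" for F
    by (simp add: smean_def s(2) sum_divide_distrib)
  have "(\<Sum>j\<in>J. \<Sum>a\<in>A. x j a * (\<Sum>e\<in>signs I. (t a e / s) * (g j e / s))) \<le> \<alpha> * \<beta> * Sup (form_values J
      A x)"
    using t g assms(1-5) by (intro form_values_scaled) (auto simp: r power_divide finite_signs)
  then show ?thesis using s by (simp add: r power2_eq_square)
qed

text \<open>Inner products become covariances of Rademacher sums. The clipped sums are bounded
  functions, to which the weak 1-norm applies pointwise; the two remainders cost at most Sup/4 each.
  Hence Sup \<le> 48 + Sup/2.\<close>

lemma form_values_le:
  assumes "finite J" "finite A" and w: "wkf 1 1 J A x"
  shows "Sup (form_values J A x) \<le> 96"
proof -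
  \<comment> \<open>The fourth moment of a normalised sum is at most 3, so the clipped-off part has
    squared L_2 norm at most 3/48 = (1/4)^2.\<close>
  define M :: real where "M = sqrt 48"
  have M: "M > 0" "M\<^sup>2 = 48" by (auto simp: M_def)
  have "v \<le> 48 + Sup (form_values J A x) / 2" if vin: "v \<in> form_values J A x" for v
  proof -
    obtain L :: nat and t g where
      "(\<forall>a\<in>A. (\<Sum>i<L. (t a i)\<^sup>2) \<le> 1) \<and> (\<forall>j\<in>J. (\<Sum>i<L. (g j i)\<^sup>2) \<le> 1) \<and>
        v = (\<Sum>j\<in>J. \<Sum>a\<in>A. x j a * (\<Sum>i<L. t a i * g j i))"
    using vin unfolding form_values_def mem_Collect_eq by (elim exE) (rule that)
  then have t: "\<And>a. a \<in> A \<Longrightarrow> (\<Sum>i<L. (t a i)\<^sup>2) \<le> 1"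
    and g: "\<And>j. j \<in> J \<Longrightarrow> (\<Sum>i<L. (g j i)\<^sup>2) \<le> 1"
    and v: "v = (\<Sum>j\<in>J. \<Sum>a\<in>A. x j a * (\<Sum>i<L. t a i * g j i))"
    by auto
    let ?R = "smean {..<L}"
    define X where "X a e = (\<Sum>i<L. t a i * e i)" for a and e :: "nat \<Rightarrow> real"
    define Y where "Y j e = (\<Sum>i<L. g j i * e i)" for j and e :: "nat \<Rightarrow> real"
    have rest: "?R (\<lambda>e. ((\<Sum>i<L. c i * e i) - clip M (\<Sum>i<L. c i * e i))\<^sup>2) \<le> (1/4)\<^sup>2"
      if "(\<Sum>i<L. (c i)\<^sup>2) \<le> 1" for c
    proof -
      have "?R (\<lambda>e. ((\<Sum>i<L. c i * e i) - clip M (\<Sum>i<L. c i * e i))\<^sup>2) \<le> ?R (\<lambda>e. (1 / M\<^sup>2) * (\<Sum>i<L.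
          c i * e i) ^ 4)"
        using clip_bounds(3)[OF M(1)] by (intro smean_mono) auto
      also have "\<dots> = (1 / M\<^sup>2) * ?R (\<lambda>e. (\<Sum>i<L. c i * e i) ^ 4)" by (rule smean_cmult)
      also have "\<dots> \<le> (1 / M\<^sup>2) * (3 * (\<Sum>i<L. (c i)\<^sup>2)\<^sup>2)"
        by (intro mult_left_mono smean_fourth) auto
      also have "\<dots> \<le> (1 / M\<^sup>2) * (3 * 1\<^sup>2)"
        using that by (intro mult_left_mono power_mono) (auto intro: sum_nonneg)
      also have "\<dots> = (1/4)\<^sup>2" unfolding M(2) by (simp add: power_divide)
      finally show ?thesis .
    qed
    have full: "?R (\<lambda>e. (\<Sum>i<L. c i * e i)\<^sup>2) \<le> 1\<^sup>2" if "(\<Sum>i<L. (c i)\<^sup>2) \<le> 1" for c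
      using that smean_inner[of "{..<L}" c c] by (simp add: power2_eq_square)
    have clp: "?R (\<lambda>e. (clip M (\<Sum>i<L. c i * e i))\<^sup>2) \<le> 1\<^sup>2" if "(\<Sum>i<L. (c i)\<^sup>2) \<le> 1" for c
      using clip_bounds(2)[OF M(1)] by (intro order.trans[OF smean_mono full[OF that]]) (simp add:
          abs_le_square_iff)
    let ?S = "\<lambda>F G. \<Sum>j\<in>J. \<Sum>a\<in>A. x j a * ?R (\<lambda>e. F a e * G j e)"
    have "v = (\<Sum>j\<in>J. \<Sum>a\<in>A. x j a * ?R (\<lambda>e. X a e * Y j e))"
      unfolding v X_def Y_def by (subst smean_inner) auto
    \<comment> \<open>The product X Y is telescoped so that each error term contains one remainder
      of L_2 norm at most 1/4 and one factor of norm at most 1.\<close>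
    also have "\<dots> = (\<Sum>j\<in>J. \<Sum>a\<in>A. x j a * ?R (\<lambda>e. clip M (X a e) * clip M (Y j e) +
         ((X a e - clip M (X a e)) * clip M (Y j e) + X a e * (Y j e - clip M (Y j e)))))"
      by (simp add: algebra_simps)
    also have "\<dots> = ?S (\<lambda>a e. clip M (X a e)) (\<lambda>j e. clip M (Y j e))
        + (?S (\<lambda>a e. X a e - clip M (X a e)) (\<lambda>j e. clip M (Y j e))
        + ?S X (\<lambda>j e. Y j e - clip M (Y j e)))"
      by (simp only: smean_add distrib_left sum.distrib)
    also have "?S (\<lambda>a e. X a e - clip M (X a e)) (\<lambda>j e. clip M (Y j e)) \<le> 1/4 * 1 * Sup
        (form_values J A x)"
      unfolding X_def Y_def using assms t g by (intro form_values_scaled_smean rest clp) auto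
    also have "?S X (\<lambda>j e. Y j e - clip M (Y j e)) \<le> 1 * (1/4) * Sup (form_values J A x)"
      unfolding X_def Y_def using assms t g by (intro form_values_scaled_smean rest full) auto
    also have "?S (\<lambda>a e. clip M (X a e)) (\<lambda>j e. clip M (Y j e)) \<le> 48"
    proof -
      have "?S (\<lambda>a e. clip M (X a e)) (\<lambda>j e. clip M (Y j e))
          = ?R (\<lambda>e. \<Sum>j\<in>J. \<Sum>a\<in>A. x j a * (clip M (X a e) * clip M (Y j e)))"
        by (simp only: smean_sum smean_cmult)
      also have "\<dots> \<le> ?R (\<lambda>e. 48)"
      proof (rule smean_mono)
        fix e :: "nat \<Rightarrow> real"
        \<comment> \<open>For a fixed sign vector, \<open>clip M (X a e) / M\<close> is an
          admissible test and \<open>clip M (Y j e) / M\<close> a coefficient of modulus at most 1.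
          The two normalisations produce the factor M^2 = 48.\<close>
        have "(\<Sum>j\<in>J. \<Sum>a\<in>A. x j a * (clip M (X a e) * clip M (Y j e)))
           = (\<Sum>j\<in>J. M\<^sup>2 * ((clip M (Y j e) / M) * (\<Sum>a\<in>A. x j a * (clip M (X a e) / M))))"
          using M(1) by (simp add: sum_distrib_left power2_eq_square mult_ac)
        also have "\<dots> \<le> (\<Sum>j\<in>J. M\<^sup>2 * \<bar>\<Sum>a\<in>A. x j a * (clip M (X a e) / M)\<bar>)"
        proof (intro sum_mono mult_left_mono)
          fix j
          have "\<bar>clip M (Y j e) / M\<bar> \<le> 1" using clip_bounds(1)[OF M(1)] M(1) by simp
          then have "\<bar>clip M (Y j e) / M\<bar> * \<bar>\<Sum>a\<in>A. x j a * (clip M (X a e) / M)\<bar> \<le> 1 * \<bar>\<Sum>a\<in>A. x j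
              a * (clip M (X a e) / M)\<bar>"
            by (intro mult_right_mono) auto
          then show "clip M (Y j e) / M * (\<Sum>a\<in>A. x j a * (clip M (X a e) / M)) \<le> \<bar>\<Sum>a\<in>A. x j a *
              (clip M (X a e) / M)\<bar>"
            by (simp only: abs_mult[symmetric] mult_1)
        qed simp
        also have "\<dots> = M\<^sup>2 * (\<Sum>j\<in>J. \<bar>\<Sum>a\<in>A. x j a * (clip M (X a e) / M)\<bar> powr 1)"
          by (simp add: sum_distrib_left)
        also have "\<dots> \<le> M\<^sup>2 * 1"
          using clip_bounds(1)[OF M(1)] M(1) by (intro mult_left_mono wkfD[OF w]) auto
        finally show "(\<Sum>j\<in>J. \<Sum>a\<in>A. x j a * (clip M (X a e) * clip M (Y j e))) \<le> 48"
          using M by simp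
      qed
      finally show ?thesis by (simp add: smean_const)
    qed
    finally show ?thesis by linarith
  qed
  moreover have "0 \<in> form_values J A x"
    unfolding form_values_def mem_Collect_eq
    by (rule exI[of _ 0], rule exI[of _ "\<lambda>_ _. 0"], rule exI[of _ "\<lambda>_ _. 0"]) simp
  then have "form_values J A x \<noteq> {}" by blast
  ultimately have "Sup (form_values J A x) \<le> 48 + Sup (form_values J A x) / 2" by (intro cSup_least)
  then show ?thesis by linarith
qed

text \<open>The form is evaluated at the unit vectors \<open>g j\<close> in the direction of the
  image vectors \<open>v j\<close>, which turns inner products into norms. A zero \<open>v j\<close>
  gives a zero \<open>g j\<close> by the convention for division.\<close>

lemma grothendieck:
  assumes "finite J" "finite A" "finite I" and w: "wkf 1 W J A x" and "W > 0"
    and t: "\<And>a. a \<in> A \<Longrightarrow> (\<Sum>i\<in>I. (t a i)\<^sup>2) \<le> 1"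
  shows "(\<Sum>j\<in>J. sqrt (\<Sum>i\<in>I. (\<Sum>a\<in>A. x j a * t a i)\<^sup>2)) \<le> 96 * W"
proof -
  define v where "v j i = (\<Sum>a\<in>A. x j a * t a i)" for j i
  define g where "g j i = v j i / sqrt (\<Sum>i\<in>I. (v j i)\<^sup>2)" for j i
  have w': "wkf 1 1 J A (\<lambda>j a. x j a / W)"
    unfolding wkf_def
  proof (intro allI impI)
    fix \<phi> :: "_ \<Rightarrow> real" assume "\<forall>a\<in>A. \<bar>\<phi> a\<bar> \<le> 1"
    then have "(\<Sum>j\<in>J. \<bar>\<Sum>a\<in>A. x j a * \<phi> a\<bar> powr 1) \<le> W" using w by (auto simp: wkf_def)
    moreover have "(\<Sum>a\<in>A. x j a / W * \<phi> a) = (\<Sum>a\<in>A. x j a * \<phi> a) / W" for j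
      by (simp add: sum_divide_distrib)
    ultimately show "(\<Sum>j\<in>J. \<bar>\<Sum>a\<in>A. x j a / W * \<phi> a\<bar> powr 1) \<le> 1"
      using \<open>W > 0\<close> by (simp add: abs_divide flip: sum_divide_distrib)
  qed
  have gg: "(\<Sum>i\<in>I. (g j i)\<^sup>2) \<le> 1\<^sup>2" for j
    by (simp add: g_def power_divide sum_nonneg flip: sum_divide_distrib)
  have vg: "(\<Sum>i\<in>I. v j i * g j i) = sqrt (\<Sum>i\<in>I. (v j i)\<^sup>2)" for j
  proof -
    have "(\<Sum>i\<in>I. v j i * g j i) = (\<Sum>i\<in>I. (v j i)\<^sup>2) / sqrt (\<Sum>i\<in>I. (v j i)\<^sup>2)"
      by (simp add: g_def power2_eq_square sum_divide_distrib)
    then show ?thesis by (simp add: sum_nonneg real_div_sqrt)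
  qed
  have "(\<Sum>j\<in>J. \<Sum>a\<in>A. x j a / W * (\<Sum>i\<in>I. t a i * g j i)) \<le> 1 * 1 * Sup (form_values J A (\<lambda>j a. x j
      a / W))"
    using assms gg by (intro form_values_scaled) auto
  also have "\<dots> \<le> 96" using form_values_le[OF assms(1,2) w'] by simp
  finally have "(\<Sum>j\<in>J. \<Sum>a\<in>A. x j a / W * (\<Sum>i\<in>I. t a i * g j i)) \<le> 96" .
  moreover have "(\<Sum>j\<in>J. \<Sum>a\<in>A. x j a / W * (\<Sum>i\<in>I. t a i * g j i)) = (\<Sum>j\<in>J. sqrt (\<Sum>i\<in>I. (v j i)\<^sup>2))
      / W"
  proof -
    have "(\<Sum>a\<in>A. x j a / W * (\<Sum>i\<in>I. t a i * g j i)) = (\<Sum>i\<in>I. v j i * g j i) / W" for j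
      unfolding v_def sum_distrib_left sum_distrib_right sum_divide_distrib
      by (subst sum.swap) (simp add: mult_ac)
    then show ?thesis by (simp add: vg sum_divide_distrib)
  qed
  ultimately have "(\<Sum>j\<in>J. sqrt (\<Sum>i\<in>I. (v j i)\<^sup>2)) / W \<le> 96" by simp
  then show ?thesis using \<open>W > 0\<close> by (simp add: v_def pos_divide_le_eq)
qed

text \<open>The exponent p is reduced to 1 by weighting \<open>x j\<close> with
  \<open>n j powr (p - 1)\<close>, after which the sum of the norms is \<open>S\<close> itself.
  Young's inequality bounds the weak 1-norm of the weighted sequence, with a share of
  \<open>S\<close> small enough to be absorbed.\<close>

lemma grothendieck_powr:
  assumes "finite J" "finite A" "finite I" and w: "wkf p 1 J A x" and "p \<ge> 1"
    and t: "\<And>a. a \<in> A \<Longrightarrow> (\<Sum>i\<in>I. (t a i)\<^sup>2) \<le> 1"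
  shows "(\<Sum>j\<in>J. sqrt (\<Sum>i\<in>I. (\<Sum>a\<in>A. x j a * t a i)\<^sup>2) powr p) \<le> 192 powr p"
proof -
  define n where "n j = sqrt (\<Sum>i\<in>I. (\<Sum>a\<in>A. x j a * t a i)\<^sup>2)" for j
  have n0: "n j \<ge> 0" for j by (simp add: n_def sum_nonneg)
  define S where "S = (\<Sum>j\<in>J. n j powr p)"
  \<comment> \<open>Since 96 / 192 = 1/2, Grothendieck's inequality yields S \<le> S/2 + 96 * 192
    powr (p - 1), hence S \<le> 192 powr p.\<close>
  define W where "W = S / 192 + 192 powr (p - 1)"
  have S0: "S \<ge> 0" by (simp add: S_def sum_nonneg)
  have W: "W > 0" using S0 by (simp add: W_def add_nonneg_pos)
  have young: "n j powr (p - 1) * c \<le> n j powr p / 192 + 192 powr (p - 1) * c powr p" if "c \<ge> 0"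
      for j c
  proof (cases "n j = 0 \<or> c = 0")
    case False
    then have pos: "n j > 0" "c > 0" using n0[of j] that by auto
    show ?thesis
    proof (cases "c \<le> n j / 192")
      case True
      then have "n j powr (p - 1) * c \<le> n j powr (p - 1) * (n j / 192)" by (intro mult_left_mono)
          auto
      also have "\<dots> = n j powr p / 192" using pos by (simp add: powr_diff)
      finally show ?thesis by (simp add: add_increasing2)
    next
      case False
      then have "n j powr (p - 1) * c \<le> (192 * c) powr (p - 1) * c"
        using pos \<open>p \<ge> 1\<close> by (intro mult_right_mono powr_mono2) auto
      also have "\<dots> = 192 powr (p - 1) * c powr p" using pos by (simp add: powr_mult powr_diff)
      finally show ?thesis by (simp add: add_increasing)
    qed
  qed auto
  have "wkf 1 W J A (\<lambda>j a. n j powr (p - 1) * x j a)"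
    unfolding wkf_def
  proof (intro allI impI)
    fix \<phi> :: "_ \<Rightarrow> real" assume phi: "\<forall>a\<in>A. \<bar>\<phi> a\<bar> \<le> 1"
    have "(\<Sum>j\<in>J. \<bar>\<Sum>a\<in>A. n j powr (p - 1) * x j a * \<phi> a\<bar> powr 1)
        = (\<Sum>j\<in>J. n j powr (p - 1) * \<bar>\<Sum>a\<in>A. x j a * \<phi> a\<bar>)"
      by (simp add: mult.assoc abs_mult flip: sum_distrib_left)
    also have "\<dots> \<le> (\<Sum>j\<in>J. n j powr p / 192 + 192 powr (p - 1) * \<bar>\<Sum>a\<in>A. x j a * \<phi> a\<bar> powr p)"
      by (intro sum_mono young) auto
    also have "\<dots> = S / 192 + 192 powr (p - 1) * (\<Sum>j\<in>J. \<bar>\<Sum>a\<in>A. x j a * \<phi> a\<bar> powr p)"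
      by (simp add: S_def sum.distrib sum_distrib_left sum_divide_distrib)
    also have "\<dots> \<le> S / 192 + 192 powr (p - 1) * 1"
      using phi by (intro add_left_mono mult_left_mono wkfD[OF w]) auto
    finally show "(\<Sum>j\<in>J. \<bar>\<Sum>a\<in>A. n j powr (p - 1) * x j a * \<phi> a\<bar> powr 1) \<le> W" by (simp add: W_def)
  qed
  from grothendieck[OF assms(1-3) this W t]
  have "(\<Sum>j\<in>J. sqrt (\<Sum>i\<in>I. (\<Sum>a\<in>A. n j powr (p - 1) * x j a * t a i)\<^sup>2)) \<le> 96 * W" by simp
  also have "(\<Sum>j\<in>J. sqrt (\<Sum>i\<in>I. (\<Sum>a\<in>A. n j powr (p - 1) * x j a * t a i)\<^sup>2)) = S"
    unfolding S_def
  proof (rule sum.cong)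
    fix j
    have "sqrt (\<Sum>i\<in>I. (\<Sum>a\<in>A. n j powr (p - 1) * x j a * t a i)\<^sup>2) = n j powr (p - 1) * n j"
      by (simp add: n_def mult.assoc power_mult_distrib real_sqrt_mult flip: sum_distrib_left)
    also have "\<dots> = n j powr p" using n0[of j] by (cases "n j = 0") (auto simp: powr_diff)
    finally show "sqrt (\<Sum>i\<in>I. (\<Sum>a\<in>A. n j powr (p - 1) * x j a * t a i)\<^sup>2) = n j powr p" .
  qed simp
  finally have "S \<le> 192 * 192 powr (p - 1)" by (simp add: W_def)
  then show ?thesis by (simp add: S_def n_def powr_diff)
qed

subsection \<open>A discrete model of stable random variables\<close>

text \<open>
  A law on \<open>{0, \<dots>, R}\<close> with \<open>P(i \<ge> k) = 2\<^sup>-\<^sup>k\<close> for \<open>k \<le> R\<close>. Hence \<open>2\<^sup>\<beta>\<^sup>i\<close> has the tail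
  \<open>t\<^sup>-\<^sup>1\<^sup>/\<^sup>\<beta>\<close> of a \<open>1/\<beta>\<close>-stable variable, up to the truncation at \<open>R\<close>.
\<close>

definition pareto :: "nat \<Rightarrow> nat \<Rightarrow> real" where
  "pareto R i = (if i = R then 1 / 2 ^ R else 1 / 2 ^ Suc i)"

lemma pareto_pos: "pareto R i > 0"
  by (simp add: pareto_def)

lemma pareto_le: "pareto R i \<le> 1 / 2 ^ i"
  by (simp add: pareto_def field_simps)

lemma pareto_ge: "pareto R i \<ge> 1 / 2 ^ Suc i"
  by (auto simp: pareto_def field_simps)

lemma pareto_tail: "k \<le> R \<Longrightarrow> (\<Sum>i\<in>{k..R}. pareto R i) = 1 / 2 ^ k"
proof (induction k rule: inc_induct)
  case base
  then show ?case by (simp add: pareto_def)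
next
  case (step n)
  have "{n..R} = insert n {Suc n..R}" using step by auto
  then have "(\<Sum>i\<in>{n..R}. pareto R i) = pareto R n + (\<Sum>i\<in>{Suc n..R}. pareto R i)" by simp
  then show ?case using step by (simp add: pareto_def)
qed

lemma pareto_sum: "(\<Sum>i\<le>R. pareto R i) = 1"
  using pareto_tail[of 0 R] by (simp add: atLeast0AtMost)

definition pmean :: "nat \<Rightarrow> 'l set \<Rightarrow> (('l \<Rightarrow> nat) \<Rightarrow> real) \<Rightarrow> real" where
  "pmean R I F = (\<Sum>z\<in>I \<rightarrow>\<^sub>E {..R}. (\<Prod>l\<in>I. pareto R (z l)) * F z)"

lemma pmean_prod:
  "finite I \<Longrightarrow> pmean R I (\<lambda>z. \<Prod>l\<in>I. g l (z l)) = (\<Prod>l\<in>I. \<Sum>i\<le>R. pareto R i * g l i)"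
  by (simp add: pmean_def prod_sum_PiE prod.distrib)

lemma pmean_add: "pmean R I (\<lambda>z. F z + G z) = pmean R I F + pmean R I G"
  by (simp add: pmean_def sum.distrib distrib_left)

lemma pmean_cmult: "pmean R I (\<lambda>z. c * F z) = c * pmean R I F"
  by (simp add: pmean_def sum_distrib_left mult_ac)

lemma pmean_sum: "pmean R I (\<lambda>z. \<Sum>j\<in>J. F j z) = (\<Sum>j\<in>J. pmean R I (F j))"
  unfolding pmean_def by (subst sum.swap) (simp add: sum_distrib_left)

lemma pmean_mono: "(\<And>z. z \<in> I \<rightarrow>\<^sub>E {..R} \<Longrightarrow> F z \<le> G z) \<Longrightarrow> pmean R I F \<le> pmean R I G"
  unfolding pmean_def by (intro sum_mono mult_left_mono prod_nonneg) (auto intro: less_imp_le[OF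
      pareto_pos])

lemma pmean_const: "finite I \<Longrightarrow> pmean R I (\<lambda>_. c) = c"
  using pmean_prod[of I R "\<lambda>_ _. 1"] pmean_cmult[of R I c "\<lambda>_. 1"] by (simp add: pareto_sum)

lemma pmean_marginal:
  assumes "finite I" "l \<in> I"
  shows "pmean R I (\<lambda>z. g (z l)) = (\<Sum>i\<le>R. pareto R i * g i)"
proof -
  have "pmean R I (\<lambda>z. g (z l)) = pmean R I (\<lambda>z. \<Prod>m\<in>I. (if m = l then g (z m) else 1))"
    using assms by (simp add: prod.delta)
  also have "\<dots> = (\<Prod>m\<in>I. \<Sum>i\<le>R. pareto R i * (if m = l then g i else 1))"
    using assms by (subst pmean_prod) auto
  also have "\<dots> = (\<Prod>m\<in>I. if m = l then (\<Sum>i\<le>R. pareto R i * g i) else 1)"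
    by (intro prod.cong) (auto simp: pareto_sum)
  finally show ?thesis using assms by (simp add: prod.delta)
qed

section \<open>Moments of linear combinations of the discrete stable variables\<close>

lemma geometric_up:
  fixes r :: real
  assumes "r > 1" "finite S" "X \<ge> 0" "\<And>i. i \<in> S \<Longrightarrow> r ^ i \<le> X"
  shows "(\<Sum>i\<in>S. r ^ i) \<le> X * r / (r - 1)"
proof (cases "S = {}")
  case False
  define n where "n = Max S"
  have n: "n \<in> S" "S \<subseteq> {..n}" using False assms(2) by (auto simp: n_def)
  have "(\<Sum>i\<le>k. r ^ i) * (r - 1) \<le> r ^ Suc k" for k
    by (induction k) (auto simp: algebra_simps)
  then have "(\<Sum>i\<le>n. r ^ i) \<le> r ^ n * r / (r - 1)"
    using assms(1) by (simp add: pos_le_divide_eq mult.commute)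
  also have "\<dots> \<le> X * r / (r - 1)"
    using assms n by (intro divide_right_mono mult_right_mono) auto
  also have "(\<Sum>i\<in>S. r ^ i) \<le> (\<Sum>i\<le>n. r ^ i)"
    using assms n by (intro sum_mono2) auto
  ultimately show ?thesis by linarith
qed (use assms in auto)

text \<open>A geometric sum over any finite set of exponents is comparable with its largest term,
  here the one with the least exponent.\<close>

lemma geometric_down:
  fixes q :: real
  assumes "0 < q" "q < 1" "finite S" "X \<ge> 0" "\<And>i. i \<in> S \<Longrightarrow> q ^ i \<le> X"
  shows "(\<Sum>i\<in>S. q ^ i) \<le> X / (1 - q)"
proof (cases "S = {}")
  case False
  define n where "n = Min S"
  define N where "N = Max S"
  have n: "n \<in> S" "S \<subseteq> {n..<n + Suc N}" using False assms(3)
    by (auto simp: n_def N_def less_Suc_eq_le intro: trans_le_add2[OF Max_ge])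
  have "(\<Sum>i\<in>{n..<n+k}. q ^ i) * (1 - q) = q ^ n - q ^ (n + k)" for k
  proof (induction k)
    case (Suc k)
    have "(\<Sum>i\<in>{n..<n+Suc k}. q ^ i) * (1 - q) = (\<Sum>i\<in>{n..<n+k}. q ^ i) * (1 - q) + q ^ (n + k) * (1
        - q)"
      by (simp add: distrib_right)
    also have "\<dots> = q ^ n - q ^ (n + Suc k)" unfolding Suc by (simp add: algebra_simps)
    finally show ?case .
  qed simp
  then have "(\<Sum>i\<in>{n..<n+Suc N}. q ^ i) * (1 - q) \<le> q ^ n"
    using assms(1) by (metis diff_le_eq less_add_same_cancel1 less_eq_real_def zero_less_power)
  then have "(\<Sum>i\<in>{n..<n+Suc N}. q ^ i) \<le> q ^ n / (1 - q)"
    using assms by (simp add: pos_le_divide_eq)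
  also have "\<dots> \<le> X / (1 - q)"
    using assms n by (intro divide_right_mono) auto
  also have "(\<Sum>i\<in>S. q ^ i) \<le> (\<Sum>i\<in>{n..<n+Suc N}. q ^ i)"
    using assms n by (intro sum_mono2) auto
  ultimately show ?thesis by linarith
qed (use assms in auto)

lemma powr_add_le:
  fixes a b s :: real
  assumes "a \<ge> 0" "b \<ge> 0" "0 < s" "s \<le> 1"
  shows "(a + b) powr s \<le> a powr s + b powr s"
proof (cases "a + b = 0")
  case True
  then show ?thesis using assms by simp
next
  case False
  then have pos: "a + b > 0" using assms by simp
  have u: "c / (a + b) \<le> (c / (a + b)) powr s" if "0 \<le> c" "c \<le> a + b" for c
    using powr_mono'[of s 1 "c / (a + b)"] that pos assms by auto
  have "1 = a / (a + b) + b / (a + b)" using pos by (simp add: add_divide_distrib[symmetric])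
  also have "\<dots> \<le> (a / (a + b)) powr s + (b / (a + b)) powr s"
    using assms by (intro add_mono u) auto
  also have "\<dots> = (a powr s + b powr s) / (a + b) powr s"
    using assms by (simp add: powr_divide add_divide_distrib)
  finally show ?thesis using pos by (simp add: field_simps)
qed

lemma powr_sum_le:
  fixes u :: "'l \<Rightarrow> real"
  assumes "finite I" "\<And>l. l \<in> I \<Longrightarrow> u l \<ge> 0" "0 < s" "s \<le> 1"
  shows "(\<Sum>l\<in>I. u l) powr s \<le> (\<Sum>l\<in>I. u l powr s)"
  using assms(1,2)
proof (induction I rule: finite_induct)
  case (insert l I)
  have "(u l + (\<Sum>l\<in>I. u l)) powr s \<le> u l powr s + (\<Sum>l\<in>I. u l) powr s"
    using insert assms by (intro powr_add_le sum_nonneg) auto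
  then show ?case using insert by (smt (verit) insertI2 sum.insert)
qed auto

text \<open>The pointwise bound |x|^\<rho> \<le> t^\<rho> + t^(\<rho> - 2) x^2, with t the standard
  deviation, reduces the moment to the variance.\<close>

lemma smean_powr:
  assumes "finite I" "0 < \<rho>" "\<rho> \<le> 2"
  shows "smean I (\<lambda>e. \<bar>\<Sum>i\<in>I. c i * e i\<bar> powr \<rho>) \<le> 2 * (\<Sum>i\<in>I. (c i)\<^sup>2) powr (\<rho> / 2)"
proof (cases "(\<Sum>i\<in>I. (c i)\<^sup>2) = 0")
  case True
  then have "c i = 0" if "i \<in> I" for i using assms that by (auto simp: sum_nonneg_eq_0_iff)
  then have "(\<Sum>i\<in>I. c i * e i) = 0" for e by (intro sum.neutral) auto
  then show ?thesis using assms by (simp add: smean_const)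
next
  case False
  define t where "t = sqrt (\<Sum>i\<in>I. (c i)\<^sup>2)"
  have t: "t > 0" using False by (simp add: t_def less_le sum_nonneg)
  have t2: "(\<Sum>i\<in>I. (c i)\<^sup>2) = t\<^sup>2" by (simp add: t_def sum_nonneg)
  have "\<bar>x\<bar> powr \<rho> \<le> t powr \<rho> + t powr (\<rho> - 2) * (x * x)" for x :: real
  proof (cases "\<bar>x\<bar> \<le> t")
    case True
    then have "\<bar>x\<bar> powr \<rho> \<le> t powr \<rho>" using assms by (intro powr_mono2) auto
    then show ?thesis by (simp add: add_increasing2)
  next
    case False
    then have "\<bar>x\<bar> powr \<rho> = \<bar>x\<bar> powr (\<rho> - 2) * \<bar>x\<bar> powr 2" by (simp only: powr_add[symmetric]) simp
    also have "\<dots> = \<bar>x\<bar> powr (\<rho> - 2) * (x * x)" using False t by (simp add: powr_numeral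
        power2_eq_square)
    also have "\<dots> \<le> t powr (\<rho> - 2) * (x * x)"
      using False t assms by (intro mult_right_mono powr_mono2') auto
    finally show ?thesis by (simp add: add_increasing)
  qed
  then have "smean I (\<lambda>e. \<bar>\<Sum>i\<in>I. c i * e i\<bar> powr \<rho>)
      \<le> smean I (\<lambda>e. t powr \<rho> + t powr (\<rho> - 2) * ((\<Sum>i\<in>I. c i * e i) * (\<Sum>i\<in>I. c i * e i)))"
    by (intro smean_mono)
  also have "\<dots> = t powr \<rho> + t powr (\<rho> - 2) * (\<Sum>i\<in>I. (c i)\<^sup>2)"
    using assms by (simp add: smean_add smean_const smean_cmult smean_inner power2_eq_square)
  also have "\<dots> = 2 * t powr \<rho>"
  proof -
    have "t powr (\<rho> - 2) * t\<^sup>2 = t powr (\<rho> - 2) * t powr 2" using t by simp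
    also have "\<dots> = t powr \<rho>" using t by (simp only: powr_add[symmetric]) simp
    finally show ?thesis by (simp add: t2)
  qed
  also have "t powr \<rho> = (\<Sum>i\<in>I. (c i)\<^sup>2) powr (\<rho> / 2)"
  proof -
    have "t\<^sup>2 = t powr 2" using t by simp
    then show ?thesis using t by (simp only: t2 powr_powr) simp
  qed
  finally show ?thesis .
qed

text \<open>Its sum over the coordinates is to dominate a power of a sum of squares, which is not
  additive. Quadratic behaviour near 0 and order \<rho> at infinity make its mean of the order
  |b|^(1/\<beta>) when \<rho> < 1/\<beta> < 2.\<close>

definition trunc_pow :: "real \<Rightarrow> real \<Rightarrow> real" where
  "trunc_pow \<rho> c = (if \<bar>c\<bar> \<le> 1 then c\<^sup>2 else \<bar>c\<bar> powr \<rho>)"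

text \<open>Coefficients of modulus at most 1 are handled by t^(\<rho>/2) \<le> 1 + t, the others by
  subadditivity of the power \<rho>/2 \<le> 1.\<close>

lemma sum_squares_powr_le:
  assumes "finite I" "0 < \<rho>" "\<rho> \<le> 2"
  shows "(\<Sum>i\<in>I. (c i)\<^sup>2) powr (\<rho> / 2) \<le> 1 + (\<Sum>i\<in>I. trunc_pow \<rho> (c i))"
proof -
  let ?A = "{i\<in>I. \<bar>c i\<bar> \<le> 1}" and ?B = "{i\<in>I. \<not> \<bar>c i\<bar> \<le> 1}"
  have I: "I = ?A \<union> ?B" by auto
  have sp: "(\<Sum>i\<in>I. F i) = (\<Sum>i\<in>?A. F i) + (\<Sum>i\<in>?B. F i)" for F :: "_ \<Rightarrow> real"
    using assms by (subst I, subst sum.union_disjoint) auto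
  have "(\<Sum>i\<in>I. (c i)\<^sup>2) powr (\<rho> / 2) \<le> (\<Sum>i\<in>?A. (c i)\<^sup>2) powr (\<rho> / 2) + (\<Sum>i\<in>?B. (c i)\<^sup>2) powr (\<rho> /
      2)"
    unfolding sp using assms by (intro powr_add_le) (auto intro: sum_nonneg)
  also have "(\<Sum>i\<in>?A. (c i)\<^sup>2) powr (\<rho> / 2) \<le> 1 + (\<Sum>i\<in>?A. (c i)\<^sup>2)"
  proof -
    have n: "(\<Sum>i\<in>?A. (c i)\<^sup>2) \<ge> 0" by (simp add: sum_nonneg)
    have "x powr (\<rho> / 2) \<le> 1 + x" if "x \<ge> 0" for x
    proof -
      have "x powr (\<rho> / 2) \<le> (1 + x) powr (\<rho> / 2)" using that assms by (intro powr_mono2) auto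
      also have "\<dots> \<le> (1 + x) powr 1" using that assms by (intro powr_mono) auto
      finally show ?thesis using that by simp
    qed
    from this[OF n] show ?thesis .
  qed
  also have "(\<Sum>i\<in>?B. (c i)\<^sup>2) powr (\<rho> / 2) \<le> (\<Sum>i\<in>?B. ((c i)\<^sup>2) powr (\<rho> / 2))"
    using assms by (intro powr_sum_le) auto
  also have "(\<Sum>i\<in>?B. ((c i)\<^sup>2) powr (\<rho> / 2)) = (\<Sum>i\<in>?B. \<bar>c i\<bar> powr \<rho>)"
  proof (rule sum.cong)
    fix i assume "i \<in> ?B"
    then have "(c i)\<^sup>2 = \<bar>c i\<bar> powr 2" by (auto simp: powr_numeral)
    then show "((c i)\<^sup>2) powr (\<rho> / 2) = \<bar>c i\<bar> powr \<rho>" by (simp only: powr_powr) simp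
  qed simp
  also have "1 + (\<Sum>i\<in>?A. (c i)\<^sup>2) + (\<Sum>i\<in>?B. \<bar>c i\<bar> powr \<rho>) = 1 + (\<Sum>i\<in>I. trunc_pow \<rho> (c i))"
    unfolding sp by (simp add: trunc_pow_def)
  finally show ?thesis by simp
qed

text \<open>The sum over scales splits where |b| 2^(\<beta> i) crosses 1. Below, the terms grow like
  2^((2\<beta> - 1) i); above, they decay like 2^((\<beta>\<rho> - 1) i). The crossing scale
  therefore dominates both sums and contributes |b|^(1/\<beta>), whatever \<open>R\<close>
  is.\<close>

lemma trunc_pow_moment:
  fixes \<beta> \<rho> :: real
  assumes "0 < \<rho>" "\<rho> * \<beta> < 1" "1 < 2 * \<beta>"
  obtains C where "C \<ge> 0"
    "\<And>R b. (\<Sum>i\<le>R. pareto R i * trunc_pow \<rho> (b * 2 powr (\<beta> * real i))) \<le> C * \<bar>b\<bar> powr (1 / \<beta>)"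
proof -
  define r where "r = 2 powr (2 * \<beta> - 1)"
  define q where "q = 2 powr (\<beta> * \<rho> - 1)"
  have r: "r > 1" unfolding r_def using assms by simp
  have "q < 2 powr 0" unfolding q_def using assms by (intro powr_less_mono) (auto simp:
      mult.commute)
  then have q: "0 < q" "q < 1" by (simp_all add: q_def)
  have b0: "\<beta> > 0" using assms by simp
  let ?C = "r / (r - 1) + 1 / (1 - q)"
  have main: "(\<Sum>i\<le>R. pareto R i * trunc_pow \<rho> (b * 2 powr (\<beta> * real i))) \<le> ?C * \<bar>b\<bar> powr (1 / \<beta>)"
      for R b
  proof (cases "b = 0")
    case True
    then show ?thesis by (simp add: trunc_pow_def)
  next
    case False
    define c where "c = \<bar>b\<bar>"
    have c: "c > 0" using False by (simp add: c_def)
    let ?t = "\<lambda>i. 2 powr (\<beta> * real i)"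
    let ?A = "{i\<in>{..R}. c * ?t i \<le> 1}" and ?B = "{i\<in>{..R}. \<not> c * ?t i \<le> 1}"
    have I: "{..R} = ?A \<union> ?B" by auto
    have sp: "(\<Sum>i\<le>R. F i) = (\<Sum>i\<in>?A. F i) + (\<Sum>i\<in>?B. F i)" for F :: "_ \<Rightarrow> real"
      by (subst I, subst sum.union_disjoint) auto
    have half: "1 / 2 ^ i = 2 powr (- real i)" for i
      by (simp add: powr_minus_divide powr_realpow)
    have A: "(\<Sum>i\<in>?A. pareto R i * trunc_pow \<rho> (b * ?t i)) \<le> r / (r - 1) * c powr (1 / \<beta>)"
    proof -
      have "(\<Sum>i\<in>?A. pareto R i * trunc_pow \<rho> (b * ?t i)) \<le> (\<Sum>i\<in>?A. c\<^sup>2 * r ^ i)"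
      proof (rule sum_mono)
        fix i assume i: "i \<in> ?A"
        have "pareto R i * trunc_pow \<rho> (b * ?t i) \<le> (1 / 2 ^ i) * (b * ?t i)\<^sup>2"
        proof -
          have "trunc_pow \<rho> (b * ?t i) = (b * ?t i)\<^sup>2" using i by (simp add: trunc_pow_def c_def
              abs_mult)
          then show ?thesis by (simp only: mult_right_mono[OF pareto_le] zero_le_power2)
        qed
        also have "\<dots> = c\<^sup>2 * (2 powr (- real i) * (?t i)\<^sup>2)"
          by (simp add: half c_def power_mult_distrib)
        also have "2 powr (- real i) * (?t i)\<^sup>2 = r ^ i"
          unfolding r_def by (simp add: power2_eq_square powr_realpow[symmetric] powr_powr flip:
              powr_add)
            (simp add: algebra_simps)
        finally show "pareto R i * trunc_pow \<rho> (b * ?t i) \<le> c\<^sup>2 * r ^ i" .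
      qed
      also have "\<dots> = c\<^sup>2 * (\<Sum>i\<in>?A. r ^ i)" by (simp add: sum_distrib_left)
      also have "\<dots> \<le> c\<^sup>2 * (c powr (1 / \<beta> - 2) * r / (r - 1))"
      proof (intro mult_left_mono geometric_up r)
        fix i assume "i \<in> ?A"
        then have "?t i \<le> 1 / c" using c by (simp add: field_simps)
        then have "?t i powr ((2 * \<beta> - 1) / \<beta>) \<le> (1 / c) powr ((2 * \<beta> - 1) / \<beta>)"
          using assms b0 by (intro powr_mono2) auto
        moreover have "?t i powr ((2 * \<beta> - 1) / \<beta>) = r ^ i"
          using b0 by (simp add: r_def powr_powr mult.commute flip: powr_realpow)
        moreover have "(1 / c) powr ((2 * \<beta> - 1) / \<beta>) = c powr (1 / \<beta> - 2)"
          using c b0 by (simp add: powr_divide diff_divide_distrib powr_diff)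
        ultimately show "r ^ i \<le> c powr (1 / \<beta> - 2)" by simp
      qed auto
      also have "\<dots> = r / (r - 1) * (c powr 2 * c powr (1 / \<beta> - 2))" using c by (simp add:
          powr_numeral)
      also have "c powr 2 * c powr (1 / \<beta> - 2) = c powr (1 / \<beta>)" by (simp flip: powr_add)
      finally show ?thesis .
    qed
    have B: "(\<Sum>i\<in>?B. pareto R i * trunc_pow \<rho> (b * ?t i)) \<le> 1 / (1 - q) * c powr (1 / \<beta>)"
    proof -
      have "(\<Sum>i\<in>?B. pareto R i * trunc_pow \<rho> (b * ?t i)) \<le> (\<Sum>i\<in>?B. c powr \<rho> * q ^ i)"
      proof (rule sum_mono)
        fix i assume i: "i \<in> ?B"
        have "pareto R i * trunc_pow \<rho> (b * ?t i) \<le> (1 / 2 ^ i) * (c * ?t i) powr \<rho>"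
        proof -
          have "trunc_pow \<rho> (b * ?t i) = (c * ?t i) powr \<rho>" using i by (simp add: trunc_pow_def
              c_def abs_mult)
          then show ?thesis by (simp only: mult_right_mono[OF pareto_le] powr_ge_zero)
        qed
        also have "\<dots> = c powr \<rho> * (2 powr (- real i) * ?t i powr \<rho>)"
          using c by (simp add: half powr_mult)
        also have "2 powr (- real i) * ?t i powr \<rho> = q ^ i"
          unfolding q_def by (simp add: powr_realpow[symmetric] powr_powr flip: powr_add)
            (simp add: algebra_simps)
        finally show "pareto R i * trunc_pow \<rho> (b * ?t i) \<le> c powr \<rho> * q ^ i" .
      qed
      also have "\<dots> = c powr \<rho> * (\<Sum>i\<in>?B. q ^ i)" by (simp add: sum_distrib_left)
      also have "\<dots> \<le> c powr \<rho> * (c powr (1 / \<beta> - \<rho>) / (1 - q))"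
      proof (intro mult_left_mono geometric_down q)
        fix i assume "i \<in> ?B"
        then have "?t i \<ge> 1 / c" using c by (simp add: field_simps)
        then have "?t i powr ((\<beta> * \<rho> - 1) / \<beta>) \<le> (1 / c) powr ((\<beta> * \<rho> - 1) / \<beta>)"
          using assms b0 c by (intro powr_mono2') (auto simp: divide_le_0_iff mult.commute)
        moreover have "?t i powr ((\<beta> * \<rho> - 1) / \<beta>) = q ^ i"
          using b0 by (simp add: q_def powr_powr mult.commute flip: powr_realpow)
        moreover have "(1 / c) powr ((\<beta> * \<rho> - 1) / \<beta>) = c powr (1 / \<beta> - \<rho>)"
          using c b0 by (simp add: powr_divide diff_divide_distrib powr_diff)
        ultimately show "q ^ i \<le> c powr (1 / \<beta> - \<rho>)" by simp
      qed auto
      also have "\<dots> = 1 / (1 - q) * (c powr \<rho> * c powr (1 / \<beta> - \<rho>))" by simp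
      also have "c powr \<rho> * c powr (1 / \<beta> - \<rho>) = c powr (1 / \<beta>)" by (simp flip: powr_add)
      finally show ?thesis .
    qed
    show ?thesis using A B unfolding sp by (simp add: c_def distrib_right)
  qed
  show ?thesis by (rule that[OF _ main]) (use r q in auto)
qed

abbreviation mean :: "nat \<Rightarrow> 'l set \<Rightarrow> (('l \<Rightarrow> nat) \<Rightarrow> ('l \<Rightarrow> real) \<Rightarrow> real) \<Rightarrow> real" where
  "mean R I F \<equiv> pmean R I (\<lambda>z. smean I (F z))"

definition stab :: "real \<Rightarrow> ('l \<Rightarrow> nat) \<Rightarrow> ('l \<Rightarrow> real) \<Rightarrow> 'l \<Rightarrow> real" where
  "stab \<beta> z e l = e l * 2 powr (\<beta> * real (z l))"

text \<open>Given \<open>z\<close>, the combination is a Rademacher sum, so its moment is a power of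
  a sum of squares. Linearising this power by \<open>trunc_pow\<close> lets the mean over
  \<open>z\<close> act coordinate by coordinate.\<close>

lemma stab_moment:
  fixes \<beta> \<rho> :: real
  assumes "0 < \<rho>" "\<rho> \<le> 2" "\<rho> * \<beta> < 1" "1 < 2 * \<beta>"
  obtains C where "C > 0"
    "\<And>R (I :: 'l set) b. finite I \<Longrightarrow> (\<Sum>l\<in>I. \<bar>b l\<bar> powr (1 / \<beta>)) \<le> 1 \<Longrightarrow>
       mean R I (\<lambda>z e. \<bar>\<Sum>l\<in>I. b l * stab \<beta> z e l\<bar> powr \<rho>) \<le> C"
proof -
  obtain C where C: "C \<ge> 0"
    "\<And>R b. (\<Sum>i\<le>R. pareto R i * trunc_pow \<rho> (b * 2 powr (\<beta> * real i))) \<le> C * \<bar>b\<bar> powr (1 / \<beta>)"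
    using trunc_pow_moment[OF assms(1,3,4)] by blast
  have "mean R I (\<lambda>z e. \<bar>\<Sum>l\<in>I. b l * stab \<beta> z e l\<bar> powr \<rho>) \<le> 2 * (1 + C)"
    if I: "finite I" and b: "(\<Sum>l\<in>I. \<bar>b l\<bar> powr (1 / \<beta>)) \<le> 1" for R and I :: "'l set" and b
  proof -
    have "mean R I (\<lambda>z e. \<bar>\<Sum>l\<in>I. b l * stab \<beta> z e l\<bar> powr \<rho>)
        \<le> pmean R I (\<lambda>z. 2 * (1 + (\<Sum>l\<in>I. trunc_pow \<rho> (b l * 2 powr (\<beta> * real (z l))))))"
    proof (rule pmean_mono)
      fix z :: "'l \<Rightarrow> nat"
      have "smean I (\<lambda>e. \<bar>\<Sum>l\<in>I. b l * stab \<beta> z e l\<bar> powr \<rho>)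
          = smean I (\<lambda>e. \<bar>\<Sum>l\<in>I. (b l * 2 powr (\<beta> * real (z l))) * e l\<bar> powr \<rho>)"
        by (simp add: stab_def mult_ac)
      also have "\<dots> \<le> 2 * (\<Sum>l\<in>I. (b l * 2 powr (\<beta> * real (z l)))\<^sup>2) powr (\<rho> / 2)"
        using I assms by (intro smean_powr)
      also have "\<dots> \<le> 2 * (1 + (\<Sum>l\<in>I. trunc_pow \<rho> (b l * 2 powr (\<beta> * real (z l)))))"
        using I assms by (intro mult_left_mono sum_squares_powr_le) auto
      finally show "smean I (\<lambda>e. \<bar>\<Sum>l\<in>I. b l * stab \<beta> z e l\<bar> powr \<rho>)
        \<le> 2 * (1 + (\<Sum>l\<in>I. trunc_pow \<rho> (b l * 2 powr (\<beta> * real (z l)))))" .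
    qed
    also have "\<dots> = 2 * (1 + (\<Sum>l\<in>I. pmean R I (\<lambda>z. trunc_pow \<rho> (b l * 2 powr (\<beta> * real (z l))))))"
      using I by (simp only: pmean_cmult pmean_add pmean_const pmean_sum)
    also have "(\<Sum>l\<in>I. pmean R I (\<lambda>z. trunc_pow \<rho> (b l * 2 powr (\<beta> * real (z l)))))
        = (\<Sum>l\<in>I. \<Sum>i\<le>R. pareto R i * trunc_pow \<rho> (b l * 2 powr (\<beta> * real i)))"
      using I by (intro sum.cong refl pmean_marginal) auto
    also have "\<dots> \<le> (\<Sum>l\<in>I. C * \<bar>b l\<bar> powr (1 / \<beta>))"
      by (intro sum_mono C(2))
    also have "\<dots> \<le> C * 1"
      using b C(1) by (simp only: sum_distrib_left[symmetric] mult_left_mono)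
    finally show ?thesis by simp
  qed
  then show ?thesis using C(1) by (intro that[of "2 * (1 + C)"]) auto
qed

lemma dyadic_approx:
  fixes v :: real
  assumes "0 < v" "v \<le> 1/2"
  obtains k :: nat where "1 / 2 ^ k \<le> v" "v < 2 / 2 ^ k"
proof -
  have ex: "\<exists>k. 1 / 2 ^ k \<le> v"
    using real_arch_pow_inv[of v "1/2"] assms by (auto simp: power_divide intro: less_imp_le)
  define k where "k = (LEAST k. 1 / 2 ^ k \<le> v)"
  have k: "1 / 2 ^ k \<le> v" unfolding k_def using ex by (rule LeastI_ex)
  moreover have "v < 2 / 2 ^ k"
  proof (cases k)
    case 0
    then show ?thesis using assms by simp
  next
    case (Suc n)
    then have "\<not> 1 / 2 ^ n \<le> v" unfolding k_def using not_less_Least by (metis lessI)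
    then show ?thesis using Suc by (simp add: field_simps)
  qed
  ultimately show ?thesis by (rule that)
qed

text \<open>
  \<open>F\<close> is \<open>\<plusminus>\<lambda>\<^sub>l\<close> if exactly one coordinate \<open>l\<close> exceeds a threshold, chosen such that this has
  probability about \<open>\<bar>f l\<bar>\<^sup>r\<close>, and 0 otherwise. The factor \<open>\<lambda>\<^sub>l \<le> 1\<close> corrects the rounding of the
  thresholds to powers of 2.
\<close>

lemma stable_lift:
  fixes f :: "'l \<Rightarrow> real" and r :: real
  assumes r: "2 < r" and I: "finite I" and f: "(\<Sum>l\<in>I. \<bar>f l\<bar> powr r) \<le> 1"
  shows "\<exists>R0. \<forall>R\<ge>R0. \<exists>F. (\<forall>z. \<forall>e\<in>signs I. \<bar>F z e\<bar> \<le> 1) \<and>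
    (\<forall>l\<in>I. mean R I (\<lambda>z e. F z e * stab (1 - 1 / r) z e l) = f l / 16)"
proof -
  let ?b = "1 - 1 / r"
  \<comment> \<open>The factor 1/2 keeps the total exceedance probability at most 1/2, so that with
    probability at least 1/2 no coordinate other than l exceeds its threshold.\<close>
  define v where "v l = \<bar>f l\<bar> powr r / 2" for l
  have v_sum: "(\<Sum>l\<in>I. v l) \<le> 1/2" using f by (simp add: v_def flip: sum_divide_distrib)
  have v0: "v l \<ge> 0" for l by (simp add: v_def)
  have v_le: "v l \<le> 1/2" if "l \<in> I" for l
    using member_le_sum[of l I v] v0 v_sum I that by simp
  have "\<exists>k. l \<in> I \<longrightarrow> f l \<noteq> 0 \<longrightarrow> 1 / 2 ^ k \<le> v l \<and> v l < 2 / 2 ^ k" for l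
  proof (cases "l \<in> I \<and> f l \<noteq> 0")
    case True
    then have "0 < v l" by (simp add: v_def)
    then show ?thesis using True v_le dyadic_approx by blast
  qed auto
  then obtain kk where kk: "\<And>l. l \<in> I \<Longrightarrow> f l \<noteq> 0 \<Longrightarrow> 1 / 2 ^ kk l \<le> v l"
    "\<And>l. l \<in> I \<Longrightarrow> f l \<noteq> 0 \<Longrightarrow> v l < 2 / 2 ^ kk l" by metis
  define R0 where "R0 = (\<Sum>l\<in>I. kk l)"
  have kkR: "kk l \<le> R0" if "l \<in> I" for l
    unfolding R0_def using I that by (intro member_le_sum) auto
  have "\<exists>F. (\<forall>z. \<forall>e\<in>signs I. \<bar>F z e\<bar> \<le> 1) \<and>
      (\<forall>l\<in>I. mean R I (\<lambda>z e. F z e * stab ?b z e l) = f l / 16)" if R: "R \<ge> R0" for R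
  proof -
    \<comment> \<open>A vanishing coefficient gets the threshold \<open>Suc R\<close>, which no
      value up to \<open>R\<close> reaches.\<close>
    define k where "k l = (if f l = 0 then Suc R else kk l)" for l
    define Q where "Q l = (\<Sum>i\<le>R. pareto R i * (if i < k l then 1 else 0))" for l
    define E where "E l = (\<Sum>i\<le>R. pareto R i * (if k l \<le> i then 2 powr (?b * real i) else 0))" for l
    \<comment> \<open>\<open>\<kappa> l\<close> is the mean of 2^(b z l) over the event that l alone
      exceeds its threshold. Division by 16 \<kappa> l in \<open>lam\<close> produces the prescribed
      coefficient, and \<kappa> l \<ge> |f l| / 16 makes \<open>lam l\<close> at most 1 in
      modulus.\<close>
    define \<kappa> where "\<kappa> l = E l * (\<Prod>m\<in>I - {l}. Q m)" for l
    define lam where "lam l = f l / (16 * \<kappa> l)" for l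
    define g where "g l m i = (if m = l then (if k l \<le> i then 1 else 0) else (if i < k m then 1
        else (0::real)))" for l m i
    define F where "F z e = (\<Sum>l\<in>I. lam l * (\<Prod>m\<in>I. g l m (z m)) * e l)" for z :: "'l \<Rightarrow> nat" and e
    have Q: "1 - v l \<le> Q l" "Q l \<le> 1" if "l \<in> I" for l
    proof -
      define P where "P = (\<Sum>i\<le>R. pareto R i * (if i < k l then 0 else 1))"
      have "Q l + P = (\<Sum>i\<le>R. pareto R i)"
        unfolding Q_def P_def sum.distrib[symmetric] by (intro sum.cong) auto
      then have QP: "Q l = 1 - P" by (simp add: pareto_sum)
      have "P \<ge> 0" unfolding P_def by (intro sum_nonneg) (auto intro: less_imp_le[OF pareto_pos])
      moreover have "P \<le> v l"
      proof (cases "f l = 0")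
        case True
        then have "P = 0" unfolding P_def k_def by (intro sum.neutral) auto
        then show ?thesis using v0 by simp
      next
        case False
        have "P = (\<Sum>i\<in>{kk l..R}. pareto R i)"
          unfolding P_def using False by (intro sum.mono_neutral_cong_right) (auto simp: k_def)
        also have "\<dots> = 1 / 2 ^ kk l" using kkR[OF that] R by (intro pareto_tail) simp
        also have "\<dots> \<le> v l" using kk that False by simp
        finally show ?thesis .
      qed
      ultimately show "1 - v l \<le> Q l" "Q l \<le> 1" using QP by auto
    qed
    have prodQ: "(\<Prod>m\<in>I - {l}. Q m) \<ge> 1/2" for l
    proof -
      have "1/2 \<le> 1 - (\<Sum>m\<in>I - {l}. v m)"
        using sum_mono2[OF I, of "I - {l}" v] v0 v_sum by auto
      also have "\<dots> \<le> (\<Prod>m\<in>I - {l}. 1 - v m)"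
        using v0 v_le by (intro Weierstrass_prod_ineq) force
      also have "\<dots> \<le> (\<Prod>m\<in>I - {l}. Q m)"
        using Q v_le by (intro prod_mono) force
      finally show ?thesis .
    qed
    \<comment> \<open>A single scale suffices: z l = k has probability at least 2^(-k-1), and 2^(b
      k) 2^(-k) = 2^(-k/r) is comparable with |f l|, because 2^(-k) is comparable with |f
      l|^r.\<close>
    have E: "E l \<ge> \<bar>f l\<bar> / 8" if "l \<in> I" "f l \<noteq> 0" for l
    proof -
      have "(v l / 2) powr (1 / r) \<le> (1 / 2 ^ kk l) powr (1 / r)"
        using kk[OF that] v0 r by (intro powr_mono2) auto
      also have "(v l / 2) powr (1 / r) = (\<bar>f l\<bar> powr r) powr (1 / r) / 4 powr (1 / r)"
        by (simp add: v_def powr_divide)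
      also have "\<dots> = \<bar>f l\<bar> / 4 powr (1 / r)" using r that by (simp add: powr_powr)
      finally have 1: "\<bar>f l\<bar> / 4 powr (1 / r) \<le> (1 / 2 ^ kk l) powr (1 / r)" .
      have "4 powr (1 / r) \<le> 4 powr 1" using r by (intro powr_mono) auto
      then have "\<bar>f l\<bar> / 4 \<le> \<bar>f l\<bar> / 4 powr (1 / r)" by (intro divide_left_mono) auto
      with 1 have 2: "\<bar>f l\<bar> / 4 \<le> (1 / 2 ^ kk l) powr (1 / r)" by linarith
      have h: "1 / 2 ^ i = 2 powr (- real i)" for i
        by (simp add: powr_minus_divide powr_realpow)
      have "\<bar>f l\<bar> / 8 \<le> (1 / 2 ^ kk l) powr (1 / r) / 2" using 2 by simp
      also have "(1 / 2 ^ kk l) powr (1 / r) = (1 / 2 ^ kk l) * 2 powr (?b * real (kk l))"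
        by (simp add: h powr_powr flip: powr_add) (simp add: algebra_simps)
      also have "\<dots> / 2 = (1 / 2 ^ Suc (kk l)) * 2 powr (?b * real (kk l))" by simp
      also have "\<dots> \<le> pareto R (kk l) * 2 powr (?b * real (kk l))"
        by (intro mult_right_mono pareto_ge) simp
      also have "\<dots> = (\<Sum>i\<in>{kk l}. pareto R i * (if k l \<le> i then 2 powr (?b * real i) else 0))"
        using that by (simp add: k_def)
      also have "\<dots> \<le> E l"
        unfolding E_def using R kkR[OF that(1)]
        by (intro sum_mono2) (auto intro!: mult_nonneg_nonneg less_imp_le[OF pareto_pos])
      finally show ?thesis .
    qed
    have kap: "\<kappa> l \<ge> \<bar>f l\<bar> / 16" if "l \<in> I" "f l \<noteq> 0" for l
    proof -
      have "\<bar>f l\<bar> / 8 * (1/2) \<le> \<kappa> l"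
        unfolding \<kappa>_def using E[OF that] prodQ[of l] that by (intro mult_mono) auto
      then show ?thesis by simp
    qed
    have lam: "\<bar>lam l\<bar> \<le> 1" if "l \<in> I" for l
    proof (cases "f l = 0")
      case False
      then have "\<kappa> l > 0" using kap[OF that False] by (smt (verit) divide_pos_pos zero_less_abs_iff)
      then show ?thesis using kap[OF that False] by (simp add: lam_def abs_divide abs_mult)
    qed (simp add: lam_def)
    have "\<bar>F z e\<bar> \<le> 1" if e: "e \<in> signs I" for z e
    proof (cases "\<exists>l\<in>I. k l \<le> z l")
      case False
      then have "(\<Prod>m\<in>I. g l m (z m)) = 0" if "l \<in> I" for l
        using I that by (auto simp: prod_zero_iff g_def intro!: bexI[of _ l])
      then show ?thesis by (simp add: F_def)
    next
      case True
      \<comment> \<open>If l0 exceeds its threshold, every product belonging to another l contains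
        the zero factor of l0, so at most one summand of \<open>F\<close> is left.\<close>
      then obtain l0 where l0: "l0 \<in> I" "k l0 \<le> z l0" by blast
      then have z0: "(\<Prod>m\<in>I. g l m (z m)) = 0" if "l \<in> I - {l0}" for l
        using I that by (auto simp: prod_zero_iff g_def intro!: bexI[of _ l0])
      have "(\<Sum>l\<in>I - {l0}. lam l * (\<Prod>m\<in>I. g l m (z m)) * e l) = 0"
        by (intro sum.neutral ballI) (simp only: z0 mult_zero_left mult_zero_right)
      then have "F z e = lam l0 * (\<Prod>m\<in>I. g l0 m (z m)) * e l0"
        unfolding F_def using I l0 by (subst sum.remove[of _ l0]) simp_all
      moreover have "\<bar>\<Prod>m\<in>I. g l0 m (z m)\<bar> \<le> 1"
        unfolding abs_prod by (intro prod_le_1) (auto simp: g_def)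
      moreover have "\<bar>e l0\<bar> = 1" using e l0(1) by (auto dest!: PiE_mem)
      ultimately show ?thesis using lam[OF l0(1)]
        by (simp add: abs_mult mult_le_one)
    qed
    moreover have "mean R I (\<lambda>z e. F z e * stab ?b z e l) = f l / 16" if l: "l \<in> I" for l
    proof -
      define h where "h m i = (if m = l then (if k l \<le> i then 2 powr (?b * real i) else 0) else
          (if i < k m then 1 else (0::real)))" for m i
      have "smean I (\<lambda>e. F z e * stab ?b z e l) = lam l * (\<Prod>m\<in>I. h m (z m))" for z
      proof -
        \<comment> \<open>The sign of coordinate l, written as a sum with a Kronecker coefficient,
          selects the l-th summand of \<open>F\<close> by orthogonality.\<close>
        have "smean I (\<lambda>e. F z e * stab ?b z e l) = smean I (\<lambda>e. 2 powr (?b * real (z l)) *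
           ((\<Sum>m\<in>I. (lam m * (\<Prod>n\<in>I. g m n (z n))) * e m) * (\<Sum>m\<in>I. (if m = l then 1 else 0) * e m)))"
          using I l by (intro arg_cong[where f = "smean I"] ext) (simp add: F_def stab_def
              if_distrib[of "\<lambda>x. x * _"] cong: if_cong)
        also have "\<dots> = 2 powr (?b * real (z l)) * (lam l * (\<Prod>n\<in>I. g l n (z n)))"
          unfolding smean_cmult smean_inner[OF I] using I l by (simp add: mult_delta_right)
        also have "\<dots> = lam l * (2 powr (?b * real (z l)) * (g l l (z l) * (\<Prod>n\<in>I - {l}. g l n (z
            n))))"
          using I l by (subst prod.remove[of _ l]) auto
        also have "2 powr (?b * real (z l)) * (g l l (z l) * (\<Prod>n\<in>I - {l}. g l n (z n)))
           = h l (z l) * (\<Prod>n\<in>I - {l}. h n (z n))"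
          by (simp add: g_def h_def)
        also have "\<dots> = (\<Prod>m\<in>I. h m (z m))" using I l by (subst prod.remove[of _ l]) auto
        finally show ?thesis .
      qed
      then have "mean R I (\<lambda>z e. F z e * stab ?b z e l) = lam l * (\<Prod>m\<in>I. \<Sum>i\<le>R. pareto R i * h m i)"
        using I by (simp add: pmean_cmult pmean_prod)
      also have "(\<Prod>m\<in>I. \<Sum>i\<le>R. pareto R i * h m i) = \<kappa> l"
        unfolding \<kappa>_def E_def Q_def using I l by (subst prod.remove[of _ l]) (auto simp: h_def)
      also have "lam l * \<kappa> l = f l / 16"
      proof (cases "f l = 0")
        case False
        then have "\<kappa> l > 0" using kap[OF l False] by (smt (verit) divide_pos_pos zero_less_abs_iff)
        then show ?thesis by (simp add: lam_def)
      qed (simp add: lam_def)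
      finally show ?thesis .
    qed
    ultimately show ?thesis by blast
  qed
  then show ?thesis by blast
qed

section \<open>Duality between L_s functions and the stable variables\<close>

lemma young_scaled:
  fixes u v \<tau> s :: real
  assumes "u \<ge> 0" "v \<ge> 0" "\<tau> > 0" "s > 1"
  shows "u * v \<le> \<tau> powr (s - 1) * u powr s + v powr (s / (s - 1)) / \<tau>"
proof (cases "u = 0 \<or> v = 0")
  case False
  then have pos: "u > 0" "v > 0" using assms by auto
  show ?thesis
  proof (cases "v \<le> (\<tau> * u) powr (s - 1)")
    case True
    then have "u * v \<le> u * (\<tau> * u) powr (s - 1)" using pos by (intro mult_left_mono) auto
    also have "\<dots> = \<tau> powr (s - 1) * u powr s" using pos assms by (simp add: powr_mult powr_diff)
    finally show ?thesis using assms by (simp add: add_increasing2)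
  next
    case False
    then have "((\<tau> * u) powr (s - 1)) powr (1 / (s - 1)) \<le> v powr (1 / (s - 1))"
      using assms by (intro powr_mono2) auto
    then have "\<tau> * u \<le> v powr (1 / (s - 1))" using assms pos by (simp add: powr_powr)
    then have "u \<le> v powr (1 / (s - 1)) / \<tau>" using assms by (simp add: field_simps)
    then have "u * v \<le> v powr (1 / (s - 1)) / \<tau> * v" using pos by (intro mult_right_mono) auto
    also have "\<dots> = v powr (1 / (s - 1) + 1) / \<tau>" using pos by (simp add: powr_add)
    also have "1 / (s - 1) + 1 = s / (s - 1)" using assms by (simp add: field_simps)
    finally show ?thesis using assms by (simp add: add_increasing)
  qed
qed (use assms in auto)

text \<open>The map from G to its coefficients is the adjoint of the map sending \<open>a\<close> to
  the combination of the stable variables, from l_\<rho> to L_\<rho> with \<rho> = s/(s-1). The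
  latter is bounded because \<rho> lies strictly below the stability index 1/b = r/(r-1), which also
  makes l_\<rho> embed into l_(1/b).\<close>

lemma stable_coeff_bound:
  fixes r s :: real
  assumes r: "2 < r" and s: "r < s"
  obtains K where "K > 0"
    "\<And>R (I :: 'l set) G. finite I \<Longrightarrow>
       (\<Sum>l\<in>I. \<bar>mean R I (\<lambda>z e. G z e * stab (1 - 1 / r) z e l)\<bar> powr s)
         \<le> K * mean R I (\<lambda>z e. \<bar>G z e\<bar> powr s)"
proof -
  define \<rho> where "\<rho> = s / (s - 1)"
  define b where "b = 1 - 1 / r"
  have \<rho>: "0 < \<rho>" "\<rho> \<le> 2" "1 < \<rho>" using r s by (auto simp: \<rho>_def field_simps)
  have b: "\<rho> * b < 1" "1 < 2 * b" "0 < b" "\<rho> \<le> 1 / b"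
    using r s by (auto simp: \<rho>_def b_def field_simps)
  obtain K where K: "K > 0" "\<And>R (I :: 'l set) a. finite I \<Longrightarrow> (\<Sum>l\<in>I. \<bar>a l\<bar> powr (1 / b)) \<le> 1 \<Longrightarrow>
       mean R I (\<lambda>z e. \<bar>\<Sum>l\<in>I. a l * stab b z e l\<bar> powr \<rho>) \<le> K"
    using stab_moment[OF \<rho>(1,2) b(1,2)] by blast
  have "(\<Sum>l\<in>I. \<bar>mean R I (\<lambda>z e. G z e * stab b z e l)\<bar> powr s)
      \<le> 2 * (2 * K) powr (s - 1) * mean R I (\<lambda>z e. \<bar>G z e\<bar> powr s)" if I: "finite I" for R and I
          :: "'l set" and G
  proof -
    define c where "c l = mean R I (\<lambda>z e. G z e * stab b z e l)" for l
    define S where "S = (\<Sum>l\<in>I. \<bar>c l\<bar> powr s)"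
    define g where "g = mean R I (\<lambda>z e. \<bar>G z e\<bar> powr s)"
    have S0: "S \<ge> 0" by (simp add: S_def sum_nonneg)
    have "0 = mean R I (\<lambda>z e. 0)" using I by (simp add: smean_const pmean_const)
    also have "\<dots> \<le> g" unfolding g_def by (intro pmean_mono smean_mono) simp
    finally have g0: "g \<ge> 0" .
    have "S \<le> 2 * (2 * K) powr (s - 1) * g"
    proof (cases "S = 0")
      case True
      then show ?thesis using g0 K(1) by simp
    next
      case False
      then have Sp: "S > 0" using S0 by simp
      \<comment> \<open>The extremal sequence of Hoelder's inequality for \<open>c\<close>,
        normalised in l_\<rho>.\<close>
      define a where "a l = sgn (c l) * \<bar>c l\<bar> powr (s - 1) * S powr (- 1 / \<rho>)" for l
      have ac: "a l * c l = \<bar>c l\<bar> powr s * S powr (- 1 / \<rho>)" for l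
        by (cases "c l = 0") (auto simp: a_def sgn_if powr_diff)
      have absa: "\<bar>a l\<bar> powr \<rho> = \<bar>c l\<bar> powr s / S" for l
      proof (cases "c l = 0")
        case False
        then have "\<bar>a l\<bar> = \<bar>c l\<bar> powr (s - 1) * S powr (- 1 / \<rho>)" by (simp add: a_def abs_mult
            abs_sgn_eq)
        then have "\<bar>a l\<bar> powr \<rho> = \<bar>c l\<bar> powr ((s - 1) * \<rho>) * S powr (- 1 / \<rho> * \<rho>)"
          by (simp only: powr_mult powr_powr)
        also have "(s - 1) * \<rho> = s" using r s by (simp add: \<rho>_def)
        also have "- 1 / \<rho> * \<rho> = - 1" using \<rho> by simp
        finally show ?thesis using Sp by (simp add: powr_minus_divide)
      qed (simp add: a_def)
      have sum1: "(\<Sum>l\<in>I. \<bar>a l\<bar> powr \<rho>) = 1"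
        unfolding absa using Sp by (simp add: S_def flip: sum_divide_distrib)
      have "(\<Sum>l\<in>I. \<bar>a l\<bar> powr (1 / b)) \<le> (\<Sum>l\<in>I. \<bar>a l\<bar> powr \<rho>)"
      proof (rule sum_mono)
        fix l assume "l \<in> I"
        then have "\<bar>a l\<bar> powr \<rho> \<le> 1"
          using member_le_sum[of l I "\<lambda>l. \<bar>a l\<bar> powr \<rho>"] I sum1 by simp
        then have "\<bar>a l\<bar> \<le> 1" using \<rho> by (metis abs_ge_zero gr_one_powr not_le)
        then show "\<bar>a l\<bar> powr (1 / b) \<le> \<bar>a l\<bar> powr \<rho>" using b by (intro powr_mono') auto
      qed
      then have X: "mean R I (\<lambda>z e. \<bar>\<Sum>l\<in>I. a l * stab b z e l\<bar> powr \<rho>) \<le> K"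
        using K(2)[OF I] sum1 by simp
      \<comment> \<open>With this \<tau> the second Young term is at most S^(1/s) / 2, half of the
        left-hand side.\<close>
      define \<tau> where "\<tau> = 2 * K * S powr (- 1 / s)"
      have \<tau>: "\<tau> > 0" using K Sp by (simp add: \<tau>_def)
      have "(\<Sum>l\<in>I. a l * c l) = mean R I (\<lambda>z e. G z e * (\<Sum>l\<in>I. a l * stab b z e l))"
        by (simp add: c_def sum_distrib_left mult.left_commute[of "G _ _"] smean_sum pmean_sum
            smean_cmult pmean_cmult)
      also have "\<dots> \<le> mean R I (\<lambda>z e. \<tau> powr (s - 1) * \<bar>G z e\<bar> powr s
          + (1 / \<tau>) * \<bar>\<Sum>l\<in>I. a l * stab b z e l\<bar> powr \<rho>)"
      proof (intro pmean_mono smean_mono)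
        fix z :: "'l \<Rightarrow> nat" and e :: "'l \<Rightarrow> real"
        let ?y = "\<Sum>l\<in>I. a l * stab b z e l"
        have "G z e * ?y \<le> \<bar>G z e\<bar> * \<bar>?y\<bar>" by (metis abs_ge_self abs_mult)
        also have "\<dots> \<le> \<tau> powr (s - 1) * \<bar>G z e\<bar> powr s + \<bar>?y\<bar> powr (s / (s - 1)) / \<tau>"
          using r s by (intro young_scaled \<tau>) auto
        finally show "G z e * ?y \<le> \<tau> powr (s - 1) * \<bar>G z e\<bar> powr s + (1 / \<tau>) * \<bar>?y\<bar> powr \<rho>"
          by (simp add: \<rho>_def)
      qed
      also have "\<dots> = \<tau> powr (s - 1) * g + (1 / \<tau>) * mean R I (\<lambda>z e. \<bar>\<Sum>l\<in>I. a l * stab b z e l\<bar>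
          powr \<rho>)"
        by (simp only: g_def pmean_add smean_add pmean_cmult smean_cmult)
      also have "\<dots> \<le> \<tau> powr (s - 1) * g + (1 / \<tau>) * K"
        using X \<tau> by (intro add_left_mono mult_left_mono) auto
      also have "(\<Sum>l\<in>I. a l * c l) = S * S powr (- 1 / \<rho>)" by (simp add: ac S_def sum_distrib_right)
      also have "S * S powr (- 1 / \<rho>) = S powr (1 / s)"
      proof -
        have "S * S powr (- 1 / \<rho>) = S powr (1 + - 1 / \<rho>)" using Sp by (simp only: powr_add) simp
        also have "1 + - 1 / \<rho> = 1 / s" using r s by (simp add: \<rho>_def field_simps)
        finally show ?thesis .
      qed
      also have "(1 / \<tau>) * K = S powr (1 / s) / 2"
        using K Sp by (simp add: \<tau>_def powr_minus_divide)
      finally have "S powr (1 / s) \<le> 2 * (\<tau> powr (s - 1) * g)" by simp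
      then have "S powr (1 / s) * S powr ((s - 1) / s) \<le> 2 * (\<tau> powr (s - 1) * g) * S powr ((s -
          1) / s)"
        by (intro mult_right_mono) auto
      also have "S powr (1 / s) * S powr ((s - 1) / s) = S"
        using Sp r s by (simp add: powr_add[symmetric] add_divide_distrib[symmetric])
      also have "\<tau> powr (s - 1) = (2 * K) powr (s - 1) * S powr (- 1 / s * (s - 1))"
        by (simp only: \<tau>_def powr_mult powr_powr)
      also have "2 * ((2 * K) powr (s - 1) * S powr (- 1 / s * (s - 1)) * g) * S powr ((s - 1) / s)
          = 2 * (2 * K) powr (s - 1) * g * (S powr (- 1 / s * (s - 1)) * S powr ((s - 1) / s))" by
              simp
      also have "S powr (- 1 / s * (s - 1)) * S powr ((s - 1) / s) = 1"
        using Sp r s by (simp add: powr_add[symmetric] add_divide_distrib[symmetric]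
            minus_divide_left[symmetric])
      finally show ?thesis by simp
    qed
    then show ?thesis by (simp add: S_def c_def g_def)
  qed
  then show ?thesis using K by (intro that[of "2 * (2 * K) powr (s - 1)"]) (auto simp: b_def)
qed

subsection \<open>The one-variable step\<close>

text \<open>Each vector \<open>f l a\<close>, indexed by l, is lifted to a bounded function
  \<open>F a\<close>. At every sample point the values \<open>F a z e\<close> form a test for the
  weak norm, so the sum over j of |G j|^s is at most 1 pointwise. The coefficients of
  \<open>G j\<close> against the stable variables are, up to the factor 16, the numbers to be
  estimated.\<close>

lemma step_scalar:
  fixes r s :: real
  assumes r: "2 < r" and s: "r < s"
  shows "\<exists>C>0. \<forall>(J :: 'j set) (A :: 'a set) (I :: 'l set) x f. finite J \<longrightarrow> finite A \<longrightarrow> finite I \<longrightarrow>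
    wkf s 1 J A x \<longrightarrow> (\<forall>a\<in>A. (\<Sum>l\<in>I. \<bar>f l a\<bar> powr r) \<le> 1) \<longrightarrow>
    (\<Sum>j\<in>J. \<Sum>l\<in>I. \<bar>\<Sum>a\<in>A. x j a * f l a\<bar> powr s) \<le> C"
proof -
  obtain K where K: "K > 0"
    "\<And>R (I :: 'l set) G. finite I \<Longrightarrow>
       (\<Sum>l\<in>I. \<bar>mean R I (\<lambda>z e. G z e * stab (1 - 1 / r) z e l)\<bar> powr s)
         \<le> K * mean R I (\<lambda>z e. \<bar>G z e\<bar> powr s)"
    by (rule stable_coeff_bound[OF r s]) (rule that)
  have "(\<Sum>j\<in>J. \<Sum>l\<in>I. \<bar>\<Sum>a\<in>A. x j a * f l a\<bar> powr s) \<le> 16 powr s * K"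
    if fin: "finite J" "finite A" "finite I" and w: "wkf s 1 J A x"
      and f: "\<And>a. a \<in> A \<Longrightarrow> (\<Sum>l\<in>I. \<bar>f l a\<bar> powr r) \<le> 1"
    for J :: "'j set" and A :: "'a set" and I :: "'l set" and x f
  proof -
    define good where "good R a F \<longleftrightarrow> (\<forall>z. \<forall>e\<in>signs I. \<bar>F z e\<bar> \<le> 1) \<and>
      (\<forall>l\<in>I. mean R I (\<lambda>z e. F z e * stab (1 - 1 / r) z e l) = f l a / 16)" for R a F
    have "\<forall>a\<in>A. \<exists>R0. \<forall>R\<ge>R0. \<exists>F. good R a F"
      unfolding good_def
    proof
      fix a assume "a \<in> A"
      from stable_lift[OF r fin(3) f[OF this]]
      show "\<exists>R0. \<forall>R\<ge>R0. \<exists>F. (\<forall>z. \<forall>e\<in>signs I. \<bar>F z e\<bar> \<le> 1) \<and>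
        (\<forall>l\<in>I. mean R I (\<lambda>z e. F z e * stab (1 - 1 / r) z e l) = f l a / 16)" .
    qed
    from bchoice[OF this] obtain R0 where R0: "\<forall>a\<in>A. \<forall>R\<ge>R0 a. \<exists>F. good R a F" ..
    \<comment> \<open>One truncation level has to serve all \<open>a\<close>, which is possible
      because a lift exists at every sufficiently large level.\<close>
    define R where "R = (\<Sum>a\<in>A. R0 a)"
    have "R \<ge> R0 a" if "a \<in> A" for a unfolding R_def using fin that by (intro member_le_sum) auto
    then have "\<forall>a\<in>A. \<exists>F. good R a F" using R0 by blast
    from bchoice[OF this] obtain F where F: "\<forall>a\<in>A. good R a (F a)" ..
    have F1: "\<bar>F a z e\<bar> \<le> 1" if "a \<in> A" "e \<in> signs I" for a z e
      using F that by (simp add: good_def)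
    have F2: "mean R I (\<lambda>z e. F a z e * stab (1 - 1 / r) z e l) = f l a / 16"
      if "a \<in> A" "l \<in> I" for a l
      using F that by (simp add: good_def)
    define G where "G j z e = (\<Sum>a\<in>A. x j a * F a z e)" for j z e
    have c: "(\<Sum>a\<in>A. x j a * f l a) = 16 * mean R I (\<lambda>z e. G j z e * stab (1 - 1 / r) z e l)"
      if "l \<in> I" for j l
    proof -
      have "mean R I (\<lambda>z e. G j z e * stab (1 - 1 / r) z e l)
          = (\<Sum>a\<in>A. x j a * mean R I (\<lambda>z e. F a z e * stab (1 - 1 / r) z e l))"
        by (simp only: G_def sum_distrib_right mult.assoc smean_sum pmean_sum smean_cmult
            pmean_cmult)
      also have "\<dots> = (\<Sum>a\<in>A. x j a * (f l a / 16))"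
        by (intro sum.cong refl) (simp only: F2 that)
      finally show ?thesis by (simp add: sum_distrib_left)
    qed
    have "(\<Sum>j\<in>J. \<Sum>l\<in>I. \<bar>\<Sum>a\<in>A. x j a * f l a\<bar> powr s)
        = 16 powr s * (\<Sum>j\<in>J. \<Sum>l\<in>I. \<bar>mean R I (\<lambda>z e. G j z e * stab (1 - 1 / r) z e l)\<bar> powr s)"
      by (simp add: c abs_mult powr_mult sum_distrib_left)
    also have "\<dots> \<le> 16 powr s * (\<Sum>j\<in>J. K * mean R I (\<lambda>z e. \<bar>G j z e\<bar> powr s))"
      by (intro mult_left_mono sum_mono K(2) fin) auto
    also have "\<dots> = 16 powr s * (K * mean R I (\<lambda>z e. \<Sum>j\<in>J. \<bar>G j z e\<bar> powr s))"
      by (simp add: smean_sum pmean_sum sum_distrib_left)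
    also have "\<dots> \<le> 16 powr s * (K * mean R I (\<lambda>z e. 1))"
      using K(1) F1 unfolding G_def
      by (intro mult_left_mono pmean_mono smean_mono wkfD[OF w]) auto
    finally show ?thesis using fin by (simp add: smean_const pmean_const)
  qed
  then show ?thesis using K(1) by (intro exI[of _ "16 powr s * K"]) simp
qed

lemma wkf_scale:
  assumes "wkf p W J A x" "c \<ge> 0" "c powr p * W \<le> V"
  shows "wkf p V J A (\<lambda>j a. c * x j a)"
  unfolding wkf_def
proof (intro allI impI)
  fix \<phi> :: "_ \<Rightarrow> real" assume phi: "\<forall>a\<in>A. \<bar>\<phi> a\<bar> \<le> 1"
  have "(\<Sum>j\<in>J. \<bar>\<Sum>a\<in>A. c * x j a * \<phi> a\<bar> powr p) = c powr p * (\<Sum>j\<in>J. \<bar>\<Sum>a\<in>A. x j a * \<phi> a\<bar> powr p)"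
    using assms(2) by (simp add: mult.assoc abs_mult powr_mult sum_distrib_left[symmetric])
  also have "\<dots> \<le> c powr p * W" using phi by (intro mult_left_mono wkfD[OF assms(1)]) auto
  finally show "(\<Sum>j\<in>J. \<bar>\<Sum>a\<in>A. c * x j a * \<phi> a\<bar> powr p) \<le> V" using assms(3) by linarith
qed

lemma sqrt_powr_two: "x \<ge> 0 \<Longrightarrow> sqrt x powr 2 = x"
  by (simp add: powr_half_sqrt[symmetric] powr_powr)

text \<open>The two mechanisms for one variable: Grothendieck's inequality, without loss at exponent
  2, and stable variables, with a strict increase beyond 2.\<close>

definition admissible :: "real \<Rightarrow> real \<Rightarrow> bool" where
  "admissible r s \<longleftrightarrow> r = 2 \<and> s = 2 \<or> 2 < r \<and> r < s"

text \<open>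
  The vector-valued step follows from the scalar one and Grothendieck's inequality, applied to the
  doubly indexed sequence \<open>y\<close> in the proof.
\<close>

lemma step_hilbert:
  assumes "admissible r s"
  shows "\<exists>C>0. \<forall>(J :: 'j set) (A :: 'a set) (\<Lambda> :: 'l set) (I :: 'i set) x f.
    finite J \<longrightarrow> finite A \<longrightarrow> finite \<Lambda> \<longrightarrow> finite I \<longrightarrow> wkf s 1 J A x \<longrightarrow>
    (\<forall>a\<in>A. (\<Sum>l\<in>\<Lambda>. sqrt (\<Sum>i\<in>I. (f l i a)\<^sup>2) powr r) \<le> 1) \<longrightarrow>
    (\<Sum>j\<in>J. \<Sum>l\<in>\<Lambda>. sqrt (\<Sum>i\<in>I. (\<Sum>a\<in>A. x j a * f l i a)\<^sup>2) powr s) \<le> C"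
  using assms unfolding admissible_def
proof (elim disjE conjE)
  assume rs: "2 < r" "r < s"
  obtain C where C: "C > 0" and C': "\<forall>(J :: 'j set) (A :: 'a set) (I :: 'l set) x f. finite J \<longrightarrow>
      finite A \<longrightarrow> finite I \<longrightarrow>
    wkf s 1 J A x \<longrightarrow> (\<forall>a\<in>A. (\<Sum>l\<in>I. \<bar>f l a\<bar> powr r) \<le> 1) \<longrightarrow>
    (\<Sum>j\<in>J. \<Sum>l\<in>I. \<bar>\<Sum>a\<in>A. x j a * f l a\<bar> powr s) \<le> C"
    using step_scalar[OF rs] by (elim exE conjE)
  have "(\<Sum>j\<in>J. \<Sum>l\<in>\<Lambda>. sqrt (\<Sum>i\<in>I. (\<Sum>a\<in>A. x j a * f l i a)\<^sup>2) powr s) \<le> 192 powr s * C"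
    if fin: "finite J" "finite A" "finite \<Lambda>" "finite I" and w: "wkf s 1 J A x"
      and f: "\<And>a. a \<in> A \<Longrightarrow> (\<Sum>l\<in>\<Lambda>. sqrt (\<Sum>i\<in>I. (f l i a)\<^sup>2) powr r) \<le> 1"
    for J :: "'j set" and A :: "'a set" and \<Lambda> :: "'l set" and I :: "'i set" and x f
  proof -
    define n where "n l a = sqrt (\<Sum>i\<in>I. (f l i a)\<^sup>2)" for l a
    have n0: "n l a \<ge> 0" for l a by (simp add: n_def sum_nonneg)
    \<comment> \<open>The length \<open>n l a\<close> goes into the new matrix \<open>y\<close>, the
      direction into the vectors \<open>u\<close>. A test on pairs (a, l) multiplies
      \<open>n l a\<close> by a number of modulus at most 1, so the scalar case bounds the weak
      s-norm of \<open>y\<close>.\<close>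
    define y where "y = (\<lambda>(j, l) (a, l'). if l' = l then x j a * n l a else 0)"
    define u where "u = (\<lambda>(a, l) i. f l i a / n l a)"
    define c where "c = C powr (- 1 / s)"
    have cs: "c powr s * C = 1" 
    proof -
      have "c powr s = C powr - 1" using rs by (simp only: c_def powr_powr) simp
      then show ?thesis using C(1) by (simp add: powr_minus_divide)
    qed
    have y: "(\<Sum>b\<in>A \<times> \<Lambda>. y (j, l) b * v b) = (\<Sum>a\<in>A. x j a * (n l a * v (a, l)))" if "l \<in> \<Lambda>" for j l v
    proof -
      have "(\<Sum>b\<in>A \<times> \<Lambda>. y (j, l) b * v b) = (\<Sum>a\<in>A. \<Sum>l'\<in>\<Lambda>. y (j, l) (a, l') * v (a, l'))"
        by (simp add: sum.cartesian_product case_prod_unfold)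
      also have "\<dots> = (\<Sum>a\<in>A. \<Sum>l'\<in>\<Lambda>. if l' = l then x j a * (n l a * v (a, l)) else 0)"
        by (intro sum.cong) (auto simp: y_def)
      finally show ?thesis using fin that by simp
    qed
    have "wkf s C (J \<times> \<Lambda>) (A \<times> \<Lambda>) y"
      unfolding wkf_def
    proof (intro allI impI)
      fix \<phi> :: "'a \<times> 'l \<Rightarrow> real" assume phi: "\<forall>b\<in>A \<times> \<Lambda>. \<bar>\<phi> b\<bar> \<le> 1"
      have "(\<Sum>k\<in>J \<times> \<Lambda>. \<bar>\<Sum>b\<in>A \<times> \<Lambda>. y k b * \<phi> b\<bar> powr s)
          = (\<Sum>j\<in>J. \<Sum>l\<in>\<Lambda>. \<bar>\<Sum>b\<in>A \<times> \<Lambda>. y (j, l) b * \<phi> b\<bar> powr s)"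
        by (simp add: sum.cartesian_product case_prod_unfold)
      also have "\<dots> = (\<Sum>j\<in>J. \<Sum>l\<in>\<Lambda>. \<bar>\<Sum>a\<in>A. x j a * (n l a * \<phi> (a, l))\<bar> powr s)"
        by (simp add: y)
      also have "\<dots> \<le> C"
      proof (intro C'[rule_format] fin w)
        fix a assume a: "a \<in> A"
        have "(\<Sum>l\<in>\<Lambda>. \<bar>n l a * \<phi> (a, l)\<bar> powr r) \<le> (\<Sum>l\<in>\<Lambda>. n l a powr r)"
        proof (intro sum_mono powr_mono2)
          fix l assume "l \<in> \<Lambda>"
          then have "n l a * \<bar>\<phi> (a, l)\<bar> \<le> n l a * 1" using phi a n0 by (intro mult_left_mono) auto
          then show "\<bar>n l a * \<phi> (a, l)\<bar> \<le> n l a" using n0 by (simp add: abs_mult)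
        qed (use rs in auto)
        also have "\<dots> \<le> 1" using f[OF a] by (simp add: n_def)
        finally show "(\<Sum>l\<in>\<Lambda>. \<bar>n l a * \<phi> (a, l)\<bar> powr r) \<le> 1" .
      qed
      finally show "(\<Sum>k\<in>J \<times> \<Lambda>. \<bar>\<Sum>b\<in>A \<times> \<Lambda>. y k b * \<phi> b\<bar> powr s) \<le> C" .
    qed
    then have "wkf s 1 (J \<times> \<Lambda>) (A \<times> \<Lambda>) (\<lambda>k b. c * y k b)"
      by (rule wkf_scale) (simp_all only: cs, simp_all add: c_def)
    then have "(\<Sum>k\<in>J \<times> \<Lambda>. sqrt (\<Sum>i\<in>I. (\<Sum>b\<in>A \<times> \<Lambda>. c * y k b * u b i)\<^sup>2) powr s) \<le> 192 powr s"
    proof (rule grothendieck_powr[rotated 3])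
      fix b assume "b \<in> A \<times> \<Lambda>"
      obtain a l where b: "b = (a, l)" by (cases b)
      have "(\<Sum>i\<in>I. (u b i)\<^sup>2) = (\<Sum>i\<in>I. (f l i a)\<^sup>2) / (n l a)\<^sup>2"
        by (simp add: u_def b power_divide sum_divide_distrib)
      also have "\<dots> \<le> 1" by (simp add: n_def sum_nonneg)
      finally show "(\<Sum>i\<in>I. (u b i)\<^sup>2) \<le> 1" .
    qed (use fin rs in auto)
    also have "(\<Sum>k\<in>J \<times> \<Lambda>. sqrt (\<Sum>i\<in>I. (\<Sum>b\<in>A \<times> \<Lambda>. c * y k b * u b i)\<^sup>2) powr s)
        = (\<Sum>j\<in>J. \<Sum>l\<in>\<Lambda>. sqrt (\<Sum>i\<in>I. (\<Sum>b\<in>A \<times> \<Lambda>. c * y (j, l) b * u b i)\<^sup>2) powr s)"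
      by (simp add: sum.cartesian_product case_prod_unfold)
    also have "\<dots> = (\<Sum>j\<in>J. \<Sum>l\<in>\<Lambda>. c powr s * sqrt (\<Sum>i\<in>I. (\<Sum>a\<in>A. x j a * f l i a)\<^sup>2) powr s)"
    proof (intro sum.cong refl)
      fix j l assume l: "l \<in> \<Lambda>"
      \<comment> \<open>Division by zero in \<open>u\<close> is harmless, as a vector of length 0
        has zero coordinates.\<close>
      have "n l a * u (a, l) i = f l i a" if "i \<in> I" for a i
      proof (cases "n l a = 0")
        case True
        then have "f l i a = 0" using that fin by (simp add: n_def sum_nonneg_eq_0_iff)
        then show ?thesis using True by simp
      qed (simp add: u_def)
      then have "(\<Sum>a\<in>A. x j a * (n l a * u (a, l) i)) = (\<Sum>a\<in>A. x j a * f l i a)" if "i \<in> I" for i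
        using that by (intro sum.cong refl) simp
      moreover have "(\<Sum>b\<in>A \<times> \<Lambda>. c * y (j, l) b * u b i) = c * (\<Sum>b\<in>A \<times> \<Lambda>. y (j, l) b * u b i)" for i
        by (simp only: mult.assoc sum_distrib_left)
      ultimately have "(\<Sum>b\<in>A \<times> \<Lambda>. c * y (j, l) b * u b i) = c * (\<Sum>a\<in>A. x j a * f l i a)" if "i \<in>
          I" for i
        using that y[OF l, of j "\<lambda>b. u b i"] by simp
      then have "(\<Sum>i\<in>I. (\<Sum>b\<in>A \<times> \<Lambda>. c * y (j, l) b * u b i)\<^sup>2) = (\<Sum>i\<in>I. c\<^sup>2 * (\<Sum>a\<in>A. x j a * f l i
          a)\<^sup>2)"
        by (intro sum.cong refl) (simp only: power_mult_distrib)
      also have "\<dots> = c\<^sup>2 * (\<Sum>i\<in>I. (\<Sum>a\<in>A. x j a * f l i a)\<^sup>2)" by (simp add: sum_distrib_left)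
      finally show "sqrt (\<Sum>i\<in>I. (\<Sum>b\<in>A \<times> \<Lambda>. c * y (j, l) b * u b i)\<^sup>2) powr s
          = c powr s * sqrt (\<Sum>i\<in>I. (\<Sum>a\<in>A. x j a * f l i a)\<^sup>2) powr s"
        by (simp add: real_sqrt_mult powr_mult c_def)
    qed
    also have "\<dots> = c powr s * (\<Sum>j\<in>J. \<Sum>l\<in>\<Lambda>. sqrt (\<Sum>i\<in>I. (\<Sum>a\<in>A. x j a * f l i a)\<^sup>2) powr s)"
      by (simp add: sum_distrib_left)
    finally have fin_le: "c powr s * (\<Sum>j\<in>J. \<Sum>l\<in>\<Lambda>. sqrt (\<Sum>i\<in>I. (\<Sum>a\<in>A. x j a * f l i a)\<^sup>2) powr s) \<le>
        192 powr s" .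
    have "C * (c powr s * (\<Sum>j\<in>J. \<Sum>l\<in>\<Lambda>. sqrt (\<Sum>i\<in>I. (\<Sum>a\<in>A. x j a * f l i a)\<^sup>2) powr s)) \<le> C * 192
        powr s"
      using C(1) by (intro mult_left_mono fin_le) simp
    moreover have "C * (c powr s * X) = X" for X
    proof -
      have "C * (c powr s * X) = (c powr s * C) * X" by simp
      then show ?thesis unfolding cs by simp
    qed
    ultimately show ?thesis by (simp only: mult.commute)
  qed
  then show ?thesis using C(1) by (intro exI[of _ "192 powr s * C"]) simp
next
  assume rs: "r = 2" "s = 2"
  have "(\<Sum>j\<in>J. \<Sum>l\<in>\<Lambda>. sqrt (\<Sum>i\<in>I. (\<Sum>a\<in>A. x j a * f l i a)\<^sup>2) powr s) \<le> 192 powr 2"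
    if fin: "finite J" "finite A" "finite \<Lambda>" "finite I" and w: "wkf s 1 J A x"
      and f: "\<And>a. a \<in> A \<Longrightarrow> (\<Sum>l\<in>\<Lambda>. sqrt (\<Sum>i\<in>I. (f l i a)\<^sup>2) powr r) \<le> 1"
    for J :: "'j set" and A :: "'a set" and \<Lambda> :: "'l set" and I :: "'i set" and x f
  proof -
    \<comment> \<open>At exponent 2 the target l_2(\<Lambda>; l_2(I)) is the Hilbert space over
      \<Lambda> \<times> I, and Grothendieck's inequality applies directly.\<close>
    have sq: "sqrt (\<Sum>i\<in>I. (h i)\<^sup>2) powr 2 = (\<Sum>i\<in>I. (h i)\<^sup>2)" for h :: "'i \<Rightarrow> real"
      by (intro sqrt_powr_two sum_nonneg) simp
    have fl: "(\<Sum>k\<in>\<Lambda> \<times> I. H (fst k) (snd k)) = (\<Sum>l\<in>\<Lambda>. \<Sum>i\<in>I. H l i)" for H :: "'l \<Rightarrow> 'i \<Rightarrow> real"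
      by (simp add: sum.cartesian_product case_prod_unfold)
    have t: "(\<Sum>k\<in>\<Lambda> \<times> I. (f (fst k) (snd k) a)\<^sup>2) \<le> 1" if "a \<in> A" for a
      using f[OF that] fl[of "\<lambda>l i. (f l i a)\<^sup>2"] unfolding rs sq by simp
    have "(\<Sum>j\<in>J. sqrt (\<Sum>k\<in>\<Lambda> \<times> I. (\<Sum>a\<in>A. x j a * f (fst k) (snd k) a)\<^sup>2) powr 2) \<le> 192 powr 2"
      using fin w t unfolding rs by (intro grothendieck_powr) simp_all
    also have "(\<Sum>j\<in>J. sqrt (\<Sum>k\<in>\<Lambda> \<times> I. (\<Sum>a\<in>A. x j a * f (fst k) (snd k) a)\<^sup>2) powr 2)
        = (\<Sum>j\<in>J. \<Sum>l\<in>\<Lambda>. \<Sum>i\<in>I. (\<Sum>a\<in>A. x j a * f l i a)\<^sup>2)"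
    proof (intro sum.cong refl)
      fix j
      have "sqrt (\<Sum>k\<in>\<Lambda> \<times> I. (\<Sum>a\<in>A. x j a * f (fst k) (snd k) a)\<^sup>2) powr 2
          = (\<Sum>k\<in>\<Lambda> \<times> I. (\<Sum>a\<in>A. x j a * f (fst k) (snd k) a)\<^sup>2)"
        by (intro sqrt_powr_two sum_nonneg) simp
      also have "\<dots> = (\<Sum>l\<in>\<Lambda>. \<Sum>i\<in>I. (\<Sum>a\<in>A. x j a * f l i a)\<^sup>2)" by (rule fl)
      finally show "sqrt (\<Sum>k\<in>\<Lambda> \<times> I. (\<Sum>a\<in>A. x j a * f (fst k) (snd k) a)\<^sup>2) powr 2
          = (\<Sum>l\<in>\<Lambda>. \<Sum>i\<in>I. (\<Sum>a\<in>A. x j a * f l i a)\<^sup>2)" .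
    qed
    finally show ?thesis unfolding rs sq .
  qed
  then show ?thesis by (intro exI[of _ "192 powr 2"]) simp
qed

subsection \<open>Factorization through the weak 2-norm\<close>

text \<open>Every point of the cube is a barycentre of its vertices: \<nu> is the product law whose
  coordinate at \<open>a\<close> equals 1 with probability (1 + \<phi> a) / 2.\<close>

lemma random_rounding:
  fixes \<phi> :: "'a \<Rightarrow> real"
  assumes A: "finite A" and phi: "\<And>a. a \<in> A \<Longrightarrow> \<bar>\<phi> a\<bar> \<le> 1"
  shows "\<exists>\<nu>. (\<forall>f\<in>signs A. \<nu> f \<ge> 0) \<and> (\<Sum>f\<in>signs A. \<nu> f) = 1 \<and>
    (\<forall>a\<in>A. (\<Sum>f\<in>signs A. \<nu> f * f a) = \<phi> a)"
proof -
  define \<nu> where "\<nu> f = (\<Prod>a\<in>A. (1 + f a * \<phi> a) / 2)" for f :: "'a \<Rightarrow> real"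
  have "\<nu> f \<ge> 0" if "f \<in> signs A" for f
    unfolding \<nu>_def
  proof (rule prod_nonneg)
    fix a assume a: "a \<in> A"
    then have "f a \<in> {-1, 1}" using that by blast
    then show "0 \<le> (1 + f a * \<phi> a) / 2" using phi[OF a] by auto
  qed
  moreover have "(\<Sum>f\<in>signs A. \<nu> f) = 1"
  proof -
    have "(\<Sum>f\<in>signs A. \<nu> f) = (\<Prod>a\<in>A. \<Sum>b\<in>{-1, 1::real}. (1 + b * \<phi> a) / 2)"
      unfolding \<nu>_def using A by (subst prod_sum_PiE) auto
    also have "\<dots> = 1" by (intro prod.neutral) (simp add: field_simps)
    finally show ?thesis .
  qed
  moreover have "(\<Sum>f\<in>signs A. \<nu> f * f a) = \<phi> a" if a: "a \<in> A" for a
  proof -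
    let ?g = "\<lambda>c b. (1 + b * \<phi> c) / 2 * (if c = a then b else 1)"
    have "(\<Sum>f\<in>signs A. \<nu> f * f a) = (\<Sum>f\<in>signs A. \<Prod>c\<in>A. ?g c (f c))"
      unfolding \<nu>_def prod.distrib using A a by (simp add: prod.delta)
    also have "\<dots> = (\<Prod>c\<in>A. \<Sum>b\<in>{-1, 1}. ?g c b)"
      using A by (subst prod_sum_PiE) auto
    also have "\<dots> = (\<Prod>c\<in>A. if c = a then \<phi> a else 1)"
      by (intro prod.cong) (auto simp: field_simps)
    finally show ?thesis using A a by (simp add: prod.delta)
  qed
  ultimately show ?thesis by (intro exI[of _ \<nu>]) simp
qed

text \<open>Pinning the coordinates outside \<open>F\<close> to 0 makes the set a closed part of a
  product of compact sets in the full function space, so Tychonoff's theorem applies.\<close>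

lemma compact_simplex:
  assumes "finite F"
  shows "compact {\<mu> :: 'f \<Rightarrow> real. (\<forall>f. \<mu> f \<in> (if f \<in> F then {0..1} else {0})) \<and> (\<Sum>f\<in>F. \<mu> f) = 1}"
proof -
  let ?S = "\<lambda>f. if f \<in> F then {0..1} else {0::real}"
  have "compactin (product_topology (\<lambda>_. euclidean) UNIV) (PiE UNIV ?S)"
    by (subst compactin_PiE) auto
  then have "compact (PiE UNIV ?S)"
    by (simp add: euclidean_product_topology)
  moreover have "closed {\<mu> :: 'f \<Rightarrow> real. (\<Sum>f\<in>F. \<mu> f) = 1}"
    by (intro closed_Collect_eq continuous_intros continuous_on_product_coordinates)
  ultimately have "compact (PiE UNIV ?S \<inter> {\<mu> :: 'f \<Rightarrow> real. (\<Sum>f\<in>F. \<mu> f) = 1})"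
    by (rule compact_Int_closed)
  also have "PiE UNIV ?S \<inter> {\<mu> :: 'f \<Rightarrow> real. (\<Sum>f\<in>F. \<mu> f) = 1}
      = {\<mu>. (\<forall>f. \<mu> f \<in> ?S f) \<and> (\<Sum>f\<in>F. \<mu> f) = 1}"
    by (auto simp: PiE_def Pi_def)
  finally show ?thesis .
qed

text \<open>
  The weights \<open>H\<close> come from a maximizer \<open>\<mu>\<close> of the concave function \<open>\<Psi>\<close> on the simplex: its
  first-order condition in the direction of each sign vector is the last claim. The shift by \<open>\<delta>\<close>
  keeps \<open>\<Psi>\<close> differentiable.
\<close>

lemma factor_signs:
  fixes x :: "'j \<Rightarrow> 'a \<Rightarrow> real"
  assumes p: "1 \<le> p" "p < 2" and \<delta>: "\<delta> > 0" and fin: "finite J" "finite A" and w: "wkf p 1 J A x"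
  shows "\<exists>H. (\<forall>j\<in>J. H j \<ge> \<delta>) \<and> (\<Sum>j\<in>J. H j powr (p / 2)) \<le> 192 powr p + card J * \<delta> powr (p / 2) \<and>
    (\<forall>f\<in>signs A. (\<Sum>j\<in>J. H j powr (p / 2 - 1) * (\<Sum>a\<in>A. x j a * f a)\<^sup>2) \<le> (\<Sum>j\<in>J. H j powr (p / 2)))"
proof -
  define F where "F = signs A"
  have F: "finite F" "F \<noteq> {}" using fin by (auto simp: F_def finite_signs PiE_eq_empty_iff)
  define c where "c j f = (\<Sum>a\<in>A. x j a * f a)\<^sup>2" for j f
  have c0: "c j f \<ge> 0" for j f by (simp add: c_def)
  define D where "D = {\<mu> :: ('a \<Rightarrow> real) \<Rightarrow> real. (\<forall>f. \<mu> f \<in> (if f \<in> F then {0..1} else {0})) \<and>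
      (\<Sum>f\<in>F. \<mu> f) = 1}"
  \<comment> \<open>\<open>G \<mu> j\<close> is the second moment of the j-th form under the law
    \<mu> on the sign vectors.\<close>
  define G where "G \<mu> j = (\<Sum>f\<in>F. \<mu> f * c j f)" for \<mu> j
  have D0: "\<mu> f \<ge> 0" "\<mu> f \<le> 1" if "\<mu> \<in> D" for \<mu> f
  proof -
    have "\<mu> f \<in> (if f \<in> F then {0..1} else {0})" using that by (simp add: D_def)
    then show "\<mu> f \<ge> 0" "\<mu> f \<le> 1" by (auto split: if_splits)
  qed
  have G0: "G \<mu> j \<ge> 0" if "\<mu> \<in> D" for \<mu> j
    unfolding G_def using D0[OF that] c0 by (intro sum_nonneg mult_nonneg_nonneg) auto
  define \<Psi> where "\<Psi> \<mu> = (\<Sum>j\<in>J. (\<delta> + G \<mu> j) powr (p / 2))" for \<mu>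
  have "compact D" unfolding D_def using F by (intro compact_simplex)
  moreover obtain f1 where f1: "f1 \<in> F" using F by blast
  have "(\<lambda>f. if f = f1 then 1 else 0) \<in> D" using F f1 by (auto simp: D_def)
  then have "D \<noteq> {}" by blast
  moreover have "continuous_on D \<Psi>"
    unfolding \<Psi>_def
  proof (intro continuous_on_sum continuous_on_powr')
    fix j
    show "continuous_on D (\<lambda>\<mu>. \<delta> + G \<mu> j)"
      unfolding G_def
      by (intro continuous_intros continuous_on_subset[OF continuous_on_product_coordinates]) simp
    show "\<forall>\<mu>\<in>D. 0 \<le> \<delta> + G \<mu> j \<and> (\<delta> + G \<mu> j = 0 \<longrightarrow> 0 < p / 2)"
      using G0 \<delta> p by (auto intro: add_nonneg_nonneg less_imp_le)
  qed simp
  ultimately have "\<exists>\<mu>\<in>D. \<forall>\<mu>'\<in>D. \<Psi> \<mu>' \<le> \<Psi> \<mu>" by (rule continuous_attains_sup)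
  then obtain \<mu> where \<mu>: "\<mu> \<in> D" and mx: "\<And>\<mu>'. \<mu>' \<in> D \<Longrightarrow> \<Psi> \<mu>' \<le> \<Psi> \<mu>" by blast
  define H where "H j = \<delta> + G \<mu> j" for j
  have H: "H j \<ge> \<delta>" "H j > 0" for j using G0[OF \<mu>, of j] \<delta> by (auto simp: H_def)
  have sqp: "sqrt u powr p = u powr (p / 2)" if "u \<ge> 0" for u
    using that by (simp add: powr_half_sqrt[symmetric] powr_powr)
  \<comment> \<open>For a law \<mu> on signs the vectors with coordinates
    \<open>sqrt (\<mu> f) * f a\<close> have length 1. Grothendieck's inequality therefore bounds
    the sum of \<open>G \<mu> j powr (p / 2)\<close>.\<close>
  have "(\<Sum>j\<in>J. sqrt (\<Sum>f\<in>F. (\<Sum>a\<in>A. x j a * (sqrt (\<mu> f) * f a))\<^sup>2) powr p) \<le> 192 powr p"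
  proof (intro grothendieck_powr fin F w p)
    fix a assume a: "a \<in> A"
    have "(\<Sum>f\<in>F. (sqrt (\<mu> f) * f a)\<^sup>2) = (\<Sum>f\<in>F. \<mu> f)"
    proof (rule sum.cong)
      fix f assume "f \<in> F"
      then have "f a \<in> {-1, 1}" using a unfolding F_def by blast
      then show "(sqrt (\<mu> f) * f a)\<^sup>2 = \<mu> f" using D0[OF \<mu>, of f] by (auto simp: power_mult_distrib)
    qed simp
    then show "(\<Sum>f\<in>F. (sqrt (\<mu> f) * f a)\<^sup>2) \<le> 1" using \<mu> by (simp add: D_def)
  qed
  also have "(\<Sum>j\<in>J. sqrt (\<Sum>f\<in>F. (\<Sum>a\<in>A. x j a * (sqrt (\<mu> f) * f a))\<^sup>2) powr p) = (\<Sum>j\<in>J. G \<mu> j powr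
      (p / 2))"
  proof (rule sum.cong)
    fix j
    have "(\<Sum>f\<in>F. (\<Sum>a\<in>A. x j a * (sqrt (\<mu> f) * f a))\<^sup>2) = G \<mu> j"
      unfolding G_def c_def
    proof (rule sum.cong)
      fix f
      have "(\<Sum>a\<in>A. x j a * (sqrt (\<mu> f) * f a)) = sqrt (\<mu> f) * (\<Sum>a\<in>A. x j a * f a)"
        by (simp add: sum_distrib_left mult_ac)
      then show "(\<Sum>a\<in>A. x j a * (sqrt (\<mu> f) * f a))\<^sup>2 = \<mu> f * (\<Sum>a\<in>A. x j a * f a)\<^sup>2"
        using D0[OF \<mu>, of f] by (simp add: power_mult_distrib)
    qed simp
    then show "sqrt (\<Sum>f\<in>F. (\<Sum>a\<in>A. x j a * (sqrt (\<mu> f) * f a))\<^sup>2) powr p = G \<mu> j powr (p / 2)"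
      using G0[OF \<mu>] by (simp add: sqp)
  qed simp
  finally have Gb: "(\<Sum>j\<in>J. G \<mu> j powr (p / 2)) \<le> 192 powr p" .
  have "(\<Sum>j\<in>J. H j powr (p / 2)) \<le> (\<Sum>j\<in>J. \<delta> powr (p / 2) + G \<mu> j powr (p / 2))"
    unfolding H_def using p \<delta> G0[OF \<mu>] by (intro sum_mono powr_add_le) auto
  also have "\<dots> \<le> 192 powr p + card J * \<delta> powr (p / 2)" using Gb by (simp add: sum.distrib)
  finally have Hb: "(\<Sum>j\<in>J. H j powr (p / 2)) \<le> 192 powr p + card J * \<delta> powr (p / 2)" .
  have fo: "(\<Sum>j\<in>J. H j powr (p / 2 - 1) * c j f0) \<le> (\<Sum>j\<in>J. H j powr (p / 2))" if f0: "f0 \<in> F" for f0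
  proof -
    \<comment> \<open>\<open>h\<close> is \<Psi> along the segment from the maximizer to the point
      mass at \<open>f0\<close>; its derivative at 0 cannot be positive.\<close>
    define h where "h t = (\<Sum>j\<in>J. (H j + t * (c j f0 - G \<mu> j)) powr (p / 2))" for t
    have h_le: "h t \<le> h 0" if t: "0 \<le> t" "t \<le> 1" for t
    proof -
      define \<mu>' where "\<mu>' f = (1 - t) * \<mu> f + t * (if f = f0 then 1 else 0)" for f
      have s1: "(\<Sum>f\<in>F. \<mu>' f) = 1"
      proof -
        have "(\<Sum>f\<in>F. \<mu>' f) = (1 - t) * (\<Sum>f\<in>F. \<mu> f) + t * (\<Sum>f\<in>F. if f = f0 then 1 else 0)"
          unfolding \<mu>'_def by (simp only: sum.distrib sum_distrib_left)
        then show ?thesis using \<mu> F f0 by (simp add: D_def)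
      qed
      have n0: "\<mu>' f \<ge> 0" for f unfolding \<mu>'_def using D0[OF \<mu>] t by simp
      have "\<mu>' f \<in> (if f \<in> F then {0..1} else {0})" for f
      proof (cases "f \<in> F")
        case True
        then have "\<mu>' f \<le> (\<Sum>f\<in>F. \<mu>' f)" using F n0 by (intro member_le_sum) auto
        then show ?thesis using True n0 s1 by simp
      next
        case False
        have "\<mu> f \<in> (if f \<in> F then {0..1} else {0})" using \<mu> by (simp add: D_def)
        then have "\<mu> f = 0" using False by simp
        then show ?thesis using False f0 by (auto simp: \<mu>'_def)
      qed
      then have mu': "\<mu>' \<in> D" using s1 by (simp add: D_def)
      have "\<delta> + G \<mu>' j = H j + t * (c j f0 - G \<mu> j)" for j
      proof -
        have "G \<mu>' j = (\<Sum>f\<in>F. (1 - t) * (\<mu> f * c j f) + t * (if f = f0 then c j f else 0))"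
          unfolding G_def \<mu>'_def by (intro sum.cong) (auto simp: algebra_simps)
        also have "\<dots> = (1 - t) * G \<mu> j + t * (\<Sum>f\<in>F. if f = f0 then c j f else 0)"
          unfolding G_def by (simp only: sum.distrib sum_distrib_left)
        also have "(\<Sum>f\<in>F. if f = f0 then c j f else 0) = c j f0" using F f0 by simp
        finally show ?thesis by (simp add: H_def algebra_simps)
      qed
      then have "\<Psi> \<mu>' = h t" by (simp add: \<Psi>_def h_def)
      moreover have "\<Psi> \<mu> = h 0" by (simp add: \<Psi>_def h_def H_def)
      ultimately show ?thesis using mx[OF mu'] by simp
    qed
    define d where "d = (\<Sum>j\<in>J. (c j f0 - G \<mu> j) * (p / 2) * H j powr (p / 2 - 1))"
    have "(h has_real_derivative d) (at 0)"
      unfolding h_def d_def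
    proof (rule DERIV_sum)
      fix j
      show "((\<lambda>t. (H j + t * (c j f0 - G \<mu> j)) powr (p / 2)) has_real_derivative
          (c j f0 - G \<mu> j) * (p / 2) * H j powr (p / 2 - 1)) (at 0)"
        using H(2)[of j] by (auto intro!: derivative_eq_intros simp: powr_diff)
    qed
    have "d \<le> 0"
    proof (rule ccontr)
      assume "\<not> d \<le> 0"
      then obtain e where e: "e > 0" "\<And>u. 0 < u \<Longrightarrow> u < e \<Longrightarrow> h 0 < h (0 + u)"
        using DERIV_pos_inc_right[OF \<open>(h has_real_derivative d) (at 0)\<close>] by auto
      define u where "u = min (e / 2) 1"
      have "0 < u" "u < e" "u \<le> 1" using e(1) by (auto simp: u_def)
      then show False using e(2)[of u] h_le[of u] by simp
    qed
    moreover have "d = p / 2 * (\<Sum>j\<in>J. H j powr (p / 2 - 1) * (c j f0 - G \<mu> j))"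
      unfolding d_def sum_distrib_left by (intro sum.cong refl) (simp add: mult_ac)
    ultimately have "(\<Sum>j\<in>J. H j powr (p / 2 - 1) * (c j f0 - G \<mu> j)) \<le> 0"
      using p by (simp add: mult_le_0_iff)
    then have "(\<Sum>j\<in>J. H j powr (p / 2 - 1) * c j f0) \<le> (\<Sum>j\<in>J. H j powr (p / 2 - 1) * G \<mu> j)"
      by (simp add: right_diff_distrib sum_subtractf)
    \<comment> \<open>The first-order condition has \<open>G \<mu> j\<close> on its right-hand side,
      which is below \<open>H j\<close>.\<close>
    also have "\<dots> \<le> (\<Sum>j\<in>J. H j powr (p / 2 - 1) * H j)"
      using \<delta> by (intro sum_mono mult_left_mono) (auto simp: H_def)
    also have "\<dots> = (\<Sum>j\<in>J. H j powr (p / 2))"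
    proof (intro sum.cong refl)
      fix j
      show "H j powr (p / 2 - 1) * H j = H j powr (p / 2)" using H(2)[of j] by (simp add: powr_diff)
    qed
    finally show ?thesis .
  qed
  show ?thesis
    by (rule exI[of _ H]) (use H(1) Hb fo in \<open>auto simp: c_def F_def\<close>)
qed

text \<open>For fixed weights the left-hand side is a convex function of \<phi>, so its maximum over
  the cube is attained at the sign vectors. Concretely, \<phi> is averaged over signs, and Jensen's
  inequality for the square comes from Cauchy-Schwarz.\<close>

lemma factor_finite:
  fixes x :: "'j \<Rightarrow> 'a \<Rightarrow> real"
  assumes p: "1 \<le> p" "p < 2" and \<delta>: "\<delta> > 0" and fin: "finite J" "finite A" and w: "wkf p 1 J A x"
  shows "\<exists>H. (\<forall>j\<in>J. H j \<ge> \<delta>) \<and> (\<Sum>j\<in>J. H j powr (p / 2)) \<le> 192 powr p + card J * \<delta> powr (p / 2) \<and>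
    (\<forall>\<phi>. (\<forall>a\<in>A. \<bar>\<phi> a\<bar> \<le> 1) \<longrightarrow>
      (\<Sum>j\<in>J. H j powr (p / 2 - 1) * (\<Sum>a\<in>A. x j a * \<phi> a)\<^sup>2) \<le> (\<Sum>j\<in>J. H j powr (p / 2)))"
proof -
  let ?F = "signs A"
  from factor_signs[OF assms] obtain H where
    Hs: "(\<forall>j\<in>J. H j \<ge> \<delta>) \<and> (\<Sum>j\<in>J. H j powr (p / 2)) \<le> 192 powr p + card J * \<delta> powr (p / 2) \<and>
      (\<forall>f\<in>?F. (\<Sum>j\<in>J. H j powr (p / 2 - 1) * (\<Sum>a\<in>A. x j a * f a)\<^sup>2) \<le> (\<Sum>j\<in>J. H j powr (p / 2)))" ..
  note s = Hs[THEN conjunct2, THEN conjunct2]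
  have "(\<Sum>j\<in>J. H j powr (p / 2 - 1) * (\<Sum>a\<in>A. x j a * \<phi> a)\<^sup>2) \<le> (\<Sum>j\<in>J. H j powr (p / 2))"
    if phi: "\<forall>a\<in>A. \<bar>\<phi> a\<bar> \<le> 1" for \<phi>
  proof -
    from random_rounding[OF fin(2), of \<phi>] phi obtain \<nu> where
      "(\<forall>f\<in>?F. \<nu> f \<ge> 0) \<and> (\<Sum>f\<in>?F. \<nu> f) = 1 \<and> (\<forall>a\<in>A. (\<Sum>f\<in>?F. \<nu> f * f a) = \<phi> a)" by auto
    then have \<nu>: "\<And>f. f \<in> ?F \<Longrightarrow> \<nu> f \<ge> 0" "(\<Sum>f\<in>?F. \<nu> f) = 1"
      "\<And>a. a \<in> A \<Longrightarrow> (\<Sum>f\<in>?F. \<nu> f * f a) = \<phi> a" by simp_all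
    have jensen: "(\<Sum>a\<in>A. x j a * \<phi> a)\<^sup>2 \<le> (\<Sum>f\<in>?F. \<nu> f * (\<Sum>a\<in>A. x j a * f a)\<^sup>2)" for j
    proof -
      have "(\<Sum>a\<in>A. x j a * \<phi> a) = (\<Sum>a\<in>A. x j a * (\<Sum>f\<in>?F. \<nu> f * f a))" by (simp add: \<nu>(3))
      also have "\<dots> = (\<Sum>f\<in>?F. \<nu> f * (\<Sum>a\<in>A. x j a * f a))"
        unfolding sum_distrib_left by (subst sum.swap) (simp add: mult_ac)
      also have "\<dots> = (\<Sum>f\<in>?F. sqrt (\<nu> f) * (sqrt (\<nu> f) * (\<Sum>a\<in>A. x j a * f a)))"
        using \<nu>(1) by (intro sum.cong) (auto simp: mult.assoc[symmetric])
      finally have eq: "(\<Sum>a\<in>A. x j a * \<phi> a) = (\<Sum>f\<in>?F. sqrt (\<nu> f) * (sqrt (\<nu> f) * (\<Sum>a\<in>A. x j a * f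
          a)))" .
      have "(\<Sum>a\<in>A. x j a * \<phi> a)\<^sup>2
          \<le> (\<Sum>f\<in>?F. (sqrt (\<nu> f))\<^sup>2) * (\<Sum>f\<in>?F. (sqrt (\<nu> f) * (\<Sum>a\<in>A. x j a * f a))\<^sup>2)"
        unfolding eq by (rule Cauchy_Schwarz_ineq_sum)
      also have "\<dots> = (\<Sum>f\<in>?F. \<nu> f) * (\<Sum>f\<in>?F. \<nu> f * (\<Sum>a\<in>A. x j a * f a)\<^sup>2)"
        using \<nu>(1) by (intro arg_cong2[where f = "(*)"] sum.cong) (auto simp: power_mult_distrib)
      finally show ?thesis using \<nu>(2) by simp
    qed
    have "(\<Sum>j\<in>J. H j powr (p / 2 - 1) * (\<Sum>a\<in>A. x j a * \<phi> a)\<^sup>2)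
        \<le> (\<Sum>j\<in>J. H j powr (p / 2 - 1) * (\<Sum>f\<in>?F. \<nu> f * (\<Sum>a\<in>A. x j a * f a)\<^sup>2))"
      by (intro sum_mono mult_left_mono jensen) simp
    also have "\<dots> = (\<Sum>f\<in>?F. \<nu> f * (\<Sum>j\<in>J. H j powr (p / 2 - 1) * (\<Sum>a\<in>A. x j a * f a)\<^sup>2))"
      unfolding sum_distrib_left by (subst sum.swap) (simp add: mult_ac)
    also have "\<dots> \<le> (\<Sum>f\<in>?F. \<nu> f * (\<Sum>j\<in>J. H j powr (p / 2)))"
    proof (rule sum_mono)
      fix f assume f: "f \<in> ?F"
      show "\<nu> f * (\<Sum>j\<in>J. H j powr (p / 2 - 1) * (\<Sum>a\<in>A. x j a * f a)\<^sup>2) \<le> \<nu> f * (\<Sum>j\<in>J. H j powr (p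
          / 2))"
        using s f by (intro mult_left_mono \<nu>(1)) auto
    qed
    also have "\<dots> = (\<Sum>j\<in>J. H j powr (p / 2))" using \<nu>(2) by (simp flip: sum_distrib_right)
    finally show ?thesis .
  qed
  then show ?thesis using Hs by (intro exI[of _ H]) simp
qed

subsection \<open>Transfer to real and complex sequences\<close>

text \<open>
  Instantiated with \<open>(id, 0, 0)\<close> for the reals and with \<open>(Re, Im, \<i>)\<close> for the complex numbers.
\<close>

locale scalar_parts =
  fixes re im :: "'k::{real_normed_field,banach} \<Rightarrow> real" and \<iota> :: 'k
  assumes re: "bounded_linear re" and im: "bounded_linear im"
    and re_le: "\<And>x. \<bar>re x\<bar> \<le> norm x" and im_le: "\<And>x. \<bar>im x\<bar> \<le> norm x"
    and parts: "\<And>x. x = of_real (re x) + \<iota> * of_real (im x)" and \<iota>: "norm \<iota> \<le> 1"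
begin

lemma norm_le_parts: "norm x \<le> \<bar>re x\<bar> + \<bar>im x\<bar>"
proof -
  have "norm x \<le> norm (of_real (re x) :: 'k) + norm (\<iota> * of_real (im x))"
    by (subst parts[of x]) (rule norm_triangle_ineq)
  also have "\<dots> \<le> \<bar>re x\<bar> + 1 * \<bar>im x\<bar>"
    unfolding norm_mult norm_of_real by (intro add_left_mono mult_right_mono \<iota>) simp
  finally show ?thesis by simp
qed

lemma norm_sq_le_parts: "(norm x)\<^sup>2 \<le> 2 * ((re x)\<^sup>2 + (im x)\<^sup>2)"
proof -
  have "(norm x)\<^sup>2 \<le> (\<bar>re x\<bar> + \<bar>im x\<bar>)\<^sup>2" by (intro power_mono norm_le_parts) simp
  also have "\<dots> \<le> 2 * ((re x)\<^sup>2 + (im x)\<^sup>2)"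
    using sum_squares_bound[of "\<bar>re x\<bar>" "\<bar>im x\<bar>"] by (simp add: power2_sum)
  finally show ?thesis .
qed

lemma parts_sq_le: "(re x)\<^sup>2 + (im x)\<^sup>2 \<le> 2 * (norm x)\<^sup>2"
proof -
  have "(re x)\<^sup>2 \<le> (norm x)\<^sup>2" using re_le[of x] by (intro abs_le_square_iff[THEN iffD1]) simp
  moreover have "(im x)\<^sup>2 \<le> (norm x)\<^sup>2" using im_le[of x] by (intro abs_le_square_iff[THEN iffD1])
      simp
  ultimately show ?thesis by linarith
qed

end

text \<open>The bridge between \<open>wkf\<close> and \<open>weak_ell\<close>: scalars are real or
  complex and the coordinates infinitely many, while the tests remain real bounded sequences.
  Summability is demanded because the sum of a divergent series is an arbitrary value.\<close>

definition wk :: "real \<Rightarrow> real \<Rightarrow> nat \<Rightarrow> (nat \<Rightarrow> nat \<Rightarrow> 'k::{real_normed_field,banach}) \<Rightarrow> bool" where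
  "wk p W N x \<longleftrightarrow> (\<forall>j<N. summable (\<lambda>a. norm (x j a))) \<and>
     (\<forall>\<phi>::nat \<Rightarrow> real. (\<forall>a. \<bar>\<phi> a\<bar> \<le> 1) \<longrightarrow> (\<Sum>j<N. norm (\<Sum>a. \<phi> a *\<^sub>R x j a) powr p) \<le> W)"

lemma wkD:
  assumes "wk p W N x"
  shows "\<And>j. j < N \<Longrightarrow> summable (\<lambda>a. norm (x j a))"
    "\<And>\<phi>::nat \<Rightarrow> real. (\<And>a. \<bar>\<phi> a\<bar> \<le> 1) \<Longrightarrow> (\<Sum>j<N. norm (\<Sum>a. \<phi> a *\<^sub>R x j a) powr p) \<le> W"
  using assms by (auto simp: wk_def)

lemma summable_norm_mult_bounded:
  fixes x c :: "nat \<Rightarrow> 'k::{real_normed_field,banach}"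
  assumes "summable (\<lambda>a. norm (x a))" "\<And>a. norm (c a) \<le> B"
  shows "summable (\<lambda>a. norm (x a * c a))"
proof (rule summable_comparison_test')
  show "summable (\<lambda>a. norm (x a) * B)" using assms(1) by (rule summable_mult2)
  show "norm (norm (x a * c a)) \<le> norm (x a) * B" for a
    using assms(2)[of a] by (simp add: norm_mult mult_left_mono)
qed

lemma wk_finite:
  assumes w: "wk p W N x" and phi: "\<And>a. a < n \<Longrightarrow> \<bar>\<phi> a\<bar> \<le> 1"
  shows "(\<Sum>j<N. norm (\<Sum>a<n. \<phi> a *\<^sub>R x j a) powr p) \<le> W"
proof -
  define \<psi> where "\<psi> a = (if a < n then \<phi> a else 0)" for a
  have "(\<Sum>j<N. norm (\<Sum>a. \<psi> a *\<^sub>R x j a) powr p) \<le> W"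
    using phi by (intro wkD(2)[OF w]) (auto simp: \<psi>_def)
  moreover have "(\<Sum>a. \<psi> a *\<^sub>R x j a) = (\<Sum>a<n. \<phi> a *\<^sub>R x j a)" for j
    by (subst suminf_finite[of "{..<n}"]) (auto simp: \<psi>_def)
  ultimately show ?thesis by simp
qed

lemma (in scalar_parts) wk_part:
  assumes w: "wk p W N x" and p: "p \<ge> 0" and f: "bounded_linear f" and fle: "\<And>x. \<bar>f x\<bar> \<le> norm x"
  shows "wkf p W {..<N} {..<n} (\<lambda>j a. f (x j a))"
  unfolding wkf_def
proof (intro allI impI)
  fix \<phi> :: "nat \<Rightarrow> real" assume phi: "\<forall>a\<in>{..<n}. \<bar>\<phi> a\<bar> \<le> 1"
  interpret f: bounded_linear f by (rule f)
  have "(\<Sum>j<N. \<bar>\<Sum>a<n. f (x j a) * \<phi> a\<bar> powr p) \<le> (\<Sum>j<N. norm (\<Sum>a<n. \<phi> a *\<^sub>R x j a) powr p)"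
  proof (intro sum_mono powr_mono2)
    fix j
    have "(\<Sum>a<n. f (x j a) * \<phi> a) = f (\<Sum>a<n. \<phi> a *\<^sub>R x j a)"
      by (simp add: f.sum f.scaleR mult.commute)
    then show "\<bar>\<Sum>a<n. f (x j a) * \<phi> a\<bar> \<le> norm (\<Sum>a<n. \<phi> a *\<^sub>R x j a)" by (simp add: fle)
  qed (use p in auto)
  also have "\<dots> \<le> W" using phi by (intro wk_finite[OF w]) auto
  finally show "(\<Sum>j<N. \<bar>\<Sum>a<n. f (x j a) * \<phi> a\<bar> powr p) \<le> W" .
qed

lemma powr_add_le_two:
  fixes u v s :: real
  assumes "u \<ge> 0" "v \<ge> 0" "s \<ge> 0"
  shows "(u + v) powr s \<le> 2 powr s * (u powr s + v powr s)"
proof -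
  have "(u + v) powr s \<le> (2 * max u v) powr s" using assms by (intro powr_mono2) auto
  also have "\<dots> = 2 powr s * max u v powr s" using assms by (simp add: powr_mult)
  also have "\<dots> \<le> 2 powr s * (u powr s + v powr s)" by (intro mult_left_mono) (auto simp: max_def)
  finally show ?thesis .
qed

text \<open>Both factors are split into parts: those of \<open>f\<close> enlarge the Hilbert index
  by a boolean, those of \<open>x\<close> are treated separately and recombined by the triangle
  inequality. The infinite coordinate sums are limits of finite ones, for which
  \<open>step_hilbert\<close> has a uniform constant.\<close>

lemma (in scalar_parts) step_field:
  assumes rs: "admissible r s"
  shows "\<exists>C. \<forall>N (L::nat) (\<Lambda> :: 'l set) x f. finite \<Lambda> \<longrightarrow> wk s 1 N (x :: nat \<Rightarrow> nat \<Rightarrow> 'k) \<longrightarrow>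
     (\<forall>a. (\<Sum>l\<in>\<Lambda>. sqrt (\<Sum>i<L. (norm (f l i a))\<^sup>2) powr r) \<le> D) \<longrightarrow>
     (\<Sum>j<N. \<Sum>l\<in>\<Lambda>. sqrt (\<Sum>i<L. (norm (\<Sum>a. x j a * f l i a))\<^sup>2) powr s) \<le> C"
proof -
  have r: "r \<ge> 2" and s: "s \<ge> 2" using rs by (auto simp: admissible_def)
  define E where "E = max D 1"
  have E: "E > 0" "D \<le> E" by (auto simp: E_def)
  \<comment> \<open>\<open>E\<close> replaces \<open>D\<close>, which need not be positive. The
    power of \<open>E\<close> normalises the bound, and 1 / sqrt 2 pays for replacing the norm by
    both parts.\<close>
  define c where "c = E powr (- 1 / r) / sqrt 2"
  have c: "c > 0" using E by (simp add: c_def)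
  from step_hilbert[OF rs] obtain C0 where "C0 > 0 \<and> (\<forall>(J :: nat set) (A :: nat set) (\<Lambda> :: 'l set)
      (I :: (nat \<times> bool) set) x f.
    finite J \<longrightarrow> finite A \<longrightarrow> finite \<Lambda> \<longrightarrow> finite I \<longrightarrow> wkf s 1 J A x \<longrightarrow>
    (\<forall>a\<in>A. (\<Sum>l\<in>\<Lambda>. sqrt (\<Sum>i\<in>I. (f l i a)\<^sup>2) powr r) \<le> 1) \<longrightarrow>
    (\<Sum>j\<in>J. \<Sum>l\<in>\<Lambda>. sqrt (\<Sum>i\<in>I. (\<Sum>a\<in>A. x j a * f l i a)\<^sup>2) powr s) \<le> C0)" ..
  note C0 = this[THEN conjunct1] and step = this[THEN conjunct2, rule_format]
  have "(\<Sum>j<N. \<Sum>l\<in>\<Lambda>. sqrt (\<Sum>i<L. (norm (\<Sum>a. x j a * f l i a))\<^sup>2) powr s) \<le> 2 powr s * (2 * ((2 /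
      c) powr s * C0))"
    if fin: "finite \<Lambda>" and w: "wk s 1 N x"
      and f: "\<forall>a. (\<Sum>l\<in>\<Lambda>. sqrt (\<Sum>i<L. (norm (f l i a))\<^sup>2) powr r) \<le> D"
    for N L :: nat and \<Lambda> :: "'l set" and x :: "nat \<Rightarrow> nat \<Rightarrow> 'k" and f
  proof -
    let ?I = "{..<L} \<times> (UNIV :: bool set)"
    define g where "g l k a = c * (if snd k then re (f l (fst k) a) else im (f l (fst k) a))" for
        l k a
    have sumI: "(\<Sum>k\<in>?I. H k) = (\<Sum>i<L. H (i, True) + H (i, False))" for H :: "nat \<times> bool \<Rightarrow> real"
    proof -
      have "(\<Sum>k\<in>?I. H k) = (\<Sum>i<L. \<Sum>b\<in>UNIV. H (i, b))"
        by (subst sum.cartesian_product) (simp add: case_prod_unfold)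
      then show ?thesis by (simp add: UNIV_bool add.commute)
    qed
    have g: "(\<Sum>l\<in>\<Lambda>. sqrt (\<Sum>k\<in>?I. (g l k a)\<^sup>2) powr r) \<le> 1" for a
    proof -
      have "(\<Sum>l\<in>\<Lambda>. sqrt (\<Sum>k\<in>?I. (g l k a)\<^sup>2) powr r)
          \<le> (\<Sum>l\<in>\<Lambda>. (E powr (- 1 / r) * sqrt (\<Sum>i<L. (norm (f l i a))\<^sup>2)) powr r)"
      proof (intro sum_mono powr_mono2)
        fix l
        have "(\<Sum>k\<in>?I. (g l k a)\<^sup>2) = (\<Sum>i<L. c\<^sup>2 * ((re (f l i a))\<^sup>2 + (im (f l i a))\<^sup>2))"
          unfolding sumI by (simp add: g_def power_mult_distrib distrib_left)
        also have "\<dots> \<le> (\<Sum>i<L. c\<^sup>2 * (2 * (norm (f l i a))\<^sup>2))"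
          by (intro sum_mono mult_left_mono parts_sq_le) simp
        also have "\<dots> = (c * sqrt 2)\<^sup>2 * (\<Sum>i<L. (norm (f l i a))\<^sup>2)"
          by (simp add: sum_distrib_left power_mult_distrib mult.assoc)
        finally have "sqrt (\<Sum>k\<in>?I. (g l k a)\<^sup>2) \<le> sqrt ((c * sqrt 2)\<^sup>2 * (\<Sum>i<L. (norm (f l i
            a))\<^sup>2))"
          by (rule real_sqrt_le_mono)
        also have "\<dots> = (c * sqrt 2) * sqrt (\<Sum>i<L. (norm (f l i a))\<^sup>2)"
          unfolding real_sqrt_mult[of "(c * sqrt 2)\<^sup>2"] using c by (simp del: real_sqrt_mult)
        finally have "sqrt (\<Sum>k\<in>?I. (g l k a)\<^sup>2) \<le> (c * sqrt 2) * sqrt (\<Sum>i<L. (norm (f l i a))\<^sup>2)" .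
        then show "sqrt (\<Sum>k\<in>?I. (g l k a)\<^sup>2) \<le> E powr (- 1 / r) * sqrt (\<Sum>i<L. (norm (f l i a))\<^sup>2)"
          by (simp add: c_def)
      qed (use r in \<open>auto intro: sum_nonneg\<close>)
      also have "\<dots> = (E powr (- 1 / r)) powr r * (\<Sum>l\<in>\<Lambda>. sqrt (\<Sum>i<L. (norm (f l i a))\<^sup>2) powr r)"
        by (simp add: powr_mult sum_distrib_left)
      also have "(E powr (- 1 / r)) powr r = 1 / E"
        using r E by (simp only: powr_powr) (simp add: powr_minus_divide)
      also have "1 / E * (\<Sum>l\<in>\<Lambda>. sqrt (\<Sum>i<L. (norm (f l i a))\<^sup>2) powr r) \<le> 1 / E * E"
        using f E by (intro mult_left_mono order.trans[OF f[rule_format] E(2)]) auto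
      finally show ?thesis using E by simp
    qed
    have fb: "norm (f l i a) \<le> E powr (1 / r)" if "l \<in> \<Lambda>" "i < L" for l i a
    proof -
      have "(norm (f l i a))\<^sup>2 \<le> (\<Sum>i<L. (norm (f l i a))\<^sup>2)"
        using that by (intro member_le_sum) auto
      then have "norm (f l i a) \<le> sqrt (\<Sum>i<L. (norm (f l i a))\<^sup>2)" by (rule real_le_rsqrt)
      then have "norm (f l i a) powr r \<le> sqrt (\<Sum>i<L. (norm (f l i a))\<^sup>2) powr r"
        using r by (intro powr_mono2) auto
      also have "\<dots> \<le> (\<Sum>l\<in>\<Lambda>. sqrt (\<Sum>i<L. (norm (f l i a))\<^sup>2) powr r)"
        using that fin by (intro member_le_sum) auto
      also have "\<dots> \<le> E" using f E by (meson order.trans)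
      finally have "(norm (f l i a) powr r) powr (1 / r) \<le> E powr (1 / r)"
        using r by (intro powr_mono2) auto
      then show ?thesis using r by (simp add: powr_powr)
    qed
    have part: "(\<Sum>j<N. \<Sum>l\<in>\<Lambda>. sqrt (\<Sum>i<L. (norm (\<Sum>a. of_real (y (x j a)) * f l i a))\<^sup>2) powr s) \<le>
        (2 / c) powr s * C0"
      (is "?lhs \<le> _")
      and part_sum: "\<And>j l i. j < N \<Longrightarrow> l \<in> \<Lambda> \<Longrightarrow> i < L \<Longrightarrow> summable (\<lambda>a. of_real (y (x j a)) * f l i a)"
      if y: "bounded_linear y" and yle: "\<And>x. \<bar>y x\<bar> \<le> norm x" for y
    proof -
      have sm: "summable (\<lambda>a. of_real (y (x j a)) * f l i a)" if "j < N" "l \<in> \<Lambda>" "i < L" for j l i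
      proof -
        have "summable (\<lambda>a. norm (of_real (y (x j a)) :: 'k))"
          using wkD(1)[OF w that(1)] by (rule summable_comparison_test'[where N = 0]) (simp add:
              yle)
        from summable_norm_mult_bounded[OF this fb[OF that(2,3)]] show ?thesis by (rule
            summable_norm_cancel)
      qed
      then show "\<And>j l i. j < N \<Longrightarrow> l \<in> \<Lambda> \<Longrightarrow> i < L \<Longrightarrow> summable (\<lambda>a. of_real (y (x j a)) * f l i a)" .
      define U where "U j l i = (\<Sum>a. of_real (y (x j a)) * f l i a)" for j l i
      define Y where "Y j l k = c * (if snd k then re (U j l (fst k)) else im (U j l (fst k)))"
          for j l k
      have lim: "(\<lambda>n. \<Sum>a<n. y (x j a) * g l k a) \<longlonglongrightarrow> Y j l k" if "j < N" "l \<in> \<Lambda>" "k \<in> ?I" for j l k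
      proof -
        have U: "(\<lambda>a. of_real (y (x j a)) * f l (fst k) a) sums U j l (fst k)"
          unfolding U_def using sm[OF that(1,2)] that(3) by (intro summable_sums) auto
        have h: "(\<lambda>a. c * h (of_real (y (x j a)) * f l (fst k) a)) sums (c * h (U j l (fst k)))"
          if "bounded_linear h" for h :: "'k \<Rightarrow> real"
          by (intro sums_mult bounded_linear.sums[OF that U])
        have hm: "h (of_real t * z) = t * h z" if "bounded_linear h" for h :: "'k \<Rightarrow> real" and t z
          using bounded_linear.linear[OF that] by (simp add: linear_cmul
              scaleR_conv_of_real[symmetric])
        have "(\<lambda>a. y (x j a) * g l k a) sums Y j l k"
          using h[OF re] h[OF im] by (cases "snd k") (simp_all add: g_def Y_def hm[OF re] hm[OF
              im] mult.left_commute)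
        then show ?thesis by (simp add: sums_def)
      qed
      \<comment> \<open>Only finitely many entries occur, so entrywise convergence carries the bound
        to the limit.\<close>
      have "(\<lambda>n. \<Sum>j<N. \<Sum>l\<in>\<Lambda>. sqrt (\<Sum>k\<in>?I. (\<Sum>a<n. y (x j a) * g l k a)\<^sup>2) powr s)
          \<longlonglongrightarrow> (\<Sum>j<N. \<Sum>l\<in>\<Lambda>. sqrt (\<Sum>k\<in>?I. (Y j l k)\<^sup>2) powr s)"
      proof (intro tendsto_sum tendsto_powr' tendsto_real_sqrt tendsto_power lim tendsto_const
          disjI2 conjI)
      qed (use s in \<open>auto intro!: always_eventually sum_nonneg\<close>)
      moreover have "\<forall>n. (\<Sum>j<N. \<Sum>l\<in>\<Lambda>. sqrt (\<Sum>k\<in>?I. (\<Sum>a<n. y (x j a) * g l k a)\<^sup>2) powr s) \<le> C0"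
        using s by (intro allI step fin wk_part[OF w _ y yle] g) auto
      ultimately have YC: "(\<Sum>j<N. \<Sum>l\<in>\<Lambda>. sqrt (\<Sum>k\<in>?I. (Y j l k)\<^sup>2) powr s) \<le> C0"
        by (intro LIMSEQ_le_const2) auto
      have "?lhs = (\<Sum>j<N. \<Sum>l\<in>\<Lambda>. sqrt (\<Sum>i<L. (norm (U j l i))\<^sup>2) powr s)" by (simp add: U_def)
      also have "\<dots> \<le> (\<Sum>j<N. \<Sum>l\<in>\<Lambda>. (2 / c * sqrt (\<Sum>k\<in>?I. (Y j l k)\<^sup>2)) powr s)"
      proof (intro sum_mono powr_mono2)
        fix j l
        have "(\<Sum>i<L. (norm (U j l i))\<^sup>2) \<le> (\<Sum>i<L. (2 / c)\<^sup>2 * ((Y j l (i, True))\<^sup>2 + (Y j l (i,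
            False))\<^sup>2))"
        proof (rule sum_mono)
          fix i
          have eq: "(2 / c)\<^sup>2 * ((Y j l (i, True))\<^sup>2 + (Y j l (i, False))\<^sup>2) = 4 * ((re (U j l
              i))\<^sup>2 + (im (U j l i))\<^sup>2)"
            using c by (simp add: Y_def power_mult_distrib power_divide distrib_left)
          then show "(norm (U j l i))\<^sup>2 \<le> (2 / c)\<^sup>2 * ((Y j l (i, True))\<^sup>2 + (Y j l (i, False))\<^sup>2)"
            unfolding eq by (intro order.trans[OF norm_sq_le_parts] mult_right_mono) simp_all
        qed
        also have "\<dots> = (2 / c)\<^sup>2 * (\<Sum>k\<in>?I. (Y j l k)\<^sup>2)" unfolding sumI by (simp only:
            sum_distrib_left)
        finally have "sqrt (\<Sum>i<L. (norm (U j l i))\<^sup>2) \<le> sqrt ((2 / c)\<^sup>2 * (\<Sum>k\<in>?I. (Y j l k)\<^sup>2))"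
          by (rule real_sqrt_le_mono)
        then show "sqrt (\<Sum>i<L. (norm (U j l i))\<^sup>2) \<le> 2 / c * sqrt (\<Sum>k\<in>?I. (Y j l k)\<^sup>2)"
          using c by (simp add: real_sqrt_mult)
      qed (use s in \<open>auto intro: sum_nonneg\<close>)
      also have "\<dots> = (2 / c) powr s * (\<Sum>j<N. \<Sum>l\<in>\<Lambda>. sqrt (\<Sum>k\<in>?I. (Y j l k)\<^sup>2) powr s)"
        by (simp only: powr_mult sum_distrib_left)
      also have "\<dots> \<le> (2 / c) powr s * C0" by (intro mult_left_mono YC) simp
      finally show "?lhs \<le> (2 / c) powr s * C0" .
    qed
    define u where "u y j l = sqrt (\<Sum>i<L. (norm (\<Sum>a. of_real (y (x j a)) * f l i a))\<^sup>2)" for y j l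
    have u0: "u y j l \<ge> 0" for y j l by (simp add: u_def sum_nonneg)
    have "(\<Sum>j<N. \<Sum>l\<in>\<Lambda>. sqrt (\<Sum>i<L. (norm (\<Sum>a. x j a * f l i a))\<^sup>2) powr s)
        \<le> (\<Sum>j<N. \<Sum>l\<in>\<Lambda>. 2 powr s * (u re j l powr s + u im j l powr s))"
    proof (intro sum_mono)
      fix j l assume jl: "j \<in> {..<N}" "l \<in> \<Lambda>"
      have "sqrt (\<Sum>i<L. (norm (\<Sum>a. x j a * f l i a))\<^sup>2) = L2_set (\<lambda>i. norm (\<Sum>a. x j a * f l i a))
          {..<L}"
        by (simp add: L2_set_def)
      also have "\<dots> \<le> L2_set (\<lambda>i. norm (\<Sum>a. of_real (re (x j a)) * f l i a) + norm (\<Sum>a. of_real (im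
          (x j a)) * f l i a)) {..<L}"
      proof (rule L2_set_mono)
        fix i assume i: "i \<in> {..<L}"
        have s1: "summable (\<lambda>a. of_real (re (x j a)) * f l i a)" using part_sum[OF re re_le] jl i
            by auto
        have s2: "summable (\<lambda>a. of_real (im (x j a)) * f l i a)" using part_sum[OF im im_le] jl i
            by auto
        have "(\<Sum>a. x j a * f l i a) = (\<Sum>a. of_real (re (x j a)) * f l i a + \<iota> * (of_real (im (x j
            a)) * f l i a))"
          by (rule suminf_cong) (subst parts, simp add: distrib_right mult.assoc)
        also have "\<dots> = (\<Sum>a. of_real (re (x j a)) * f l i a) + \<iota> * (\<Sum>a. of_real (im (x j a)) * f l
            i a)"
          using s1 s2 by (simp add: suminf_add[symmetric] suminf_mult summable_mult)
        finally have "norm (\<Sum>a. x j a * f l i a) \<le> norm (\<Sum>a. of_real (re (x j a)) * f l i a) +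
            norm \<iota> * norm (\<Sum>a. of_real (im (x j a)) * f l i a)"
          by (simp only: norm_mult[symmetric] norm_triangle_ineq)
        also have "norm \<iota> * norm (\<Sum>a. of_real (im (x j a)) * f l i a) \<le> 1 * norm (\<Sum>a. of_real (im
            (x j a)) * f l i a)"
          by (intro mult_right_mono \<iota>) simp
        finally show "norm (\<Sum>a. x j a * f l i a) \<le> norm (\<Sum>a. of_real (re (x j a)) * f l i a) +
            norm (\<Sum>a. of_real (im (x j a)) * f l i a)"
          by simp
      qed simp
      also have "\<dots> \<le> u re j l + u im j l" unfolding u_def L2_set_def[symmetric] by (rule
          L2_set_triangle_ineq)
      finally have "sqrt (\<Sum>i<L. (norm (\<Sum>a. x j a * f l i a))\<^sup>2) powr s \<le> (u re j l + u im j l)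
          powr s"
        using s by (intro powr_mono2) (auto intro: sum_nonneg)
      also have "\<dots> \<le> 2 powr s * (u re j l powr s + u im j l powr s)"
        using s u0 by (intro powr_add_le_two) auto
      finally show "sqrt (\<Sum>i<L. (norm (\<Sum>a. x j a * f l i a))\<^sup>2) powr s \<le> 2 powr s * (u re j l powr
          s + u im j l powr s)" .
    qed
    also have "\<dots> = 2 powr s * ((\<Sum>j<N. \<Sum>l\<in>\<Lambda>. u re j l powr s) + (\<Sum>j<N. \<Sum>l\<in>\<Lambda>. u im j l powr s))"
      by (simp only: sum_distrib_left sum.distrib distrib_left)
    also have "\<dots> \<le> 2 powr s * ((2 / c) powr s * C0 + (2 / c) powr s * C0)"
      unfolding u_def by (intro mult_left_mono add_mono part re im re_le im_le) simp
    finally show ?thesis by (simp only: mult_2[of "(2 / c) powr s * C0"])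
  qed
  then show ?thesis by (intro exI allI impI)
qed

text \<open>Only the first \<open>n\<close> coordinates enter the finite factorization; the tails
  are made so small that even the largest possible weight cannot amplify them. Real and imaginary
  parts are factorized jointly, and the sum \<open>K\<close> of their numbers \<open>H\<close>
  serves both.\<close>

lemma (in scalar_parts) factor_field:
  assumes p: "1 \<le> p" "p < 2"
  shows "\<exists>C>0. \<forall>N (x :: nat \<Rightarrow> nat \<Rightarrow> 'k). wk p 1 N x \<longrightarrow>
    (\<exists>\<sigma>. (\<forall>j<N. \<sigma> j > 0) \<and> (\<Sum>j<N. \<sigma> j powr (2 * p / (2 - p))) \<le> C \<and>
      wk 2 C N (\<lambda>j a. (1 / \<sigma> j) *\<^sub>R x j a))"
proof -
  define S where "S = 192 powr p + 2"
  have S: "S > 0" by (simp add: S_def add_pos_pos)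
  have "\<exists>\<sigma>. (\<forall>j<N. \<sigma> j > 0) \<and> (\<Sum>j<N. \<sigma> j powr (2 * p / (2 - p))) \<le> 32 * S + 2 \<and>
      wk 2 (32 * S + 2) N (\<lambda>j a. (1 / \<sigma> j) *\<^sub>R x j a)" if w: "wk p 1 N x" for N and x :: "nat \<Rightarrow>
          nat \<Rightarrow> 'k"
  proof -
    \<comment> \<open>With this \<delta> the error term of \<open>factor_finite\<close> over 2N
      indices is 2N/(N+1) \<le> 2, whence the summand 2 in \<open>S\<close>.\<close>
    define \<delta> where "\<delta> = real (N + 1) powr (- 2 / p)"
    have d: "\<delta> > 0" by (simp add: \<delta>_def)
    have dp: "\<delta> powr (p / 2) = 1 / real (N + 1)"
      unfolding \<delta>_def using p by (simp only: powr_powr) (simp add: powr_minus_divide)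
    \<comment> \<open>Since p/2 - 1 < 0 and the numbers \<open>H\<close> are at least \<delta>, no
      weight exceeds \<open>w0\<close>; the choice of \<eta> makes N * w0 * \<eta>^2 less than
      1.\<close>
    define w0 where "w0 = \<delta> powr (p / 2 - 1)"
    have w0: "w0 > 0" using d by (simp add: w0_def)
    define \<eta> where "\<eta> = sqrt (1 / (real (N + 1) * w0))"
    have eta: "\<eta> > 0" using w0 by (simp add: \<eta>_def)
    have eta2: "\<eta>\<^sup>2 = 1 / (real (N + 1) * w0)" using w0 by (simp add: \<eta>_def)
    have "\<forall>j\<in>{..<N}. \<exists>n. \<forall>k\<ge>n. norm (\<Sum>i. norm (x j (i + k))) < \<eta>"
      using suminf_exist_split[OF eta wkD(1)[OF w]] by simp
    from bchoice[OF this] obtain nn where nn: "\<forall>j\<in>{..<N}. \<forall>k\<ge>nn j. norm (\<Sum>i. norm (x j (i + k))) <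
        \<eta>" ..
    define n where "n = (\<Sum>j<N. nn j)"
    have n: "nn j \<le> n" if "j < N" for j unfolding n_def using that by (intro member_le_sum) auto
    have tail: "(\<Sum>i. norm (x j (i + n))) \<le> \<eta>" if "j < N" for j
      using nn n[OF that] that by fastforce
    \<comment> \<open>Halving compensates for listing both parts: 2 * (1/2)^p \<le> 1.\<close>
    define y where "y = (\<lambda>(j, b) a. (if b then re (x j a) else im (x j a)) / 2)"
    let ?J = "{..<N} \<times> (UNIV :: bool set)"
    have sumJ: "(\<Sum>k\<in>?J. h k) = (\<Sum>j<N. h (j, True)) + (\<Sum>j<N. h (j, False))" for h :: "nat \<times> bool \<Rightarrow>
        real"
    proof -
      have "(\<Sum>k\<in>?J. h k) = (\<Sum>j<N. \<Sum>b\<in>UNIV. h (j, b))"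
        by (subst sum.cartesian_product) (simp add: case_prod_unfold)
      then show ?thesis by (simp add: UNIV_bool add.commute sum.distrib)
    qed
    have "wkf p 1 ?J {..<n} y"
      unfolding wkf_def
    proof (intro allI impI)
      fix \<phi> :: "nat \<Rightarrow> real" assume phi: "\<forall>a\<in>{..<n}. \<bar>\<phi> a\<bar> \<le> 1"
      have b: "(\<Sum>j<N. \<bar>\<Sum>a<n. f (x j a) / 2 * \<phi> a\<bar> powr p) \<le> 1 / 2"
        if f: "bounded_linear f" "\<And>x. \<bar>f x\<bar> \<le> norm x" for f
      proof -
        have "(\<Sum>j<N. \<bar>\<Sum>a<n. f (x j a) / 2 * \<phi> a\<bar> powr p) = (\<Sum>j<N. (1 / 2) powr p * \<bar>\<Sum>a<n. f (x j
            a) * \<phi> a\<bar> powr p)"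
          by (intro sum.cong refl) (simp add: abs_mult powr_mult[symmetric] powr_divide
              sum_divide_distrib[symmetric])
        also have "\<dots> = (1 / 2) powr p * (\<Sum>j<N. \<bar>\<Sum>a<n. f (x j a) * \<phi> a\<bar> powr p)"
          by (simp only: sum_distrib_left)
        also have "\<dots> \<le> (1 / 2) powr p * 1"
          using phi p by (intro mult_left_mono wkfD[OF wk_part[OF w _ f]]) auto
        also have "(1 / 2) powr p \<le> (1 / 2 :: real) powr 1" using p by (intro powr_mono') auto
        finally show ?thesis by simp
      qed
      show "(\<Sum>k\<in>?J. \<bar>\<Sum>a<n. y k a * \<phi> a\<bar> powr p) \<le> 1"
        unfolding sumJ using b[OF re re_le] b[OF im im_le] by (simp add: y_def)
    qed
    from factor_finite[OF p d _ _ this] obtain H where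
      H: "(\<forall>j\<in>?J. \<delta> \<le> H j) \<and> (\<Sum>j\<in>?J. H j powr (p / 2)) \<le> 192 powr p + card ?J * \<delta> powr (p / 2) \<and>
      (\<forall>\<phi>. (\<forall>a\<in>{..<n}. \<bar>\<phi> a\<bar> \<le> 1) \<longrightarrow>
        (\<Sum>j\<in>?J. H j powr (p / 2 - 1) * (\<Sum>a<n. y j a * \<phi> a)\<^sup>2) \<le> (\<Sum>j\<in>?J. H j powr (p / 2)))" by auto
    have Hd: "H (j, b) \<ge> \<delta>" if "j < N" for j b using H that by auto
    have HS: "(\<Sum>j\<in>?J. H j powr (p / 2)) \<le> S"
    proof -
      have "(\<Sum>j\<in>?J. H j powr (p / 2)) \<le> 192 powr p + card ?J * \<delta> powr (p / 2)" using H by blast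
      also have "card ?J * \<delta> powr (p / 2) \<le> 2" unfolding dp by (simp add: card_cartesian_product
          field_simps)
      finally show ?thesis by (simp add: S_def)
    qed
    have Hphi: "(\<Sum>k\<in>?J. H k powr (p / 2 - 1) * (\<Sum>a<n. y k a * \<phi> a)\<^sup>2) \<le> S" if "\<And>a. \<bar>\<phi> a\<bar> \<le> 1" for \<phi>
      using H that HS by (meson order.trans)
    define K where "K j = H (j, True) + H (j, False)" for j
    have K: "K j > 0" "K j \<ge> H (j, b)" "K j \<ge> \<delta>" if "j < N" for j b
      using Hd[OF that, of True] Hd[OF that, of False] d by (cases b; auto simp: K_def)+
    \<comment> \<open>The exponent (2 - p)/4 makes 1/\<sigma>^2 equal to the weight K powr (p/2 -
      1); then \<sigma> powr (2p/(2 - p)) is K powr (p/2), whose sum is bounded.\<close>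
    define \<sigma> where "\<sigma> j = K j powr (1 / 2 - p / 4)" for j
    have sig: "\<sigma> j > 0" if "j < N" for j using K(1)[OF that] by (simp add: \<sigma>_def)
    have sig2: "(1 / \<sigma> j)\<^sup>2 = K j powr (p / 2 - 1)" if "j < N" for j
    proof -
      have "(1 / \<sigma> j)\<^sup>2 = (K j powr (- (1 / 2 - p / 4)))\<^sup>2" by (simp only: \<sigma>_def powr_minus_divide)
      also have "\<dots> = K j powr (- (1 / 2 - p / 4) + - (1 / 2 - p / 4))"
        by (simp only: power2_eq_square powr_add)
      also have "- (1 / 2 - p / 4) + - (1 / 2 - p / 4) = p / 2 - 1" by simp
      finally show ?thesis .
    qed
    have "(\<Sum>j<N. \<sigma> j powr (2 * p / (2 - p))) = (\<Sum>j<N. K j powr (p / 2))"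
    proof (intro sum.cong refl)
      fix j
      have "(1 / 2 - p / 4) * (2 * p / (2 - p)) = p / 2" using p by (simp add: field_simps)
      then show "\<sigma> j powr (2 * p / (2 - p)) = K j powr (p / 2)" by (simp only: \<sigma>_def powr_powr)
    qed
    also have "\<dots> \<le> (\<Sum>j<N. H (j, True) powr (p / 2) + H (j, False) powr (p / 2))"
      unfolding K_def using p d Hd by (intro sum_mono powr_add_le) (auto intro: order.trans[OF
          less_imp_le])
    also have "\<dots> \<le> S" using HS by (simp add: sumJ sum.distrib)
    also have "\<dots> \<le> 32 * S + 2" using S by simp
    finally have c1: "(\<Sum>j<N. \<sigma> j powr (2 * p / (2 - p))) \<le> 32 * S + 2" .
    have c2: "wk 2 (32 * S + 2) N (\<lambda>j a. (1 / \<sigma> j) *\<^sub>R x j a)"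
      unfolding wk_def
    proof (intro conjI allI impI)
      fix j assume "j < N"
      then show "summable (\<lambda>a. norm ((1 / \<sigma> j) *\<^sub>R x j a))"
        using wkD(1)[OF w, of j] by (simp add: summable_mult)
    next
      fix \<phi> :: "nat \<Rightarrow> real" assume phi: "\<forall>a. \<bar>\<phi> a\<bar> \<le> 1"
      have "norm (\<Sum>a. \<phi> a *\<^sub>R ((1 / \<sigma> j) *\<^sub>R x j a)) powr 2
         \<le> 16 * (H (j, True) powr (p / 2 - 1) * (\<Sum>a<n. y (j, True) a * \<phi> a)\<^sup>2 + H (j, False) powr
             (p / 2 - 1) * (\<Sum>a<n. y (j, False) a * \<phi> a)\<^sup>2)
           + 2 * (w0 * \<eta>\<^sup>2)" if j: "j < N" for j
      proof -
        have sx: "summable (\<lambda>a. norm (\<phi> a *\<^sub>R x j a))"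
          using wkD(1)[OF w j] by (rule summable_comparison_test'[where N = 0]) (use phi in \<open>simp
              add: mult_left_le_one_le\<close>)
        have sx': "summable (\<lambda>a. \<phi> a *\<^sub>R x j a)" by (rule summable_norm_cancel[OF sx])
        define A where "A = (\<Sum>a<n. \<phi> a *\<^sub>R x j a)"
        define B where "B = (\<Sum>a. \<phi> (a + n) *\<^sub>R x j (a + n))"
        have e: "(\<Sum>a. \<phi> a *\<^sub>R ((1 / \<sigma> j) *\<^sub>R x j a)) = (1 / \<sigma> j) *\<^sub>R (A + B)"
        proof -
          have "(\<Sum>a. \<phi> a *\<^sub>R ((1 / \<sigma> j) *\<^sub>R x j a)) = (\<Sum>a. (1 / \<sigma> j) *\<^sub>R (\<phi> a *\<^sub>R x j a))" by
              (simp add: mult.commute)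
          also have "\<dots> = (1 / \<sigma> j) *\<^sub>R (\<Sum>a. \<phi> a *\<^sub>R x j a)" by (rule suminf_scaleR_right[OF sx',
              symmetric])
          also have "(\<Sum>a. \<phi> a *\<^sub>R x j a) = A + B"
            unfolding A_def B_def using suminf_split_initial_segment[OF sx', of n] by simp
          finally show ?thesis .
        qed
        have nB: "norm B \<le> \<eta>"
        proof -
          have "norm B \<le> (\<Sum>a. norm (\<phi> (a + n) *\<^sub>R x j (a + n)))"
            unfolding B_def using summable_ignore_initial_segment[OF sx, of n] by (rule
                summable_norm)
          also have "\<dots> \<le> (\<Sum>a. norm (x j (a + n)))"
            using phi summable_ignore_initial_segment[OF sx, of n]
                summable_ignore_initial_segment[OF wkD(1)[OF w j], of n]
            by (intro suminf_le) (auto simp: mult_left_le_one_le)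
          finally show ?thesis using tail[OF j] by simp
        qed
        have A: "re A = 2 * (\<Sum>a<n. y (j, True) a * \<phi> a)" "im A = 2 * (\<Sum>a<n. y (j, False) a * \<phi> a)"
          unfolding A_def y_def sum_distrib_left
          by (simp_all add: linear_sum[OF bounded_linear.linear[OF re]] linear_sum[OF
              bounded_linear.linear[OF im]]
              linear_cmul[OF bounded_linear.linear[OF re]] linear_cmul[OF bounded_linear.linear[OF
                  im]] mult.commute)
        have "norm ((1 / \<sigma> j) *\<^sub>R (A + B)) powr 2 = (norm ((1 / \<sigma> j) *\<^sub>R (A + B)))\<^sup>2" by simp
        also have "\<dots> = (1 / \<sigma> j)\<^sup>2 * (norm (A + B))\<^sup>2" by (simp add: power_mult_distrib
            power_divide)
        also have "\<dots> = K j powr (p / 2 - 1) * (norm (A + B))\<^sup>2" by (simp only: sig2[OF j])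
        also have "\<dots> \<le> K j powr (p / 2 - 1) * (2 * (norm A)\<^sup>2 + 2 * (norm B)\<^sup>2)"
        proof (rule mult_left_mono)
          have "(norm (A + B))\<^sup>2 \<le> (norm A + norm B)\<^sup>2" by (intro power_mono norm_triangle_ineq)
              simp
          also have "\<dots> \<le> 2 * (norm A)\<^sup>2 + 2 * (norm B)\<^sup>2"
            using sum_squares_bound[of "norm A" "norm B"] by (simp add: power2_sum)
          finally show "(norm (A + B))\<^sup>2 \<le> 2 * (norm A)\<^sup>2 + 2 * (norm B)\<^sup>2" .
        qed simp
        also have "\<dots> \<le> K j powr (p / 2 - 1) * (4 * (re A)\<^sup>2 + 4 * (im A)\<^sup>2 + 2 * \<eta>\<^sup>2)"
        proof (rule mult_left_mono)
          have "(norm B)\<^sup>2 \<le> \<eta>\<^sup>2" using nB by (intro power_mono) auto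
          then show "2 * (norm A)\<^sup>2 + 2 * (norm B)\<^sup>2 \<le> 4 * (re A)\<^sup>2 + 4 * (im A)\<^sup>2 + 2 * \<eta>\<^sup>2"
            using norm_sq_le_parts[of A] by simp
        qed simp
        also have "\<dots> = 16 * (K j powr (p / 2 - 1) * (\<Sum>a<n. y (j, True) a * \<phi> a)\<^sup>2 + K j powr (p /
            2 - 1) * (\<Sum>a<n. y (j, False) a * \<phi> a)\<^sup>2)
           + 2 * (K j powr (p / 2 - 1) * \<eta>\<^sup>2)"
          by (simp add: A power_mult_distrib algebra_simps)
        also have "\<dots> \<le> 16 * (H (j, True) powr (p / 2 - 1) * (\<Sum>a<n. y (j, True) a * \<phi> a)\<^sup>2 + H (j,
            False) powr (p / 2 - 1) * (\<Sum>a<n. y (j, False) a * \<phi> a)\<^sup>2)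
           + 2 * (w0 * \<eta>\<^sup>2)"
        proof -
          have kh: "K j powr (p / 2 - 1) \<le> H (j, b) powr (p / 2 - 1)" for b
            using K(2)[OF j, of b] Hd[OF j, of b] d p by (intro powr_mono2') auto
          have kw: "K j powr (p / 2 - 1) \<le> w0"
            unfolding w0_def using K(3)[OF j] d p by (intro powr_mono2') auto
          show ?thesis by (intro add_mono mult_left_mono mult_right_mono kh kw) auto
        qed
        finally show ?thesis unfolding e .
      qed
      then have "(\<Sum>j<N. norm (\<Sum>a. \<phi> a *\<^sub>R ((1 / \<sigma> j) *\<^sub>R x j a)) powr 2)
         \<le> (\<Sum>j<N. 16 * (H (j, True) powr (p / 2 - 1) * (\<Sum>a<n. y (j, True) a * \<phi> a)\<^sup>2 + H (j,
             False) powr (p / 2 - 1) * (\<Sum>a<n. y (j, False) a * \<phi> a)\<^sup>2)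
           + 2 * (w0 * \<eta>\<^sup>2))"
        by (intro sum_mono) auto
      also have "\<dots> = 16 * (\<Sum>k\<in>?J. H k powr (p / 2 - 1) * (\<Sum>a<n. y k a * \<phi> a)\<^sup>2) + 2 * (real N *
          (w0 * \<eta>\<^sup>2))"
        unfolding sumJ by (simp add: sum.distrib sum_distrib_left distrib_left)
      also have "\<dots> \<le> 16 * S + 2 * 1"
      proof (intro add_mono mult_left_mono)
        show "(\<Sum>k\<in>?J. H k powr (p / 2 - 1) * (\<Sum>a<n. y k a * \<phi> a)\<^sup>2) \<le> S" using phi by (intro Hphi)
            simp
        have "real N * (w0 * \<eta>\<^sup>2) = real N / real (N + 1)" unfolding eta2 using w0 by simp
        then show "real N * (w0 * \<eta>\<^sup>2) \<le> 1" by simp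
      qed auto
      also have "\<dots> \<le> 32 * S + 2" using S by simp
      finally show "(\<Sum>j<N. norm (\<Sum>a. \<phi> a *\<^sub>R ((1 / \<sigma> j) *\<^sub>R x j a)) powr 2) \<le> 32 * S + 2" .
    qed
    show ?thesis using sig c1 c2 by blast
  qed
  moreover have "32 * S + 2 > 0" using S by simp
  ultimately show ?thesis by blast
qed

subsection \<open>Multilinear operators\<close>

lemma ell_one_iff: "x \<in> ell 1 \<longleftrightarrow> summable (\<lambda>i. norm (x i))"
  by (simp add: ell_def)

lemma ell_norm_one: "x \<in> ell 1 \<Longrightarrow> ell_norm 1 x = (\<Sum>i. norm (x i))"
  by (simp add: ell_norm_def ell_one_iff suminf_nonneg)

lemma ell_norm_nonneg: "ell_norm r x \<ge> 0"
  by (simp add: ell_norm_def)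

lemma ell_two_iff: "x \<in> ell 2 \<longleftrightarrow> summable (\<lambda>i. (norm (x i))\<^sup>2)"
  by (simp add: ell_def)

lemma ell_norm_two: "x \<in> ell 2 \<Longrightarrow> ell_norm 2 x = sqrt (\<Sum>i. (norm (x i))\<^sup>2)"
  by (simp add: ell_norm_def ell_two_iff powr_half_sqrt suminf_nonneg)

abbreviation norm_upto :: "nat \<Rightarrow> (nat \<Rightarrow> 'k::real_normed_field) \<Rightarrow> real" where
  "norm_upto L v \<equiv> sqrt (\<Sum>i<L. (norm (v i))\<^sup>2)"

lemma ell_norm_two_partial:
  assumes "x \<in> ell 2"
  shows "norm_upto L x \<le> ell_norm 2 x"
    "(\<lambda>L. norm_upto L x) \<longlonglongrightarrow> ell_norm 2 x"
proof -
  have s: "summable (\<lambda>i. (norm (x i))\<^sup>2)" using assms by (simp add: ell_two_iff)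
  show "norm_upto L x \<le> ell_norm 2 x"
    unfolding ell_norm_two[OF assms] using s by (intro real_sqrt_le_mono sum_le_suminf) auto
  show "(\<lambda>L. norm_upto L x) \<longlonglongrightarrow> ell_norm 2 x"
    unfolding ell_norm_two[OF assms] by (intro tendsto_real_sqrt summable_LIMSEQ s)
qed

definition unit_seq :: "nat \<Rightarrow> nat \<Rightarrow> 'k::real_normed_field" where
  "unit_seq a = (\<lambda>i. if i = a then 1 else 0)"

lemma unit_seq_ell: "(unit_seq a :: nat \<Rightarrow> 'k::real_normed_field) \<in> ell 1"
  unfolding ell_one_iff by (rule summable_finite[of "{a}"]) (auto simp: unit_seq_def)

lemma ell_norm_unit_seq: "ell_norm 1 (unit_seq a :: nat \<Rightarrow> 'k::real_normed_field) = 1"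
proof -
  have "(\<Sum>i. norm (unit_seq a i :: 'k)) = (\<Sum>i\<in>{a}. norm (unit_seq a i :: 'k))"
    by (rule suminf_finite) (auto simp: unit_seq_def)
  also have "\<dots> = 1" by (simp add: unit_seq_def)
  finally show ?thesis by (simp add: ell_norm_one[OF unit_seq_ell])
qed

lemma ell_one_lincomb:
  assumes "u \<in> ell 1" "v \<in> ell 1"
  shows "(\<lambda>i. a * u i + b * v i) \<in> ell 1"
  unfolding ell_one_iff
proof (rule summable_comparison_test')
  show "summable (\<lambda>i. norm a * norm (u i) + norm b * norm (v i))"
    using assms by (intro summable_add summable_mult) (auto simp: ell_one_iff)
  show "norm (norm (a * u i + b * v i)) \<le> norm a * norm (u i) + norm b * norm (v i)" for i
    using norm_triangle_ineq[of "a * u i" "b * v i"] by (simp add: norm_mult)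
qed

lemma ell_one_scale: "u \<in> ell 1 \<Longrightarrow> (\<lambda>i. a * u i) \<in> ell 1"
  using ell_one_lincomb[of u u a 0] by simp

lemma PiE_upd_ell: "x \<in> {..<m} \<rightarrow>\<^sub>E S \<Longrightarrow> k < m \<Longrightarrow> u \<in> S \<Longrightarrow> x(k := u) \<in> {..<m} \<rightarrow>\<^sub>E S"
  by (auto simp: PiE_def extensional_def)

locale bounded_multilinear_op =
  fixes m :: nat and T :: "(nat \<Rightarrow> nat \<Rightarrow> 'k::{real_normed_field,banach}) \<Rightarrow> nat \<Rightarrow> 'k"
  assumes T: "T \<in> bounded_multilinear_ops m 1 2"
begin

lemma T_ell: "x \<in> {..<m} \<rightarrow>\<^sub>E ell 1 \<Longrightarrow> T x \<in> ell 2"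
  using T by (auto simp: bounded_multilinear_ops_def)

lemma T_linear:
  "\<lbrakk>x \<in> {..<m} \<rightarrow>\<^sub>E ell 1; k < m; u \<in> ell 1; v \<in> ell 1\<rbrakk> \<Longrightarrow>
    T (x(k := \<lambda>i. a * u i + b * v i)) = (\<lambda>i. a * T (x(k := u)) i + b * T (x(k := v)) i)"
  using T by (simp add: bounded_multilinear_ops_def)

lemma T_bound: "\<exists>B\<ge>0. \<forall>x \<in> {..<m} \<rightarrow>\<^sub>E ell 1. ell_norm 2 (T x) \<le> B * (\<Prod>k<m. ell_norm 1 (x k))"
proof -
  obtain C where C: "\<forall>x \<in> {..<m} \<rightarrow>\<^sub>E ell 1. ell_norm 2 (T x) \<le> C * (\<Prod>k<m. ell_norm 1 (x k))"
    using T by (auto simp: bounded_multilinear_ops_def)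
  have "ell_norm 2 (T x) \<le> max C 0 * (\<Prod>k<m. ell_norm 1 (x k))" if "x \<in> {..<m} \<rightarrow>\<^sub>E ell 1" for x
    using C that by (intro order.trans[OF C[rule_format, OF that]] mult_right_mono prod_nonneg)
        (auto simp: ell_norm_nonneg)
  then show ?thesis by (intro exI[of _ "max C 0"]) auto
qed

lemma T_scale_arg:
  assumes "x \<in> {..<m} \<rightarrow>\<^sub>E ell 1" "k < m" "u \<in> ell 1"
  shows "T (x(k := \<lambda>i. a * u i)) = (\<lambda>i. a * T (x(k := u)) i)"
  using T_linear[OF assms assms(3), of a 0] by simp

text \<open>The factors are pulled out one argument at a time; \<open>z n\<close> is the tuple in
  which the arguments below \<open>n\<close> are scaled.\<close>

lemma T_scale:
  assumes u: "\<And>k. k < m \<Longrightarrow> u k \<in> ell 1"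
  shows "T (\<lambda>k\<in>{..<m}. \<lambda>i. s k * u k i) = (\<lambda>i. (\<Prod>k<m. s k) * T (\<lambda>k\<in>{..<m}. u k) i)"
proof -
  define z where "z n = (\<lambda>k\<in>{..<m}. if k < n then (\<lambda>i. s k * u k i) else u k)" for n
  have z: "z n \<in> {..<m} \<rightarrow>\<^sub>E ell 1" for n
    using u by (auto simp: z_def ell_one_scale)
  have "T (z n) = (\<lambda>i. (\<Prod>k<n. s k) * T (z 0) i)" if "n \<le> m" for n
    using that
  proof (induction n)
    case (Suc n)
    have "z (Suc n) = (z n)(n := \<lambda>i. s n * u n i)" "(z n)(n := u n) = z n"
      using Suc(2) by (auto simp: z_def fun_eq_iff less_Suc_eq)
    then have "T (z (Suc n)) = (\<lambda>i. s n * T (z n) i)"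
      using T_scale_arg[OF z, of n "u n" n "s n"] Suc(2) u by simp
    then show ?case using Suc by (simp add: mult_ac)
  qed simp
  from this[of m] have "T (z m) = (\<lambda>i. (\<Prod>k<m. s k) * T (z 0) i)" by simp
  moreover have "z m = (\<lambda>k\<in>{..<m}. \<lambda>i. s k * u k i)" "z 0 = (\<lambda>k\<in>{..<m}. u k)"
    by (auto simp: z_def fun_eq_iff)
  ultimately show ?thesis by simp
qed

text \<open>Finite heads of \<open>x k\<close> expand by linearity, and boundedness makes the value
  at the tail at most a constant times the l_1 norm of that tail.\<close>

lemma T_series:
  assumes x: "x \<in> {..<m} \<rightarrow>\<^sub>E ell 1" and k: "k < m"
  shows "(\<lambda>a. x k a * T (x(k := unit_seq a)) i) sums T x i"
proof -
  obtain B where B: "B \<ge> 0" "\<forall>x \<in> {..<m} \<rightarrow>\<^sub>E ell 1. ell_norm 2 (T x) \<le> B * (\<Prod>k<m. ell_norm 1 (x k))"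
    using T_bound by blast
  define hd where "hd n = (\<lambda>i. if i < n then x k i else 0)" for n
  define tl where "tl n = (\<lambda>i. if i < n then 0 else x k i)" for n
  have xk: "x k \<in> ell 1" using x k by auto
  then have sx: "summable (\<lambda>i. norm (x k i))" by (simp add: ell_one_iff)
  have hd: "hd n \<in> ell 1" for n
    unfolding ell_one_iff by (rule summable_finite[of "{..<n}"]) (auto simp: hd_def)
  have tl: "tl n \<in> ell 1" for n
    unfolding ell_one_iff by (rule summable_comparison_test'[OF sx]) (auto simp: tl_def)
  have tln: "ell_norm 1 (tl n) = (\<Sum>i. norm (x k (i + n)))" for n
  proof -
    have "(\<Sum>i. norm (tl n i)) = (\<Sum>i. norm (tl n (i + n))) + (\<Sum>i<n. norm (tl n i))"
      using tl by (intro suminf_split_initial_segment) (simp add: ell_one_iff)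
    then show ?thesis unfolding ell_norm_one[OF tl] by (simp add: tl_def)
  qed
  have hd0: "T (x(k := hd n)) i = (\<Sum>a<n. x k a * T (x(k := unit_seq a)) i)" for n
  proof (induction n)
    case 0
    have z: "hd 0 = (\<lambda>i. 0)" by (simp add: hd_def)
    have lin: "T (x(k := \<lambda>i. 0)) = (\<lambda>i. 0)" using T_linear[OF x k hd hd, of 0 0 0 0] by simp
    show ?case unfolding z lin lessThan_0 sum.empty ..
  next
    case (Suc n)
    have "hd (Suc n) = (\<lambda>i. 1 * hd n i + x k n * unit_seq n i)"
      by (auto simp: hd_def unit_seq_def less_Suc_eq)
    then have e: "T (x(k := hd (Suc n))) i = T (x(k := hd n)) i + x k n * T (x(k := unit_seq n)) i"
      using T_linear[OF x k hd unit_seq_ell, of 1 n "x k n" n] by simp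
    show ?case unfolding e Suc sum.lessThan_Suc ..
  qed
  have split: "T x i = T (x(k := hd n)) i + T (x(k := tl n)) i" for n
  proof -
    have "x k = (\<lambda>i. 1 * hd n i + 1 * tl n i)" by (auto simp: hd_def tl_def)
    then have "x = x(k := \<lambda>i. 1 * hd n i + 1 * tl n i)" by (metis fun_upd_triv)
    then have "T x = T (x(k := \<lambda>i. 1 * hd n i + 1 * tl n i))" by (rule arg_cong)
    then show ?thesis unfolding T_linear[OF x k hd tl] by simp
  qed
  define P where "P = B * (\<Prod>j\<in>{..<m} - {k}. ell_norm 1 (x j))"
  have tb: "norm (T (x(k := tl n)) i) \<le> P * ell_norm 1 (tl n)" for n
  proof -
    have xt: "x(k := tl n) \<in> {..<m} \<rightarrow>\<^sub>E ell 1" using x k tl by (intro PiE_upd_ell)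
    have "(norm (T (x(k := tl n)) i))\<^sup>2 \<le> (\<Sum>j<Suc i. (norm (T (x(k := tl n)) j))\<^sup>2)"
      by (intro member_le_sum) auto
    then have "norm (T (x(k := tl n)) i) \<le> sqrt (\<Sum>j<Suc i. (norm (T (x(k := tl n)) j))\<^sup>2)"
      by (rule real_le_rsqrt)
    also have "\<dots> \<le> ell_norm 2 (T (x(k := tl n)))" by (intro ell_norm_two_partial T_ell xt)
    also have "\<dots> \<le> B * (\<Prod>j<m. ell_norm 1 ((x(k := tl n)) j))" using B xt by blast
    also have "(\<Prod>j<m. ell_norm 1 ((x(k := tl n)) j)) = ell_norm 1 (tl n) * (\<Prod>j\<in>{..<m} - {k}.
        ell_norm 1 (x j))"
      using k by (subst prod.remove[of _ k]) auto
    finally show ?thesis unfolding P_def by (simp only: mult_ac)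
  qed
  have "(\<lambda>n. (\<Sum>i. norm (x k (i + n)))) \<longlonglongrightarrow> 0"
  proof -
    have "(\<lambda>n. (\<Sum>i. norm (x k i)) - (\<Sum>i<n. norm (x k i))) \<longlonglongrightarrow> (\<Sum>i. norm (x k i)) - (\<Sum>i. norm (x k i))"
      by (intro tendsto_diff tendsto_const summable_LIMSEQ sx)
    moreover have "(\<Sum>i. norm (x k i)) - (\<Sum>i<n. norm (x k i)) = (\<Sum>i. norm (x k (i + n)))" for n
      using suminf_split_initial_segment[OF sx, of n] by simp
    ultimately show ?thesis by simp
  qed
  then have lim: "(\<lambda>n. P * ell_norm 1 (tl n)) \<longlonglongrightarrow> 0"
    unfolding tln by (rule tendsto_mult_right_zero)
  have "(\<lambda>n. T (x(k := tl n)) i) \<longlonglongrightarrow> 0"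
    by (rule Lim_null_comparison[OF always_eventually lim]) (intro allI tb)
  then have "(\<lambda>n. T x i - T (x(k := tl n)) i) \<longlonglongrightarrow> T x i - 0"
    by (intro tendsto_diff tendsto_const)
  moreover have "T x i - T (x(k := tl n)) i = (\<Sum>a<n. x k a * T (x(k := unit_seq a)) i)" for n
    using split[of n] hd0[of n] by simp
  ultimately show ?thesis unfolding sums_def by simp
qed

text \<open>The state between two steps of the iteration: variables below \<open>n\<close> carry the
  given sequences, the others still run through unit vectors.\<close>

definition mixed :: "(nat \<Rightarrow> nat \<Rightarrow> nat \<Rightarrow> 'k) \<Rightarrow> nat \<Rightarrow> (nat \<Rightarrow> nat) \<Rightarrow> (nat \<Rightarrow> nat) \<Rightarrow> nat \<Rightarrow> nat \<Rightarrow> 'k"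
    where
  "mixed x n c d = (\<lambda>k\<in>{..<m}. if k < n then x k (c k) else unit_seq (d k))"

end

locale bounded_multilinear_op_parts = bounded_multilinear_op m T + scalar_parts re im \<iota>
  for m and T :: "(nat \<Rightarrow> nat \<Rightarrow> 'k::{real_normed_field,banach}) \<Rightarrow> nat \<Rightarrow> 'k"
    and re im :: "'k \<Rightarrow> real" and \<iota> :: 'k
begin

text \<open>Uniformity in \<open>d\<close> drives the induction: letting \<open>d n\<close> range
  over all indices gives the hypothesis of \<open>step_field\<close> for the variable
  \<open>n\<close>, and \<open>T_series\<close> expands \<open>x n\<close> in unit vectors. The
  outer index of that step is the multi-index of the variables done before.\<close>

lemma iterate:
  assumes adm: "\<And>k. k < m \<Longrightarrow> admissible (r k) (r (Suc k))" and n: "n \<le> m" and r0: "r 0 \<ge> 0"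
  shows "\<exists>C. \<forall>N L x d. (\<forall>k<m. \<forall>k'<m. wk (r (Suc k')) 1 N (x k)) \<longrightarrow>
    (\<Sum>c\<in>{..<n} \<rightarrow>\<^sub>E {..<N}. norm_upto L (T (mixed x n c d)) powr r n) \<le> C"
  using n
proof (induction n)
  case 0
  obtain B where B: "B \<ge> 0" "\<forall>x \<in> {..<m} \<rightarrow>\<^sub>E ell 1. ell_norm 2 (T x) \<le> B * (\<Prod>k<m. ell_norm 1 (x k))"
    using T_bound by blast
  have "norm_upto L (T (mixed x 0 c d)) powr r 0 \<le> B powr r 0" for L x c d
  proof (rule powr_mono2)
    have e: "mixed x 0 c d \<in> {..<m} \<rightarrow>\<^sub>E ell 1" by (auto simp: mixed_def unit_seq_ell)
    have "norm_upto L (T (mixed x 0 c d)) \<le> ell_norm 2 (T (mixed x 0 c d))"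
      by (intro ell_norm_two_partial T_ell e)
    also have "\<dots> \<le> B * (\<Prod>k<m. ell_norm 1 (mixed x 0 c d k))" using B e by blast
    also have "(\<Prod>k<m. ell_norm 1 (mixed x 0 c d k)) = 1"
      by (intro prod.neutral) (auto simp: mixed_def ell_norm_unit_seq)
    finally show "norm_upto L (T (mixed x 0 c d)) \<le> B" by simp
  qed (use r0 in \<open>auto intro: sum_nonneg\<close>)
  then show ?case by (intro exI[of _ "B powr r 0"]) simp
next
  case (Suc n)
  then have n: "n < m" by simp
  from Suc obtain D where D: "\<forall>N L x d. (\<forall>k<m. \<forall>k'<m. wk (r (Suc k')) 1 N (x k)) \<longrightarrow>
    (\<Sum>c\<in>{..<n} \<rightarrow>\<^sub>E {..<N}. norm_upto L (T (mixed x n c d)) powr r n) \<le> D"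
    by auto
  have "\<exists>C. \<forall>N (L::nat) (\<Lambda> :: (nat \<Rightarrow> nat) set) x f. finite \<Lambda> \<longrightarrow> wk (r (Suc n)) 1 N (x :: nat \<Rightarrow> nat
      \<Rightarrow> 'k) \<longrightarrow>
     (\<forall>a. (\<Sum>l\<in>\<Lambda>. sqrt (\<Sum>i<L. (norm (f l i a))\<^sup>2) powr r n) \<le> D) \<longrightarrow>
     (\<Sum>j<N. \<Sum>l\<in>\<Lambda>. sqrt (\<Sum>i<L. (norm (\<Sum>a. x j a * f l i a))\<^sup>2) powr r (Suc n)) \<le> C"
    by (rule step_field[OF adm[OF n]])
  then obtain C where
    C: "\<forall>N (L::nat) (\<Lambda> :: (nat \<Rightarrow> nat) set) x f. finite \<Lambda> \<longrightarrow> wk (r (Suc n)) 1 N (x :: nat \<Rightarrow> nat \<Rightarrow>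
        'k) \<longrightarrow>
     (\<forall>a. (\<Sum>l\<in>\<Lambda>. sqrt (\<Sum>i<L. (norm (f l i a))\<^sup>2) powr r n) \<le> D) \<longrightarrow>
     (\<Sum>j<N. \<Sum>l\<in>\<Lambda>. sqrt (\<Sum>i<L. (norm (\<Sum>a. x j a * f l i a))\<^sup>2) powr r (Suc n)) \<le> C" ..
  have "(\<Sum>c\<in>{..<Suc n} \<rightarrow>\<^sub>E {..<N}. norm_upto L (T (mixed x (Suc n) c d)) powr r (Suc n)) \<le> C"
    if w: "\<forall>k<m. \<forall>k'<m. wk (r (Suc k')) 1 N (x k)" for N and L :: nat and x d
  proof -
    have ser: "T (mixed x (Suc n) (c(n := j)) d) i = (\<Sum>a. x n j a * T (mixed x n c (d(n := a))) i)"
      if c: "c \<in> {..<n} \<rightarrow>\<^sub>E {..<N}" and j: "j < N" for c j i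
    proof -
      let ?z = "mixed x (Suc n) (c(n := j)) d"
      have "x k (c k) \<in> ell 1" if "k < n" for k
      proof -
        have "c k < N" using c that by auto
        moreover have "wk (r (Suc n)) 1 N (x k)" using w that n by simp
        ultimately show ?thesis unfolding ell_one_iff by (intro wkD(1))
      qed
      moreover have "wk (r (Suc n)) 1 N (x n)" using w n by simp
      then have "x n j \<in> ell 1" unfolding ell_one_iff using j by (rule wkD(1))
      ultimately have z: "?z \<in> {..<m} \<rightarrow>\<^sub>E ell 1"
        by (auto simp: mixed_def unit_seq_ell less_Suc_eq)
      have "?z(n := unit_seq a) = mixed x n c (d(n := a))" for a
        using n by (auto simp: mixed_def fun_eq_iff less_Suc_eq)
      moreover have "?z n = x n j" using n by (simp add: mixed_def)
      ultimately show ?thesis using T_series[OF z n, of i] by (simp add: sums_iff)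
    qed
    have "(\<Sum>c\<in>{..<Suc n} \<rightarrow>\<^sub>E {..<N}. norm_upto L (T (mixed x (Suc n) c d)) powr r (Suc n))
        = (\<Sum>j<N. \<Sum>c\<in>{..<n} \<rightarrow>\<^sub>E {..<N}. sqrt (\<Sum>i<L. (norm (T (mixed x (Suc n) (c(n := j)) d) i))\<^sup>2)
            powr r (Suc n))"
      unfolding lessThan_Suc by (rule sum_PiE_insert) simp
    also have "\<dots> = (\<Sum>j<N. \<Sum>c\<in>{..<n} \<rightarrow>\<^sub>E {..<N}. sqrt (\<Sum>i<L. (norm (\<Sum>a. x n j a * T (mixed x n c
        (d(n := a))) i))\<^sup>2) powr r (Suc n))"
      by (intro sum.cong refl) (simp add: ser)
    also have "\<dots> \<le> C"
    proof (rule C[rule_format])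
      show "finite ({..<n} \<rightarrow>\<^sub>E {..<N})" by (simp add: finite_PiE)
      show "wk (r (Suc n)) 1 N (x n)" using w n by blast
      show "(\<Sum>l\<in>{..<n} \<rightarrow>\<^sub>E {..<N}. sqrt (\<Sum>i<L. (norm (T (mixed x n l (d(n := a))) i))\<^sup>2) powr r n)
          \<le> D" for a
        using D w by blast
    qed
    finally show ?thesis .
  qed
  then show ?case by (intro exI[of _ C]) simp
qed

abbreviation "T_at x c \<equiv> T (\<lambda>k\<in>{..<m}. x k (c k))"

text \<open>Multiple summability normalised to weak norms at most 1, on finite boxes of indices and
  finitely many coordinates of the values. The constant does not depend on \<open>N\<close> and
  \<open>L\<close>, so both may tend to infinity.\<close>

definition summing_bound :: "real \<Rightarrow> real \<Rightarrow> bool" where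
  "summing_bound q p \<longleftrightarrow> (\<exists>C. \<forall>N (L::nat) (x :: nat \<Rightarrow> nat \<Rightarrow> nat \<Rightarrow> 'k). (\<forall>k<m. wk p 1 N (x k)) \<longrightarrow>
    (\<Sum>c\<in>{..<m} \<rightarrow>\<^sub>E {..<N}. norm_upto L (T_at x c) powr q) \<le> C)"

lemma wk_mono_exponent:
  assumes w: "wk p 1 N x" and "0 < p" "p \<le> s"
  shows "wk s 1 N x"
  unfolding wk_def
proof (intro conjI allI impI)
  show "summable (\<lambda>a. norm (x j a))" if "j < N" for j using wkD(1)[OF w that] .
  fix \<phi> :: "nat \<Rightarrow> real" assume phi: "\<forall>a. \<bar>\<phi> a\<bar> \<le> 1"
  have le: "(\<Sum>j<N. norm (\<Sum>a. \<phi> a *\<^sub>R x j a) powr p) \<le> 1" using phi by (intro wkD(2)[OF w]) auto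
  have "(\<Sum>j<N. norm (\<Sum>a. \<phi> a *\<^sub>R x j a) powr s) \<le> (\<Sum>j<N. norm (\<Sum>a. \<phi> a *\<^sub>R x j a) powr p)"
  proof (rule sum_mono)
    fix j assume "j \<in> {..<N}"
    then have "norm (\<Sum>a. \<phi> a *\<^sub>R x j a) powr p \<le> 1"
      using member_le_sum[of j "{..<N}" "\<lambda>j. norm (\<Sum>a. \<phi> a *\<^sub>R x j a) powr p"] le by simp
    then have "norm (\<Sum>a. \<phi> a *\<^sub>R x j a) \<le> 1" using assms(2) by (metis norm_ge_zero gr_one_powr
        not_le)
    then show "norm (\<Sum>a. \<phi> a *\<^sub>R x j a) powr s \<le> norm (\<Sum>a. \<phi> a *\<^sub>R x j a) powr p"
      using assms by (intro powr_mono') auto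
  qed
  then show "(\<Sum>j<N. norm (\<Sum>a. \<phi> a *\<^sub>R x j a) powr s) \<le> 1" using le by linarith
qed

lemma summing_bound_iterate:
  assumes "\<And>k. k < m \<Longrightarrow> admissible (r k) (r (Suc k))" "\<And>k. k < m \<Longrightarrow> p \<le> r (Suc k)" "r 0 \<ge> 0" "p > 0"
  shows "summing_bound (r m) p"
proof -
  from iterate[OF assms(1) _ assms(3), of m] obtain C where
    C: "\<forall>N L x d. (\<forall>k<m. \<forall>k'<m. wk (r (Suc k')) 1 N (x k)) \<longrightarrow>
    (\<Sum>c\<in>{..<m} \<rightarrow>\<^sub>E {..<N}. norm_upto L (T (mixed x m c d)) powr r m) \<le> C" by auto
  have e: "mixed x m c d = (\<lambda>k\<in>{..<m}. x k (c k))" for x :: "nat \<Rightarrow> nat \<Rightarrow> nat \<Rightarrow> 'k" and c d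
    by (auto simp: mixed_def fun_eq_iff)
  show ?thesis
    unfolding summing_bound_def
  proof (intro exI allI impI)
    fix N and L :: nat and x :: "nat \<Rightarrow> nat \<Rightarrow> nat \<Rightarrow> 'k" assume "\<forall>k<m. wk p 1 N (x k)"
    then have w: "\<forall>k<m. \<forall>k'<m. wk (r (Suc k')) 1 N (x k)"
      using assms(2,4) wk_mono_exponent by blast
    show "(\<Sum>c\<in>{..<m} \<rightarrow>\<^sub>E {..<N}. norm_upto L (T_at x c) powr r m) \<le> C"
      using C[THEN spec[of _ N], THEN spec[of _ L], THEN spec[of _ x], THEN spec[of _ "\<lambda>_. 0"],
          THEN mp, OF w] unfolding e .
  qed
qed

lemma summing_bound_two: "summing_bound 2 2"
  using summing_bound_iterate[of "\<lambda>_. 2" 2] by (simp add: admissible_def)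

text \<open>The exponents p + (q - p) k / m rise linearly from p to q, so each of the m variables
  receives a strict increase and none falls below p.\<close>

lemma summing_bound_large:
  assumes "2 < p" "p < q" "m > 0"
  shows "summing_bound q p"
proof -
  have "summing_bound (p + (q - p) * real m / real m) p"
  proof (rule summing_bound_iterate[of "\<lambda>k. p + (q - p) * real k / real m" p])
    fix k
    show "admissible (p + (q - p) * real k / real m) (p + (q - p) * real (Suc k) / real m)"
    proof -
      have "0 \<le> (q - p) * real k / real m" using assms by simp
      moreover have "(q - p) * real k / real m < (q - p) * real (Suc k) / real m"
        using assms by (intro divide_strict_right_mono mult_strict_left_mono) auto
      ultimately show ?thesis unfolding admissible_def using assms by linarith
    qed
    show "p \<le> p + (q - p) * real (Suc k) / real m" using assms by simp
  qed (use assms in auto)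
  then show ?thesis using assms by simp
qed

end

section \<open>Reduction of exponents below 2 to the exponent 2\<close>

lemma powr_mult_le_add:
  fixes a b p :: real
  assumes "a > 0" "b \<ge> 0" "1 \<le> p" "p < 2"
  shows "a powr p * b powr p \<le> a powr (2 * p / (2 - p)) + b powr 2"
proof (cases "b \<le> a powr (p / (2 - p))")
  case True
  then have "a powr p * b powr p \<le> a powr p * (a powr (p / (2 - p))) powr p"
    using assms by (intro mult_left_mono powr_mono2) auto
  also have "\<dots> = a powr (p + p / (2 - p) * p)" by (simp only: powr_powr powr_add)
  also have "p + p / (2 - p) * p = 2 * p / (2 - p)" using assms by (simp add: field_simps)
  finally show ?thesis by (simp add: add_increasing2)
next
  case False
  then have "(a powr (p / (2 - p))) powr (2 - p) \<le> b powr (2 - p)"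
    using assms by (intro powr_mono2) auto
  then have "a powr p \<le> b powr (2 - p)" using assms by (simp add: powr_powr)
  then have "a powr p * b powr p \<le> b powr (2 - p) * b powr p" by (intro mult_right_mono) auto
  also have "\<dots> = b powr 2" by (simp only: powr_add[symmetric]) simp
  finally show ?thesis by (simp add: add_increasing)
qed

text \<open>Multiplying \<sigma> by sqrt C moves the constant from the weak 2-norm to the sum of
  powers, since \<open>summing_bound\<close> is stated for weak norms at most 1.\<close>

lemma (in scalar_parts) factor_field_normalized:
  assumes p: "1 \<le> p" "p < 2"
  shows "\<exists>C>0. \<forall>N (x :: nat \<Rightarrow> nat \<Rightarrow> 'k). wk p 1 N x \<longrightarrow>
    (\<exists>\<sigma>. (\<forall>j<N. \<sigma> j > 0) \<and> (\<Sum>j<N. \<sigma> j powr (2 * p / (2 - p))) \<le> C \<and>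
      wk 2 1 N (\<lambda>j a. (1 / \<sigma> j) *\<^sub>R x j a))"
proof -
  from factor_field[OF p] obtain C where C: "C > 0" "\<forall>N (x :: nat \<Rightarrow> nat \<Rightarrow> 'k). wk p 1 N x \<longrightarrow>
    (\<exists>\<sigma>. (\<forall>j<N. \<sigma> j > 0) \<and> (\<Sum>j<N. \<sigma> j powr (2 * p / (2 - p))) \<le> C \<and>
      wk 2 C N (\<lambda>j a. (1 / \<sigma> j) *\<^sub>R x j a))" by blast
  define c where "c = sqrt C"
  have c: "c > 0" "c\<^sup>2 = C" using C by (auto simp: c_def)
  have "\<exists>\<sigma>. (\<forall>j<N. \<sigma> j > 0) \<and> (\<Sum>j<N. \<sigma> j powr (2 * p / (2 - p))) \<le> c powr (2 * p / (2 - p)) * C \<and>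
      wk 2 1 N (\<lambda>j a. (1 / \<sigma> j) *\<^sub>R x j a)" if w: "wk p 1 N x" for N and x :: "nat \<Rightarrow> nat \<Rightarrow> 'k"
  proof -
    from C(2) w obtain \<sigma> where \<sigma>: "\<forall>j<N. \<sigma> j > 0" "(\<Sum>j<N. \<sigma> j powr (2 * p / (2 - p))) \<le> C"
      "wk 2 C N (\<lambda>j a. (1 / \<sigma> j) *\<^sub>R x j a)" by blast
    have "(\<Sum>j<N. (c * \<sigma> j) powr (2 * p / (2 - p))) = c powr (2 * p / (2 - p)) * (\<Sum>j<N. \<sigma> j powr (2
        * p / (2 - p)))"
      by (simp add: powr_mult sum_distrib_left)
    also have "\<dots> \<le> c powr (2 * p / (2 - p)) * C" by (intro mult_left_mono \<sigma>) simp
    finally have 1: "(\<Sum>j<N. (c * \<sigma> j) powr (2 * p / (2 - p))) \<le> c powr (2 * p / (2 - p)) * C" .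
    have 2: "wk 2 1 N (\<lambda>j a. (1 / (c * \<sigma> j)) *\<^sub>R x j a)"
      unfolding wk_def
    proof (intro conjI allI impI)
      fix j assume "j < N"
      from wkD(1)[OF \<sigma>(3) this] have "summable (\<lambda>a. \<bar>1 / c\<bar> * norm ((1 / \<sigma> j) *\<^sub>R x j a))" by
          (rule summable_mult)
      then show "summable (\<lambda>a. norm ((1 / (c * \<sigma> j)) *\<^sub>R x j a))" by (simp add: abs_mult
          divide_inverse mult_ac)
    next
      fix \<phi> :: "nat \<Rightarrow> real" assume phi: "\<forall>a. \<bar>\<phi> a\<bar> \<le> 1"
      have "norm (\<Sum>a. \<phi> a *\<^sub>R (1 / (c * \<sigma> j)) *\<^sub>R x j a) powr 2 = (1 / C) * norm (\<Sum>a. \<phi> a *\<^sub>R (1 /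
          \<sigma> j) *\<^sub>R x j a) powr 2"
        if j: "j < N" for j
      proof -
        have s: "summable (\<lambda>a. \<phi> a *\<^sub>R (1 / \<sigma> j) *\<^sub>R x j a)"
        proof (rule summable_norm_cancel, rule summable_comparison_test'[OF wkD(1)[OF \<sigma>(3) j]])
          show "norm (norm (\<phi> a *\<^sub>R (1 / \<sigma> j) *\<^sub>R x j a)) \<le> norm ((1 / \<sigma> j) *\<^sub>R x j a)" for a
            using mult_right_mono[OF phi[rule_format, of a], of "norm ((1 / \<sigma> j) *\<^sub>R x j a)"]
            by (simp only: norm_scaleR[of "\<phi> a"] real_norm_def mult_1 norm_ge_zero abs_of_nonneg
                mult_nonneg_nonneg abs_ge_zero)
        qed
        have "(\<Sum>a. \<phi> a *\<^sub>R (1 / (c * \<sigma> j)) *\<^sub>R x j a) = (\<Sum>a. (1 / c) *\<^sub>R (\<phi> a *\<^sub>R (1 / \<sigma> j) *\<^sub>R x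
            j a))"
          by (simp add: mult_ac)
        also have "\<dots> = (1 / c) *\<^sub>R (\<Sum>a. \<phi> a *\<^sub>R (1 / \<sigma> j) *\<^sub>R x j a)" by (rule
            suminf_scaleR_right[OF s, symmetric])
        finally have "norm (\<Sum>a. \<phi> a *\<^sub>R (1 / (c * \<sigma> j)) *\<^sub>R x j a) = (1 / c) * norm (\<Sum>a. \<phi> a *\<^sub>R
            (1 / \<sigma> j) *\<^sub>R x j a)"
          using c by simp
        then show ?thesis using c by (simp add: power_divide)
      qed
      then have "(\<Sum>j<N. norm (\<Sum>a. \<phi> a *\<^sub>R (1 / (c * \<sigma> j)) *\<^sub>R x j a) powr 2)
          = (1 / C) * (\<Sum>j<N. norm (\<Sum>a. \<phi> a *\<^sub>R (1 / \<sigma> j) *\<^sub>R x j a) powr 2)"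
        unfolding sum_distrib_left by (intro sum.cong) auto
      also have "\<dots> \<le> (1 / C) * C"
        using phi C by (intro mult_left_mono wkD(2)[OF \<sigma>(3)]) auto
      finally show "(\<Sum>j<N. norm (\<Sum>a. \<phi> a *\<^sub>R (1 / (c * \<sigma> j)) *\<^sub>R x j a) powr 2) \<le> 1" using C by simp
    qed
    show ?thesis
      by (rule exI[of _ "\<lambda>j. c * \<sigma> j"]) (use \<sigma>(1) c 1 2 in simp)
  qed
  moreover have "c powr (2 * p / (2 - p)) * C > 0" using c C by simp
  ultimately show ?thesis by blast
qed

context bounded_multilinear_op_parts
begin

text \<open>By multilinearity the scalars \<sigma> leave T as a product. Young's inequality with
  exponents 2/(2-p) and 2/p separates this product from the value of T at \<open>y\<close>; its sum
  over the box factorizes and is at most C^m, and the rest is the case of exponent 2.\<close>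

lemma summing_bound_small:
  assumes p: "1 \<le> p" "p < 2"
  shows "summing_bound p p"
proof -
  define \<rho> where "\<rho> = 2 * p / (2 - p)"
  from factor_field_normalized[OF p] obtain C where C: "C > 0" "\<forall>N (x :: nat \<Rightarrow> nat \<Rightarrow> 'k). wk p 1 N
      x \<longrightarrow>
    (\<exists>\<sigma>. (\<forall>j<N. \<sigma> j > 0) \<and> (\<Sum>j<N. \<sigma> j powr \<rho>) \<le> C \<and>
      wk 2 1 N (\<lambda>j a. (1 / \<sigma> j) *\<^sub>R x j a))" unfolding \<rho>_def by blast
  from summing_bound_two obtain D where D: "\<forall>N (L::nat) (x :: nat \<Rightarrow> nat \<Rightarrow> nat \<Rightarrow> 'k). (\<forall>k<m. wk 2 1
      N (x k)) \<longrightarrow>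
    (\<Sum>c\<in>{..<m} \<rightarrow>\<^sub>E {..<N}. norm_upto L (T_at x c) powr 2) \<le> D"
    unfolding summing_bound_def ..
  have "(\<Sum>c\<in>{..<m} \<rightarrow>\<^sub>E {..<N}. norm_upto L (T_at x c) powr p) \<le> C ^ m + D"
    if w: "\<forall>k<m. wk p 1 N (x k)" for N and L :: nat and x :: "nat \<Rightarrow> nat \<Rightarrow> nat \<Rightarrow> 'k"
  proof -
    have "\<forall>k\<in>{..<m}. \<exists>\<sigma>. (\<forall>j<N. \<sigma> j > 0) \<and> (\<Sum>j<N. \<sigma> j powr \<rho>) \<le> C \<and>
      wk 2 1 N (\<lambda>j a. (1 / \<sigma> j) *\<^sub>R x k j a)" using C(2) w by blast
    from bchoice[OF this] obtain \<sigma> where \<sigma>: "\<forall>k\<in>{..<m}. (\<forall>j<N. \<sigma> k j > 0) \<and> (\<Sum>j<N. \<sigma> k j powr \<rho>) \<le>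
        C \<and>
      wk 2 1 N (\<lambda>j a. (1 / \<sigma> k j) *\<^sub>R x k j a)" ..
    define y where "y k j a = (1 / \<sigma> k j) *\<^sub>R x k j a" for k j a
    have wy: "\<forall>k<m. wk 2 1 N (y k)" using \<sigma> by (simp add: y_def[abs_def])
    have t: "norm_upto L (T_at x c) powr p
        \<le> (\<Prod>k<m. \<sigma> k (c k) powr \<rho>) + norm_upto L (T_at y c) powr 2"
      if c: "c \<in> {..<m} \<rightarrow>\<^sub>E {..<N}" for c
    proof -
      have cN: "c k < N" if "k < m" for k using c that by auto
      have sp: "\<sigma> k (c k) > 0" if "k < m" for k using \<sigma> cN[OF that] that by simp
      define a where "a = (\<Prod>k<m. \<sigma> k (c k))"
      have a: "a > 0" unfolding a_def using sp by (intro prod_pos) auto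
      have "(\<lambda>k\<in>{..<m}. x k (c k)) = (\<lambda>k\<in>{..<m}. \<lambda>i. of_real (\<sigma> k (c k)) * y k (c k) i)"
      proof (intro restrict_ext ext)
        fix k i assume "k \<in> {..<m}"
        then show "x k (c k) i = of_real (\<sigma> k (c k)) * y k (c k) i"
          using sp[of k] by (simp add: y_def scaleR_conv_of_real)
      qed
      moreover have "y k (c k) \<in> ell 1" if "k < m" for k
        using wkD(1)[of 2 1 N "y k" "c k"] wy cN that by (simp add: ell_one_iff)
      ultimately have "T_at x c = (\<lambda>i. (\<Prod>k<m. of_real (\<sigma> k (c k))) * T_at y c i)"
        using T_scale[of "\<lambda>k. y k (c k)" "\<lambda>k. of_real (\<sigma> k (c k))"] by simp
      then have "(norm (T_at x c i))\<^sup>2 = a\<^sup>2 * (norm (T_at y c i))\<^sup>2" for i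
        using a by (simp add: norm_mult power_mult_distrib a_def flip: of_real_prod)
      then have "norm_upto L (T_at x c) = a * norm_upto L (T_at y c)"
        using a by (simp add: sum_distrib_left[symmetric] real_sqrt_mult)
      then have "norm_upto L (T_at x c) powr p
         = a powr p * norm_upto L (T_at y c) powr p"
        by (simp only: powr_mult)
      also have "\<dots> \<le> a powr \<rho> + norm_upto L (T_at y c) powr 2"
        unfolding \<rho>_def using a p by (intro powr_mult_le_add) (auto intro: sum_nonneg)
      also have "a powr \<rho> = (\<Prod>k<m. \<sigma> k (c k) powr \<rho>)"
        unfolding a_def by (rule prod_powr_distrib)
      finally show ?thesis .
    qed
    have "(\<Sum>c\<in>{..<m} \<rightarrow>\<^sub>E {..<N}. norm_upto L (T_at x c) powr p)
       \<le> (\<Sum>c\<in>{..<m} \<rightarrow>\<^sub>E {..<N}. (\<Prod>k<m. \<sigma> k (c k) powr \<rho>) + norm_upto L (T_at y c) powr 2)"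
      by (intro sum_mono t)
    also have "\<dots> = (\<Prod>k<m. \<Sum>j<N. \<sigma> k j powr \<rho>)
        + (\<Sum>c\<in>{..<m} \<rightarrow>\<^sub>E {..<N}. norm_upto L (T_at y c) powr 2)"
      by (simp only: sum.distrib prod_sum_PiE[OF finite_lessThan finite_lessThan])
    also have "\<dots> \<le> C ^ m + D"
    proof (rule add_mono)
      have "(\<Prod>k<m. \<Sum>j<N. \<sigma> k j powr \<rho>) \<le> (\<Prod>k<m. C)"
        using \<sigma> by (intro prod_mono) (auto intro: sum_nonneg)
      then show "(\<Prod>k<m. \<Sum>j<N. \<sigma> k j powr \<rho>) \<le> C ^ m" by simp
      show "(\<Sum>c\<in>{..<m} \<rightarrow>\<^sub>E {..<N}. norm_upto L (T_at y c) powr 2) \<le> D"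
        using D[THEN spec[of _ N], THEN spec[of _ L], THEN spec[of _ y], THEN mp, OF wy] .
    qed
    finally show ?thesis .
  qed
  then show ?thesis unfolding summing_bound_def by (intro exI[of _ "C ^ m + D"]) simp
qed

lemma summing_bound_mono:
  assumes b: "summing_bound q p" and q: "0 < q" "q \<le> s"
  shows "summing_bound s p"
proof -
  from b obtain D where D: "\<forall>N (L::nat) (x :: nat \<Rightarrow> nat \<Rightarrow> nat \<Rightarrow> 'k). (\<forall>k<m. wk p 1 N (x k)) \<longrightarrow>
    (\<Sum>c\<in>{..<m} \<rightarrow>\<^sub>E {..<N}. norm_upto L (T_at x c) powr q) \<le> D"
    unfolding summing_bound_def ..
  define E where "E = max D 1"
  have E: "E \<ge> 1" "D \<le> E" by (auto simp: E_def)
  have "(\<Sum>c\<in>{..<m} \<rightarrow>\<^sub>E {..<N}. norm_upto L (T_at x c) powr s) \<le> E powr (s / q - 1) * E"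
    if w: "\<forall>k<m. wk p 1 N (x k)" for N and L :: nat and x :: "nat \<Rightarrow> nat \<Rightarrow> nat \<Rightarrow> 'k"
  proof -
    let ?f = "\<lambda>c. norm_upto L (T_at x c)"
    have le: "(\<Sum>c\<in>{..<m} \<rightarrow>\<^sub>E {..<N}. ?f c powr q) \<le> E"
      using D[THEN spec[of _ N], THEN spec[of _ L], THEN spec[of _ x], THEN mp, OF w] E by linarith
    have "(\<Sum>c\<in>{..<m} \<rightarrow>\<^sub>E {..<N}. ?f c powr s) \<le> (\<Sum>c\<in>{..<m} \<rightarrow>\<^sub>E {..<N}. E powr (s / q - 1) * ?f c
        powr q)"
    proof (rule sum_mono)
      fix c assume c: "c \<in> {..<m} \<rightarrow>\<^sub>E {..<N}"
      have "?f c powr q \<le> (\<Sum>c\<in>{..<m} \<rightarrow>\<^sub>E {..<N}. ?f c powr q)"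
        using c by (intro member_le_sum) (auto simp: finite_PiE)
      then have "?f c powr q \<le> E" using le by linarith
      then have "(?f c powr q) powr (s / q - 1) \<le> E powr (s / q - 1)"
        using q by (intro powr_mono2) auto
      then have "(?f c powr q) powr (s / q - 1) * ?f c powr q \<le> E powr (s / q - 1) * ?f c powr q"
        by (intro mult_right_mono) auto
      also have "(?f c powr q) powr (s / q - 1) * ?f c powr q = ?f c powr (q * (s / q - 1) + q)"
        by (simp only: powr_powr powr_add)
      also have "q * (s / q - 1) + q = s" using q by (simp add: field_simps)
      finally show "?f c powr s \<le> E powr (s / q - 1) * ?f c powr q" .
    qed
    also have "\<dots> = E powr (s / q - 1) * (\<Sum>c\<in>{..<m} \<rightarrow>\<^sub>E {..<N}. ?f c powr q)" by (simp only:
        sum_distrib_left)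
    also have "\<dots> \<le> E powr (s / q - 1) * E" by (intro mult_left_mono le) simp
    finally show ?thesis .
  qed
  then show ?thesis unfolding summing_bound_def by (intro exI[of _ "E powr (s / q - 1) * E"]) simp
qed

lemma summing_bound_all:
  assumes "m > 0" "1 \<le> p" "p \<le> q" "p \<le> 2 \<or> q > p \<and> p > 2"
  shows "summing_bound q p"
proof (cases "p > 2")
  case True
  then show ?thesis using assms summing_bound_large by simp
next
  case False
  have "summing_bound p p"
  proof (cases "p = 2")
    case True
    show ?thesis unfolding True by (rule summing_bound_two)
  next
    case 2: False
    show ?thesis by (rule summing_bound_small) (use False 2 assms in linarith)+
  qed
  then show ?thesis by (rule summing_bound_mono) (use assms in auto)
qed

end

section \<open>Weak norms defined by the dual ball of l_1, and the passage to infinite sums\<close>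

lemma weighted_sum_dual:
  fixes \<phi> :: "nat \<Rightarrow> real"
  assumes phi: "\<And>a. \<bar>\<phi> a\<bar> \<le> 1"
  shows "(\<lambda>y\<in>ell 1. \<Sum>a. \<phi> a *\<^sub>R y a) \<in> (dual_unit_ball 1 :: ((nat \<Rightarrow>
      'k::{real_normed_field,banach}) \<Rightarrow> 'k) set)"
proof -
  have sn: "summable (\<lambda>a. norm (\<phi> a *\<^sub>R y a))" and le: "\<And>a. norm (\<phi> a *\<^sub>R y a) \<le> norm (y a)"
    if "y \<in> ell 1" for y :: "nat \<Rightarrow> 'k"
  proof -
    show l: "norm (\<phi> a *\<^sub>R y a) \<le> norm (y a)" for a
      using mult_right_mono[OF phi[of a], of "norm (y a)"] by simp
    show "summable (\<lambda>a. norm (\<phi> a *\<^sub>R y a))"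
      using that unfolding ell_one_iff by (rule summable_comparison_test'[where N = 0]) (use l in
          simp)
  qed
  have s: "summable (\<lambda>a. \<phi> a *\<^sub>R y a)" if "y \<in> ell 1" for y :: "nat \<Rightarrow> 'k"
    using sn[OF that] by (rule summable_norm_cancel)
  show ?thesis
    unfolding dual_unit_ball_def
  proof (intro CollectI conjI ballI allI)
    fix x y :: "nat \<Rightarrow> 'k" and a b assume x: "x \<in> ell 1" and y: "y \<in> ell 1"
    have "(\<Sum>i. \<phi> i *\<^sub>R (a * x i + b * y i)) = (\<Sum>i. a * (\<phi> i *\<^sub>R x i) + b * (\<phi> i *\<^sub>R y i))"
      by (simp add: scaleR_add_right)
    also have "\<dots> = a * (\<Sum>i. \<phi> i *\<^sub>R x i) + b * (\<Sum>i. \<phi> i *\<^sub>R y i)"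
      using s[OF x] s[OF y] by (simp add: suminf_add[symmetric] suminf_mult summable_mult del:
          mult_scaleR_right)
    finally show "(\<lambda>y\<in>ell 1. \<Sum>a. \<phi> a *\<^sub>R y a) (\<lambda>i. a * x i + b * y i)
        = a * (\<lambda>y\<in>ell 1. \<Sum>a. \<phi> a *\<^sub>R y a) x + b * (\<lambda>y\<in>ell 1. \<Sum>a. \<phi> a *\<^sub>R y a) y"
      using x y ell_one_lincomb[OF x y] by simp
  next
    fix x :: "nat \<Rightarrow> 'k" assume x: "x \<in> ell 1"
    have "norm (\<Sum>a. \<phi> a *\<^sub>R x a) \<le> (\<Sum>a. norm (\<phi> a *\<^sub>R x a))" by (rule summable_norm[OF sn[OF x]])
    also have "\<dots> \<le> (\<Sum>a. norm (x a))" using x by (intro suminf_le le sn) (simp_all add: ell_one_iff)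
    finally show "norm ((\<lambda>y\<in>ell 1. \<Sum>a. \<phi> a *\<^sub>R y a) x) \<le> ell_norm 1 x" using x by (simp add:
        ell_norm_one)
  qed simp
qed

lemma weak_norm_upper:
  assumes x: "x \<in> weak_ell p r" and f: "f \<in> dual_unit_ball r"
  shows "(\<Sum>j. norm (f (x j)) powr p) powr (1 / p) \<le> weak_norm p r x"
  unfolding weak_norm_def using x f by (intro cSUP_upper) (auto simp: weak_ell_def)

lemma weak_norm_nonneg:
  fixes x :: "nat \<Rightarrow> nat \<Rightarrow> 'k::{real_normed_field,banach}"
  assumes "x \<in> weak_ell p 1"
  shows "weak_norm p 1 x \<ge> 0"
  using weak_norm_upper[OF assms weighted_sum_dual[of "\<lambda>_. 0"]] by (rule order.trans[rotated]) auto

text \<open>A bounded real sequence acts as a functional of norm at most 1, so \<open>wk\<close>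
  tests only elements of the dual ball. The divisor w is allowed to exceed the weak norm, which can
  be 0.\<close>

lemma wk_weak_ell:
  fixes x :: "nat \<Rightarrow> nat \<Rightarrow> 'k::{real_normed_field,banach}"
  assumes x: "x \<in> weak_ell p 1" and w: "w > 0" "weak_norm p 1 x \<le> w" and p: "p > 0"
  shows "wk p 1 N (\<lambda>j a. (1 / w) *\<^sub>R x j a)"
  unfolding wk_def
proof (intro conjI allI impI)
  have xj: "x j \<in> ell 1" for j using x by (simp add: weak_ell_def)
  show "summable (\<lambda>a. norm ((1 / w) *\<^sub>R x j a))" for j
    using summable_mult[OF xj[of j, unfolded ell_one_iff], of "\<bar>1 / w\<bar>"] by simp
  fix \<phi> :: "nat \<Rightarrow> real" assume phi: "\<forall>a. \<bar>\<phi> a\<bar> \<le> 1"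
  define F :: "(nat \<Rightarrow> 'k) \<Rightarrow> 'k" where "F = (\<lambda>y\<in>ell 1. \<Sum>a. \<phi> a *\<^sub>R y a)"
  have F: "F \<in> dual_unit_ball 1" unfolding F_def using phi by (intro weighted_sum_dual) auto
  have sm: "summable (\<lambda>j. norm (F (x j)) powr p)" using x F by (simp add: weak_ell_def)
  have "((\<Sum>j. norm (F (x j)) powr p) powr (1 / p)) powr p \<le> w powr p"
    using weak_norm_upper[OF x F] w p by (intro powr_mono2) auto
  then have le: "(\<Sum>j. norm (F (x j)) powr p) \<le> w powr p"
    using p suminf_nonneg[OF sm] by (simp add: powr_powr)
  have e: "norm (\<Sum>a. \<phi> a *\<^sub>R (1 / w) *\<^sub>R x j a) powr p = (1 / w) powr p * norm (F (x j)) powr p"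
      for j
  proof -
    have "summable (\<lambda>a. \<phi> a *\<^sub>R x j a)"
    proof (rule summable_norm_cancel, rule summable_comparison_test'[OF xj[of j, unfolded
        ell_one_iff]])
      show "norm (norm (\<phi> a *\<^sub>R x j a)) \<le> norm (x j a)" for a
        using mult_right_mono[OF phi[rule_format, of a], of "norm (x j a)"] by simp
    qed
    then have "(\<Sum>a. (1 / w) *\<^sub>R (\<phi> a *\<^sub>R x j a)) = (1 / w) *\<^sub>R (\<Sum>a. \<phi> a *\<^sub>R x j a)"
      by (rule suminf_scaleR_right[symmetric])
    then have "(\<Sum>a. \<phi> a *\<^sub>R (1 / w) *\<^sub>R x j a) = (1 / w) *\<^sub>R F (x j)"
      using xj[of j] by (simp add: F_def mult.commute)
    then have "norm (\<Sum>a. \<phi> a *\<^sub>R (1 / w) *\<^sub>R x j a) = (1 / w) * norm (F (x j))" using w by simp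
    then show ?thesis by (simp only: powr_mult)
  qed
  have "(\<Sum>j<N. norm (\<Sum>a. \<phi> a *\<^sub>R (1 / w) *\<^sub>R x j a) powr p) = (1 / w) powr p * (\<Sum>j<N. norm (F (x
      j)) powr p)"
    by (simp only: e sum_distrib_left)
  also have "\<dots> \<le> (1 / w) powr p * w powr p"
    using sum_le_suminf[OF sm, of "{..<N}"] le by (intro mult_left_mono) auto
  also have "\<dots> = 1" using w by (simp add: powr_divide)
  finally show "(\<Sum>j<N. norm (\<Sum>a. \<phi> a *\<^sub>R (1 / w) *\<^sub>R x j a) powr p) \<le> 1" .
qed

lemma finite_PiE_bounded:
  fixes m :: nat
  assumes "finite F" "F \<subseteq> {..<m} \<rightarrow>\<^sub>E (UNIV :: nat set)"
  shows "\<exists>N. F \<subseteq> {..<m} \<rightarrow>\<^sub>E {..<N}"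
proof (intro exI subsetI)
  fix c assume c: "c \<in> F"
  have "c k < Suc (\<Sum>c\<in>F. \<Sum>k<m. c k)" if "k < m" for k
  proof -
    have "c k \<le> (\<Sum>k<m. c k)" using that by (intro member_le_sum) auto
    also have "\<dots> \<le> (\<Sum>c\<in>F. \<Sum>k<m. c k)"
      using c assms(1) by (intro member_le_sum[where f = "\<lambda>c. \<Sum>k<m. c k"]) auto
    finally show ?thesis by simp
  qed
  then show "c \<in> {..<m} \<rightarrow>\<^sub>E {..<Suc (\<Sum>c\<in>F. \<Sum>k<m. c k)}"
    using assms(2) c by (auto simp: PiE_iff)
qed

context bounded_multilinear_op_parts
begin

text \<open>Multi-homogeneity turns the normalised bound into one with the product of the numbers
  \<open>w k\<close>. Letting L tend to infinity recovers the norms of the values; finite sets of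
  multi-indices lie in boxes, which gives summability over all of them.\<close>

lemma summing_bound_imp_multiple_summing:
  assumes b: "summing_bound q p" and p: "p > 0" and q: "q > 0"
  shows "T \<in> multiple_summing_ops m q p 1 2"
proof -
  from b obtain D where D: "\<forall>N (L::nat) (x :: nat \<Rightarrow> nat \<Rightarrow> nat \<Rightarrow> 'k). (\<forall>k<m. wk p 1 N (x k)) \<longrightarrow>
    (\<Sum>c\<in>{..<m} \<rightarrow>\<^sub>E {..<N}. norm_upto L (T_at x c) powr q) \<le> D"
    unfolding summing_bound_def ..
  define C where "C = max D 1"
  have C: "C > 0" "D \<le> C" by (auto simp: C_def)
  have main: "(\<lambda>c. ell_norm 2 (T_at x c) powr q) summable_on ({..<m} \<rightarrow>\<^sub>E UNIV) \<and>
     (\<Sum>\<^sub>\<infinity>c\<in>{..<m} \<rightarrow>\<^sub>E UNIV. ell_norm 2 (T_at x c) powr q) powr (1 / q)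
         \<le> C powr (1 / q) * (\<Prod>k<m. weak_norm p 1 (x k) + \<epsilon>)"
    if x: "\<forall>k<m. x k \<in> weak_ell p 1" and eps: "\<epsilon> > 0" for x :: "nat \<Rightarrow> nat \<Rightarrow> nat \<Rightarrow> 'k" and \<epsilon>
  proof -
    \<comment> \<open>The summand \<epsilon> keeps the divisor positive when a weak norm vanishes; a
      limit from the right removes it at the end.\<close>
    define w where "w k = weak_norm p 1 (x k) + \<epsilon>" for k
    have w: "w k > 0" if "k < m" for k
      using weak_norm_nonneg x eps that by (auto simp: w_def intro: add_nonneg_pos)
    define P where "P = (\<Prod>k<m. w k)"
    have P: "P > 0" unfolding P_def using w by (intro prod_pos) auto
    define y where "y k j a = (1 / w k) *\<^sub>R x k j a" for k j a
    have xe: "x k j \<in> ell 1" if "k < m" for k j using x that by (simp add: weak_ell_def)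
    have ye: "y k j \<in> ell 1" if "k < m" for k j
      using ell_one_scale[OF xe[OF that], of "of_real (1 / w k)" j] by (simp add: y_def[abs_def]
          scaleR_conv_of_real)
    have wy: "\<forall>k<m. wk p 1 N (y k)" for N
      unfolding y_def using x w p eps by (auto intro!: wk_weak_ell simp: w_def)
    let ?n = "\<lambda>c. ell_norm 2 (T_at x c)"
    have box: "(\<Sum>c\<in>{..<m} \<rightarrow>\<^sub>E {..<N}. ?n c powr q) \<le> P powr q * C" for N
    proof -
      have "(\<lambda>L. \<Sum>c\<in>{..<m} \<rightarrow>\<^sub>E {..<N}. norm_upto L (T_at x c) powr q)
          \<longlonglongrightarrow> (\<Sum>c\<in>{..<m} \<rightarrow>\<^sub>E {..<N}. ?n c powr q)"
      proof (rule tendsto_sum)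
        fix c
        have "(\<lambda>k\<in>{..<m}. x k (c k)) \<in> {..<m} \<rightarrow>\<^sub>E ell 1" using xe by auto
        from ell_norm_two_partial(2)[OF T_ell[OF this]]
        show "(\<lambda>L. norm_upto L (T_at x c) powr q) \<longlonglongrightarrow> ?n c powr q"
        proof (rule tendsto_powr'[OF _ tendsto_const])
          have "\<forall>\<^sub>F L in sequentially. 0 \<le> norm_upto L (T_at x c)"
            by (intro always_eventually allI real_sqrt_ge_zero sum_nonneg zero_le_power2)
          then show "?n c \<noteq> 0 \<or> 0 < q \<and> (\<forall>\<^sub>F L in sequentially. 0 \<le> norm_upto L (T_at x c))"
            using q by blast
        qed
      qed
      moreover have "(\<Sum>c\<in>{..<m} \<rightarrow>\<^sub>E {..<N}. norm_upto L (T_at x c) powr q) \<le> P powr q * C" for L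
      proof -
        have "norm_upto L (T_at x c) powr q
            = P powr q * norm_upto L (T_at y c) powr q" for c
        proof -
          have "(\<lambda>k\<in>{..<m}. x k (c k)) = (\<lambda>k\<in>{..<m}. \<lambda>i. of_real (w k) * y k (c k) i)"
          proof (intro restrict_ext ext)
            fix k i assume "k \<in> {..<m}"
            then show "x k (c k) i = of_real (w k) * y k (c k) i"
              using w[of k] by (simp add: y_def scaleR_conv_of_real)
          qed
          then have "T_at x c = (\<lambda>i. (\<Prod>k<m. of_real (w k)) * T_at y c i)"
            using T_scale[of "\<lambda>k. y k (c k)" "\<lambda>k. of_real (w k)"] ye by simp
          then have "(norm (T_at x c i))\<^sup>2 = P\<^sup>2 * (norm (T_at y c i))\<^sup>2" for i
            using P by (simp add: norm_mult power_mult_distrib P_def flip: of_real_prod)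
          then have "norm_upto L (T_at x c) = P * norm_upto L (T_at y c)"
            using P by (simp add: sum_distrib_left[symmetric] real_sqrt_mult)
          then show ?thesis by (simp only: powr_mult)
        qed
        then have "(\<Sum>c\<in>{..<m} \<rightarrow>\<^sub>E {..<N}. norm_upto L (T_at x c) powr q)
            = P powr q * (\<Sum>c\<in>{..<m} \<rightarrow>\<^sub>E {..<N}. norm_upto L (T_at y c) powr q)"
          by (simp only: sum_distrib_left)
        also have "\<dots> \<le> P powr q * C"
        proof (rule mult_left_mono)
          show "(\<Sum>c\<in>{..<m} \<rightarrow>\<^sub>E {..<N}. norm_upto L (T_at y c) powr q) \<le> C"
            using D[THEN spec[of _ N], THEN spec[of _ L], THEN spec[of _ y], THEN mp, OF wy] C(2)
                by linarith
        qed simp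
        finally show ?thesis .
      qed
      ultimately show ?thesis by (intro LIMSEQ_le_const2) auto
    qed
    have fin: "sum (\<lambda>c. ?n c powr q) F \<le> P powr q * C" if F: "finite F" "F \<subseteq> {..<m} \<rightarrow>\<^sub>E UNIV" for F
    proof -
      from finite_PiE_bounded[OF F] obtain N where N: "F \<subseteq> {..<m} \<rightarrow>\<^sub>E {..<N}" ..
      have "sum (\<lambda>c. ?n c powr q) F \<le> (\<Sum>c\<in>{..<m} \<rightarrow>\<^sub>E {..<N}. ?n c powr q)"
        using N by (intro sum_mono2) (auto simp: finite_PiE)
      then show ?thesis using box[of N] by linarith
    qed
    have sm: "(\<lambda>c. ?n c powr q) summable_on ({..<m} \<rightarrow>\<^sub>E UNIV)"
    proof (rule nonneg_bdd_above_summable_on)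
      show "bdd_above (sum (\<lambda>c. ?n c powr q) ` {F. F \<subseteq> {..<m} \<rightarrow>\<^sub>E UNIV \<and> finite F})"
        by (rule bdd_aboveI2[where M = "P powr q * C"]) (use fin in blast)
    qed simp
    have "(\<Sum>\<^sub>\<infinity>c\<in>{..<m} \<rightarrow>\<^sub>E UNIV. ?n c powr q) \<le> P powr q * C"
      by (rule infsum_le_finite_sums[OF sm fin])
    then have "(\<Sum>\<^sub>\<infinity>c\<in>{..<m} \<rightarrow>\<^sub>E UNIV. ?n c powr q) powr (1 / q) \<le> (P powr q * C) powr (1 / q)"
      using q by (intro powr_mono2 infsum_nonneg) auto
    also have "\<dots> = C powr (1 / q) * P" using q P by (simp add: powr_mult powr_powr)
    finally show ?thesis using sm by (simp add: P_def w_def)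
  qed
  have "(\<lambda>c. ell_norm 2 (T_at x c) powr q) summable_on ({..<m} \<rightarrow>\<^sub>E UNIV) \<and>
     (\<Sum>\<^sub>\<infinity>c\<in>{..<m} \<rightarrow>\<^sub>E UNIV. ell_norm 2 (T_at x c) powr q) powr (1 / q)
         \<le> C powr (1 / q) * (\<Prod>k<m. weak_norm p 1 (x k))"
    if x: "\<forall>k<m. x k \<in> weak_ell p 1" for x :: "nat \<Rightarrow> nat \<Rightarrow> nat \<Rightarrow> 'k"
  proof
    show "(\<lambda>c. ell_norm 2 (T_at x c) powr q) summable_on ({..<m} \<rightarrow>\<^sub>E UNIV)"
      using main[OF x zero_less_one] by (rule conjunct1)
    have "((\<lambda>\<epsilon>. C powr (1 / q) * (\<Prod>k<m. weak_norm p 1 (x k) + \<epsilon>)) \<longlongrightarrow> C powr (1 / q) * (\<Prod>k<m.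
        weak_norm p 1 (x k) + 0)) (at_right 0)"
      by (intro tendsto_mult tendsto_prod tendsto_add tendsto_const tendsto_ident_at)
    moreover have "\<forall>\<^sub>F \<epsilon> in at_right 0. (\<Sum>\<^sub>\<infinity>c\<in>{..<m} \<rightarrow>\<^sub>E UNIV. ell_norm 2 (T_at x c) powr q) powr
        (1 / q)
        \<le> C powr (1 / q) * (\<Prod>k<m. weak_norm p 1 (x k) + \<epsilon>)"
      unfolding eventually_at_right_field using main[OF x] by (intro exI[of _ 1]) simp
    ultimately show "(\<Sum>\<^sub>\<infinity>c\<in>{..<m} \<rightarrow>\<^sub>E UNIV. ell_norm 2 (T_at x c) powr q) powr (1 / q)
         \<le> C powr (1 / q) * (\<Prod>k<m. weak_norm p 1 (x k))"
      by (intro tendsto_lowerbound[where F = "at_right (0::real)"]) auto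
  qed
  moreover have "C powr (1 / q) > 0" using C by simp
  ultimately show ?thesis using T unfolding multiple_summing_ops_def by blast
qed

end

subsection \<open>The critical case\<close>

text \<open>The stability index p/(p-1) exceeds 1, so combinations with coefficients in l_(p/(p-1))
  are bounded in L_1. Dually, integration against a bounded function gives an l_p sequence. Bounded
  tests need only the first moment, hence there is no loss in the exponent.\<close>

lemma stable_weak_bound:
  fixes p :: real
  assumes p: "2 < p"
  obtains K where "K > 0" "\<And>R (n::nat) G. (\<forall>z. \<forall>e\<in>signs {..<n}. \<bar>G z e\<bar> \<le> 1) \<Longrightarrow>
    (\<Sum>j<n. \<bar>mean R {..<n} (\<lambda>z e. G z e * stab (1 - 1 / p) z e j)\<bar> powr p) \<le> K"
proof -
  define b where "b = 1 - 1 / p"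
  have b: "1 * b < 1" "1 < 2 * b" "1 / b = p / (p - 1)" "b > 0" using p by (auto simp: b_def
      field_simps)
  have r: "(0::real) < 1" "(1::real) \<le> 2" by simp_all
  obtain K where K: "K > 0" "\<And>R (I :: nat set) a. finite I \<Longrightarrow> (\<Sum>l\<in>I. \<bar>a l\<bar> powr (1 / b)) \<le> 1 \<Longrightarrow>
       mean R I (\<lambda>z e. \<bar>\<Sum>l\<in>I. a l * stab b z e l\<bar> powr 1) \<le> K"
    using stab_moment[OF r b(1,2)] by blast
  have "(\<Sum>j<n. \<bar>mean R {..<n} (\<lambda>z e. G z e * stab b z e j)\<bar> powr p) \<le> K powr p"
    if G: "\<forall>z. \<forall>e\<in>signs {..<n}. \<bar>G z e\<bar> \<le> 1" for R n and G :: "(nat \<Rightarrow> nat) \<Rightarrow> (nat \<Rightarrow> real) \<Rightarrow> real"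
  proof -
    define c where "c j = mean R {..<n} (\<lambda>z e. G z e * stab b z e j)" for j
    define S where "S = (\<Sum>j<n. \<bar>c j\<bar> powr p)"
    have "S \<le> K powr p"
    proof (cases "S = 0")
      case False
      have "S \<ge> 0" by (simp add: S_def sum_nonneg)
      then have Sp: "S > 0" using False by simp
      define a where "a j = sgn (c j) * \<bar>c j\<bar> powr (p - 1) * S powr (- b)" for j
      have ac: "a j * c j = \<bar>c j\<bar> powr p * S powr (- b)" for j
        by (cases "c j = 0") (auto simp: a_def sgn_if powr_diff)
      have absa: "\<bar>a j\<bar> powr (1 / b) = \<bar>c j\<bar> powr p / S" for j
      proof (cases "c j = 0")
        case False
        then have "\<bar>a j\<bar> = \<bar>c j\<bar> powr (p - 1) * S powr (- b)" by (simp add: a_def abs_mult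
            abs_sgn_eq)
        then have "\<bar>a j\<bar> powr (1 / b) = \<bar>c j\<bar> powr ((p - 1) * (1 / b)) * S powr (- b * (1 / b))"
          by (simp only: powr_mult powr_powr)
        also have "(p - 1) * (1 / b) = p" unfolding b(3) using p by simp
        also have "- b * (1 / b) = - 1" using b(4) by simp
        finally show ?thesis using Sp by (simp add: powr_minus_divide)
      qed (simp add: a_def)
      have "(\<Sum>j<n. \<bar>a j\<bar> powr (1 / b)) = 1"
        unfolding absa using Sp by (simp add: S_def flip: sum_divide_distrib)
      then have X: "mean R {..<n} (\<lambda>z e. \<bar>\<Sum>l<n. a l * stab b z e l\<bar> powr 1) \<le> K"
        by (intro K) auto
      have "(\<Sum>j<n. a j * c j) = mean R {..<n} (\<lambda>z e. G z e * (\<Sum>j<n. a j * stab b z e j))"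
        by (simp add: c_def sum_distrib_left mult.left_commute[of "G _ _"] smean_sum pmean_sum
            smean_cmult pmean_cmult)
      also have "\<dots> \<le> mean R {..<n} (\<lambda>z e. \<bar>\<Sum>l<n. a l * stab b z e l\<bar> powr 1)"
      proof (intro pmean_mono smean_mono)
        fix z :: "nat \<Rightarrow> nat" and e :: "nat \<Rightarrow> real"
        assume e: "e \<in> signs {..<n}"
        let ?y = "\<Sum>j<n. a j * stab b z e j"
        have "G z e * ?y \<le> \<bar>G z e\<bar> * \<bar>?y\<bar>" using abs_ge_self[of "G z e * ?y"] by (simp add:
            abs_mult)
        also have "\<dots> \<le> 1 * \<bar>?y\<bar>" using G e by (intro mult_right_mono) auto
        finally show "G z e * ?y \<le> \<bar>?y\<bar> powr 1" by simp
      qed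
      also note X
      also have "(\<Sum>j<n. a j * c j) = S * S powr (- b)" by (simp add: ac S_def sum_distrib_right)
      also have "S * S powr (- b) = S powr (1 + - b)" using Sp by (simp only: powr_add) simp
      also have "1 + - b = 1 / p" by (simp add: b_def)
      finally have "(S powr (1 / p)) powr p \<le> K powr p" using p by (intro powr_mono2) auto
      then show ?thesis using p Sp by (simp add: powr_powr)
    qed (use K in auto)
    then show ?thesis by (simp add: S_def c_def)
  qed
  note main = this
  have "K powr p > 0" using K(1) by simp
  then show ?thesis
  proof (rule that)
    fix R n and G :: "(nat \<Rightarrow> nat) \<Rightarrow> (nat \<Rightarrow> real) \<Rightarrow> real"
    assume "\<forall>z. \<forall>e\<in>signs {..<n}. \<bar>G z e\<bar> \<le> 1"
    from main[OF this, of R]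
    show "(\<Sum>j<n. \<bar>mean R {..<n} (\<lambda>z e. G z e * stab (1 - 1 / p) z e j)\<bar> powr p) \<le> K powr p"
      by (simp add: b_def)
  qed
qed

lemma pmean_pair_prod:
  "finite I \<Longrightarrow> pmean R I (\<lambda>z. pmean R I (\<lambda>z'. \<Prod>l\<in>I. h l (z l) (z' l)))
     = (\<Prod>l\<in>I. \<Sum>i\<le>R. \<Sum>i'\<le>R. pareto R i * pareto R i' * h l i i')"
  by (simp add: pmean_prod[where g = "\<lambda>l. h l (_ l)"] pmean_prod[where g = "\<lambda>l i. \<Sum>i'\<le>R. pareto R
      i' * h l i i'"]
      sum_distrib_left mult.assoc)

text \<open>
  The indicator of the event that \<open>l\<close> is the only coordinate with \<open>z l + z' l \<ge> R\<close>.
\<close>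

definition resonance :: "nat \<Rightarrow> nat \<Rightarrow> nat \<Rightarrow> (nat \<Rightarrow> nat) \<Rightarrow> (nat \<Rightarrow> nat) \<Rightarrow> real" where
  "resonance n R l z z' = (\<Prod>k<n. if k = l then of_bool (R \<le> z k + z' k) else of_bool (z k + z' k <
      R))"

definition signed_resonance :: "nat \<Rightarrow> nat \<Rightarrow> (nat \<Rightarrow> nat) \<Rightarrow> (nat \<Rightarrow> real) \<Rightarrow> (nat \<Rightarrow> nat) \<Rightarrow> (nat \<Rightarrow>
    real) \<Rightarrow> real" where
  "signed_resonance n R z e z' e' = (\<Sum>l<n. resonance n R l z z' * (e l * e' l))"

text \<open>A resonance of l0 annihilates the indicators of all other l, so the sum has at most one
  nonzero term.\<close>

lemma signed_resonance_le:
  assumes e: "e \<in> signs {..<n}" and e': "e' \<in> signs {..<n}"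
  shows "\<bar>signed_resonance n R z e z' e'\<bar> \<le> 1"
proof (cases "\<exists>l<n. R \<le> z l + z' l")
  case False
  then have "resonance n R l z z' = 0" if "l < n" for l
    using that by (auto simp: resonance_def prod_zero_iff intro!: bexI[of _ l])
  then show ?thesis by (simp add: signed_resonance_def)
next
  case True
  then obtain l0 where l0: "l0 < n" "R \<le> z l0 + z' l0" by blast
  then have r0: "resonance n R l z z' = 0" if "l \<in> {..<n} - {l0}" for l
    using that by (auto simp: resonance_def prod_zero_iff intro!: bexI[of _ l0])
  have "(\<Sum>l\<in>{..<n} - {l0}. resonance n R l z z' * (e l * e' l)) = 0"
    by (intro sum.neutral ballI) (simp only: r0 mult_zero_left)
  then have "signed_resonance n R z e z' e' = resonance n R l0 z z' * (e l0 * e' l0)"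
    unfolding signed_resonance_def using l0 by (subst sum.remove[of _ l0]) simp_all
  moreover have "\<bar>resonance n R l0 z z'\<bar> \<le> 1"
    unfolding resonance_def abs_prod by (intro prod_le_1) auto
  moreover have "\<bar>e l0\<bar> = 1" "\<bar>e' l0\<bar> = 1" using e e' l0(1) by (auto dest!: PiE_mem)
  ultimately show ?thesis by (simp add: abs_mult)
qed

text \<open>The signs of coordinate j in both samples isolate the j-th term, by orthonormality
  applied in \<open>e'\<close> and then in \<open>e\<close>.\<close>

lemma smean_signed_resonance:
  assumes j: "j < n"
  shows "smean {..<n} (\<lambda>e. e j * smean {..<n} (\<lambda>e'. e' j * signed_resonance n R z e z' e')) =
      resonance n R j z z'"
proof -
  have d: "(\<Sum>l<n. of_bool (l = j) * e l) = e j" for e :: "nat \<Rightarrow> real"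
    using j by (simp add: of_bool_def mult_delta_left)
  have "smean {..<n} (\<lambda>e'. e' j * signed_resonance n R z e z' e') = resonance n R j z z' * e j"
      for e
  proof -
    have "smean {..<n} (\<lambda>e'. e' j * signed_resonance n R z e z' e')
        = smean {..<n} (\<lambda>e'. (\<Sum>l<n. of_bool (l = j) * e' l) * (\<Sum>l<n. (resonance n R l z z' * e l)
            * e' l))"
      unfolding d signed_resonance_def by (simp add: mult.assoc)
    also have "\<dots> = (\<Sum>l<n. of_bool (l = j) * (resonance n R l z z' * e l))" by (rule smean_inner)
        simp
    also have "\<dots> = resonance n R j z z' * e j" using j by (simp add: of_bool_def mult_delta_left)
    finally show ?thesis .
  qed
  then have "smean {..<n} (\<lambda>e. e j * smean {..<n} (\<lambda>e'. e' j * signed_resonance n R z e z' e'))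
      = smean {..<n} (\<lambda>e. resonance n R j z z' * ((\<Sum>l<n. of_bool (l = j) * e l) * (\<Sum>l<n. of_bool
          (l = j) * e l)))"
    unfolding d by (simp add: mult_ac)
  also have "\<dots> = resonance n R j z z' * (\<Sum>l<n. of_bool (l = j) * of_bool (l = j))"
    unfolding smean_cmult by (subst smean_inner) auto
  also have "\<dots> = resonance n R j z z'" using j by (simp add: of_bool_def mult_delta_left)
  finally show ?thesis .
qed

text \<open>The R + 1 pairs (i, R - i) each have probability at least 2^(-R-2) and carry the same
  value 2^(b R); their number is the source of the divergence. All other coordinates avoid resonance
  with probability at least 1/2, by Weierstrass' product inequality and the hypothesis on n.\<close>

lemma resonance_value:
  fixes b :: real
  assumes n: "real n * (real R + 1) / 2 ^ R \<le> 1 / 2" and j: "j < n"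
  shows "(real R + 1) / (8 * 2 ^ R) * 2 powr (b * real R)
    \<le> pmean R {..<n} (\<lambda>z. pmean R {..<n} (\<lambda>z'. 2 powr (b * real (z j)) * 2 powr (b * real (z' j))
        * resonance n R j z z'))"
proof -
  define h where "h l i i' = (if l = j then 2 powr (b * real i) * 2 powr (b * real i') * of_bool
      (R \<le> i + i') else of_bool (i + i' < R))" for l i i'
  have "2 powr (b * real (z j)) * 2 powr (b * real (z' j)) * resonance n R j z z' = (\<Prod>l<n. h l (z
      l) (z' l))" for z z'
  proof -
    have "resonance n R j z z' = of_bool (R \<le> z j + z' j) * (\<Prod>k\<in>{..<n} - {j}. of_bool (z k + z' k
        < R))"
      unfolding resonance_def using j by (subst prod.remove[of _ j]) auto
    moreover have "(\<Prod>l<n. h l (z l) (z' l)) = h j (z j) (z' j) * (\<Prod>k\<in>{..<n} - {j}. of_bool (z k +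
        z' k < R))"
      using j by (subst prod.remove[of _ j]) (auto simp: h_def)
    ultimately show ?thesis by (simp add: h_def)
  qed
  then have "pmean R {..<n} (\<lambda>z. pmean R {..<n} (\<lambda>z'. 2 powr (b * real (z j)) * 2 powr (b * real
      (z' j)) * resonance n R j z z'))
      = (\<Prod>l<n. \<Sum>i\<le>R. \<Sum>i'\<le>R. pareto R i * pareto R i' * h l i i')"
    by (simp add: pmean_pair_prod)
  also have "\<dots> = (\<Sum>i\<le>R. \<Sum>i'\<le>R. pareto R i * pareto R i' * h j i i')
      * (\<Prod>l\<in>{..<n} - {j}. \<Sum>i\<le>R. \<Sum>i'\<le>R. pareto R i * pareto R i' * h l i i')"
    using j by (subst prod.remove[of _ j]) auto
  finally have eq: "pmean R {..<n} (\<lambda>z. pmean R {..<n} (\<lambda>z'. 2 powr (b * real (z j)) * 2 powr (b *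
      real (z' j)) * resonance n R j z z')) = \<dots>" .
  have A: "(real R + 1) / (4 * 2 ^ R) * 2 powr (b * real R) \<le> (\<Sum>i\<le>R. \<Sum>i'\<le>R. pareto R i * pareto R
      i' * h j i i')"
  proof -
    have "(real R + 1) / (4 * 2 ^ R) * 2 powr (b * real R) = (\<Sum>i\<le>R. 1 / (4 * 2 ^ R) * 2 powr (b *
        real R))" by simp
    also have "\<dots> \<le> (\<Sum>i\<le>R. \<Sum>i'\<le>R. pareto R i * pareto R i' * h j i i')"
    proof (rule sum_mono)
      fix i assume i: "i \<in> {..R}"
      have "1 / (4 * 2 ^ R) = (1 / 2 ^ Suc i) * (1 / 2 ^ Suc (R - i) :: real)"
        using i by (simp flip: power_add)
      also have "\<dots> \<le> pareto R i * pareto R (R - i)"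
        by (intro mult_mono pareto_ge) (auto intro: less_imp_le[OF pareto_pos])
      finally have "1 / (4 * 2 ^ R) * 2 powr (b * real R) \<le> pareto R i * pareto R (R - i) * 2 powr
          (b * real R)"
        by (intro mult_right_mono) auto
      moreover have "2 powr (b * real R) = h j i (R - i)"
        using i by (simp add: h_def powr_add[symmetric] distrib_left[symmetric] of_nat_diff)
      ultimately have "1 / (4 * 2 ^ R) * 2 powr (b * real R) \<le> pareto R i * pareto R (R - i) * h j
          i (R - i)" by metis
      also have "pareto R i * pareto R (R - i) * h j i (R - i) \<le> (\<Sum>i'\<le>R. pareto R i * pareto R i'
          * h j i i')"
        by (rule member_le_sum) (auto simp: h_def intro!: mult_nonneg_nonneg less_imp_le[OF
            pareto_pos])
      finally show "1 / (4 * 2 ^ R) * 2 powr (b * real R) \<le> (\<Sum>i'\<le>R. pareto R i * pareto R i' * h j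
          i i')" .
    qed
    finally show ?thesis .
  qed
  have B1: "1 - (real R + 1) / 2 ^ R \<le> (\<Sum>i\<le>R. \<Sum>i'\<le>R. pareto R i * pareto R i' * h l i i')" if "l \<noteq>
      j" for l
  proof -
    have "1 = (\<Sum>i\<le>R. \<Sum>i'\<le>R. pareto R i * pareto R i')" by (simp add: pareto_sum flip:
        sum_distrib_left)
    also have "\<dots> = (\<Sum>i\<le>R. \<Sum>i'\<le>R. pareto R i * pareto R i' * h l i i' + pareto R i * (pareto R i' *
        of_bool (R \<le> i + i')))"
      using that by (intro sum.cong refl) (auto simp: h_def)
    also have "\<dots> = (\<Sum>i\<le>R. \<Sum>i'\<le>R. pareto R i * pareto R i' * h l i i') + (\<Sum>i\<le>R. pareto R i *
        (\<Sum>i'\<le>R. pareto R i' * of_bool (R \<le> i + i')))"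
      by (simp only: sum.distrib sum_distrib_left)
    also have "(\<Sum>i\<le>R. pareto R i * (\<Sum>i'\<le>R. pareto R i' * of_bool (R \<le> i + i'))) \<le> (\<Sum>i\<le>R. 1 / 2 ^ R)"
    proof (rule sum_mono)
      fix i assume i: "i \<in> {..R}"
      have "(\<Sum>i'\<le>R. pareto R i' * of_bool (R \<le> i + i')) = (\<Sum>i'\<in>{R - i..R}. pareto R i')"
        by (intro sum.mono_neutral_cong_right) auto
      also have "\<dots> = 1 / 2 ^ (R - i)" by (rule pareto_tail) simp
      finally have "pareto R i * (\<Sum>i'\<le>R. pareto R i' * of_bool (R \<le> i + i')) \<le> 1 / 2 ^ i * (1 / 2
          ^ (R - i))"
        using pareto_le[of R i] by (simp only: mult_right_mono zero_le_divide_1_iff zero_le_power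
            zero_le_numeral)
      also have "\<dots> = 1 / 2 ^ R" using i by (simp flip: power_add)
      finally show "pareto R i * (\<Sum>i'\<le>R. pareto R i' * of_bool (R \<le> i + i')) \<le> 1 / 2 ^ R" .
    qed
    finally show ?thesis by (simp add: add.commute)
  qed
  have u: "(real R + 1) / 2 ^ R \<in> {0..1}"
  proof -
    have "(real R + 1) / 2 ^ R \<le> real n * (real R + 1) / 2 ^ R"
      using j by (intro divide_right_mono) auto
    with n have "(real R + 1) / 2 ^ R \<le> 1 / 2" by (rule order.trans[rotated])
    moreover have "0 \<le> (real R + 1) / 2 ^ R" by simp
    ultimately show ?thesis unfolding atLeastAtMost_iff by linarith
  qed
  have "1 / 2 \<le> 1 - real (card ({..<n} - {j})) * ((real R + 1) / 2 ^ R)"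
  proof -
    have "real (card ({..<n} - {j})) * ((real R + 1) / 2 ^ R) \<le> real n * ((real R + 1) / 2 ^ R)"
      using u by (intro mult_right_mono) (auto simp: card_Diff_singleton_if)
    moreover have "real n * ((real R + 1) / 2 ^ R) \<le> 1 / 2" using n unfolding
        times_divide_eq_right .
    ultimately show ?thesis by linarith
  qed
  also have "\<dots> = 1 - (\<Sum>l\<in>{..<n} - {j}. (real R + 1) / 2 ^ R)" by (simp only: sum_constant)
  also have "\<dots> \<le> (\<Prod>l\<in>{..<n} - {j}. 1 - (real R + 1) / 2 ^ R)"
    by (rule Weierstrass_prod_ineq) (rule u)
  also have "\<dots> \<le> (\<Prod>l\<in>{..<n} - {j}. \<Sum>i\<le>R. \<Sum>i'\<le>R. pareto R i * pareto R i' * h l i i')"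
    using B1 u by (intro prod_mono) auto
  finally have B: "1 / 2 \<le> (\<Prod>l\<in>{..<n} - {j}. \<Sum>i\<le>R. \<Sum>i'\<le>R. pareto R i * pareto R i' * h l i i')" .
  have "(real R + 1) / (8 * 2 ^ R) * 2 powr (b * real R) = (real R + 1) / (4 * 2 ^ R) * 2 powr (b
      * real R) * (1 / 2)" by simp
  also have "\<dots> \<le> (\<Sum>i\<le>R. \<Sum>i'\<le>R. pareto R i * pareto R i' * h j i i')
      * (\<Prod>l\<in>{..<n} - {j}. \<Sum>i\<le>R. \<Sum>i'\<le>R. pareto R i * pareto R i' * h l i i')"
    by (intro mult_mono A B order.trans[OF _ A]) auto
  finally show ?thesis unfolding eq .
qed

text \<open>L_1 of the finite probability space of pairs (z, e) is realised as l_1 on U points,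
  \<open>x j\<close> being the j-th stable variable times the weights and \<open>S\<close> the
  signed resonance. Each of the n terms is at least ((R+1)/8)^p 2^(-R), and n is of the order
  2^R/(R+1), so the sum is at least of the order (R+1)^(p-1).\<close>

lemma scalar_finite_example:
  fixes p M :: real
  assumes p: "2 < p"
  shows "\<exists>K>0. \<forall>M. \<exists>n U (S :: nat \<Rightarrow> nat \<Rightarrow> real) x. (\<forall>u<U. \<forall>v<U. \<bar>S u v\<bar> \<le> 1) \<and>
     wkf p K {..<n::nat} {..<U} x \<and> M \<le> (\<Sum>j<n. \<bar>\<Sum>u<U. \<Sum>v<U. x j u * x j v * S u v\<bar> powr p)"
proof -
  define b where "b = 1 - 1 / p"
  obtain K where K: "K > 0" "\<And>R (n::nat) G. (\<forall>z. \<forall>e\<in>signs {..<n}. \<bar>G z e\<bar> \<le> 1) \<Longrightarrow>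
    (\<Sum>j<n. \<bar>mean R {..<n} (\<lambda>z e. G z e * stab b z e j)\<bar> powr p) \<le> K"
    using stable_weak_bound[OF p] unfolding b_def by blast
  have "\<exists>n U (S :: nat \<Rightarrow> nat \<Rightarrow> real) x. (\<forall>u<U. \<forall>v<U. \<bar>S u v\<bar> \<le> 1) \<and>
     wkf p K {..<n::nat} {..<U} x \<and> M \<le> (\<Sum>j<n. \<bar>\<Sum>u<U. \<Sum>v<U. x j u * x j v * S u v\<bar> powr p)" for M
  proof -
    have "\<exists>t. M * (2 * 8 powr p) < (2 powr (p - 1)) ^ t"
      using p by (intro real_arch_pow) simp
    then obtain t0 where t0: "M * (2 * 8 powr p) < (2 powr (p - 1)) ^ t0" ..
    \<comment> \<open>t \<ge> 2 guarantees t + 1 \<le> R for R = 2^t - 1, so that R - t - 1 is a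
      true difference. R + 1 is a power of 2 in order that n (R+1) / 2^R equals 1/2 exactly.\<close>
    define t where "t = max t0 2"
    have "(2 powr (p - 1)) ^ t0 \<le> (2 powr (p - 1)) ^ t"
      using p by (intro power_increasing) (auto simp: t_def ge_one_powr_ge_zero)
    with t0 have Mt: "M * (2 * 8 powr p) \<le> (2 powr (p - 1)) ^ t" by linarith
    define R :: nat where "R = 2 ^ t - 1"
    have R1: "real R + 1 = 2 ^ t" by (simp add: R_def of_nat_diff)
    have tR: "t + 1 \<le> R"
    proof -
      have "2 \<le> s \<Longrightarrow> s + 2 \<le> 2 ^ s" for s :: nat
        by (induction s rule: dec_induct) auto
      from this[of t] show ?thesis by (simp add: R_def t_def)
    qed
    \<comment> \<open>\<open>P(z l + z' l \<ge> R) \<le> (R + 1) / 2\<^sup>R\<close>, so that with this \<open>n\<close> no coordinate resonates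
      with probability at least 1/2.\<close>
    define n :: nat where "n = 2 ^ (R - t - 1)"
    have n: "real n * (real R + 1) / 2 ^ R = 1 / 2"
    proof -
      have "real n * (real R + 1) * 2 = 2 ^ ((R - t - 1) + t + 1)" by (simp add: R1 n_def power_add)
      also have "(R - t - 1) + t + 1 = R" using tR by simp
      finally show ?thesis by simp
    qed
    define \<Omega> where "\<Omega> = ({..<n} \<rightarrow>\<^sub>E {..R}) \<times> (signs {..<n})"
    have fin: "finite \<Omega>" by (simp add: \<Omega>_def finite_PiE)
    define W where "W w = (\<Prod>l<n. pareto R (fst w l)) / 2 ^ n" for w :: "(nat \<Rightarrow> nat) \<times> (nat \<Rightarrow> real)"
    have EW: "(\<Sum>w\<in>\<Omega>. W w * F (fst w) (snd w)) = mean R {..<n} (\<lambda>z e. F z e)" for F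
    proof -
      have "(\<Sum>w\<in>\<Omega>. W w * F (fst w) (snd w)) = (\<Sum>z\<in>{..<n} \<rightarrow>\<^sub>E {..R}. \<Sum>e\<in>signs {..<n}. W (z, e) * F
          z e)"
        unfolding \<Omega>_def by (simp add: sum.cartesian_product case_prod_unfold)
      also have "\<dots> = mean R {..<n} (\<lambda>z e. F z e)"
        by (simp add: W_def pmean_def smean_def sum_distrib_left sum_divide_distrib)
      finally show ?thesis .
    qed
    obtain h where h: "bij_betw h {..<card \<Omega>} \<Omega>"
      using fin ex_bij_betw_nat_finite lessThan_atLeast0 by metis
    let ?U = "card \<Omega>"
    have re: "(\<Sum>u<?U. F (h u)) = (\<Sum>w\<in>\<Omega>. F w)" for F :: "_ \<Rightarrow> real"
      by (rule sum.reindex_bij_betw[OF h])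
    have hU: "h u \<in> \<Omega>" if "u < ?U" for u using h that by (auto simp: bij_betw_def)
    define S where "S u v = signed_resonance n R (fst (h u)) (snd (h u)) (fst (h v)) (snd (h v))"
        for u v
    define x where "x j u = W (h u) * stab b (fst (h u)) (snd (h u)) j" for j u
    have S: "\<forall>u<?U. \<forall>v<?U. \<bar>S u v\<bar> \<le> 1"
      unfolding S_def using hU by (intro allI impI signed_resonance_le) (auto simp: \<Omega>_def
          mem_Times_iff)
    have xw: "wkf p K {..<n} {..<?U} x"
      unfolding wkf_def
    proof (intro allI impI)
      fix \<phi> :: "nat \<Rightarrow> real" assume phi: "\<forall>a\<in>{..<?U}. \<bar>\<phi> a\<bar> \<le> 1"
      define g where "g = the_inv_into {..<?U} h"
      have gh: "g (h u) = u" if "u < ?U" for u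
        unfolding g_def using h that by (intro the_inv_into_f_f) (auto simp: bij_betw_def)
      \<comment> \<open>The test \<phi> on numbers becomes a function of the sample; it is 0 off
        \<Omega> because the bound 1 is required for every \<open>z\<close>.\<close>
      define G where "G z e = (if (z, e) \<in> \<Omega> then \<phi> (g (z, e)) else 0)" for z e
      have G: "\<bar>G z e\<bar> \<le> 1" for z e
      proof (cases "(z, e) \<in> \<Omega>")
        case True
        then have "(z, e) \<in> h ` {..<?U}" using h by (simp add: bij_betw_def)
        then obtain u where "(z, e) = h u" "u \<in> {..<?U}" ..
        then have "u < ?U" "h u = (z, e)" by simp_all
        then show ?thesis using gh[of u] phi by (simp add: G_def)
      qed (simp add: G_def)
      have "(\<Sum>u<?U. x j u * \<phi> u) = mean R {..<n} (\<lambda>z e. G z e * stab b z e j)" for j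
      proof -
        have "(\<Sum>u<?U. x j u * \<phi> u) = (\<Sum>u<?U. W (h u) * (G (fst (h u)) (snd (h u)) * stab b (fst (h
            u)) (snd (h u)) j))"
          using hU gh by (intro sum.cong refl) (simp add: x_def G_def)
        also have "\<dots> = (\<Sum>w\<in>\<Omega>. W w * (G (fst w) (snd w) * stab b (fst w) (snd w) j))" by (rule re)
        also have "\<dots> = mean R {..<n} (\<lambda>z e. G z e * stab b z e j)" by (rule EW)
        finally show ?thesis .
      qed
      then show "(\<Sum>j<n. \<bar>\<Sum>u<?U. x j u * \<phi> u\<bar> powr p) \<le> K" using K(2)[of n G R] G by simp
    qed
    have val: "(real R + 1) / (8 * 2 ^ R) * 2 powr (b * real R) \<le> (\<Sum>u<?U. \<Sum>v<?U. x j u * x j v * S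
        u v)"
      if j: "j < n" for j
    proof -
      let ?sr = "\<lambda>w w'. signed_resonance n R (fst w) (snd w) (fst w') (snd w')"
      have "(\<Sum>u<?U. \<Sum>v<?U. x j u * x j v * S u v)
          = (\<Sum>u<?U. W (h u) * (stab b (fst (h u)) (snd (h u)) j *
              (\<Sum>v<?U. W (h v) * (stab b (fst (h v)) (snd (h v)) j * ?sr (h u) (h v)))))"
        by (simp only: x_def S_def sum_distrib_left mult_ac)
      also have "\<dots> = (\<Sum>w\<in>\<Omega>. W w * (stab b (fst w) (snd w) j * (\<Sum>w'\<in>\<Omega>. W w' * (stab b (fst w') (snd
          w') j * ?sr w w'))))"
        unfolding re[of "\<lambda>w'. W w' * (stab b (fst w') (snd w') j * ?sr (h _) w')"] by (rule re)
      also have "\<dots> = mean R {..<n} (\<lambda>z e. stab b z e j * mean R {..<n} (\<lambda>z' e'. stab b z' e' j *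
          signed_resonance n R z e z' e'))"
        by (simp only: EW[of "\<lambda>z' e'. stab b z' e' j * signed_resonance n R _ _ z' e'"]
             EW[of "\<lambda>z e. stab b z e j * mean R {..<n} (\<lambda>z' e'. stab b z' e' j * signed_resonance
                 n R z e z' e')"])
      also have "\<dots> = pmean R {..<n} (\<lambda>z. pmean R {..<n} (\<lambda>z'. 2 powr (b * real (z j)) * 2 powr (b
          * real (z' j)) * resonance n R j z z'))"
      proof (intro arg_cong[where f = "pmean R {..<n}"] ext)
        fix z
        have "smean {..<n} (\<lambda>e. stab b z e j * mean R {..<n} (\<lambda>z' e'. stab b z' e' j *
            signed_resonance n R z e z' e'))
            = mean R {..<n} (\<lambda>z' e. stab b z e j * smean {..<n} (\<lambda>e'. stab b z' e' j *
                signed_resonance n R z e z' e'))"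
          unfolding pmean_cmult[symmetric] unfolding smean_def pmean_def sum_divide_distrib
              sum_distrib_left
          by (subst sum.swap) (simp add: sum_distrib_left mult_ac)
        also have "\<dots> = pmean R {..<n} (\<lambda>z'. 2 powr (b * real (z j)) * 2 powr (b * real (z' j)) *
            resonance n R j z z')"
        proof (intro arg_cong[where f = "pmean R {..<n}"] ext)
          fix z'
          have "smean {..<n} (\<lambda>e. stab b z e j * smean {..<n} (\<lambda>e'. stab b z' e' j *
              signed_resonance n R z e z' e'))
              = smean {..<n} (\<lambda>e. 2 powr (b * real (z j)) * (2 powr (b * real (z' j)) * (e j *
                  smean {..<n} (\<lambda>e'. e' j * signed_resonance n R z e z' e'))))"
            unfolding stab_def smean_cmult[symmetric] by (simp add: mult_ac)
          then show "smean {..<n} (\<lambda>e. stab b z e j * smean {..<n} (\<lambda>e'. stab b z' e' j *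
              signed_resonance n R z e z' e'))
              = 2 powr (b * real (z j)) * 2 powr (b * real (z' j)) * resonance n R j z z'"
            by (simp only: smean_cmult smean_signed_resonance[OF j] mult.assoc)
        qed
        finally show "smean {..<n} (\<lambda>e. stab b z e j * mean R {..<n} (\<lambda>z' e'. stab b z' e' j *
            signed_resonance n R z e z' e'))
            = pmean R {..<n} (\<lambda>z'. 2 powr (b * real (z j)) * 2 powr (b * real (z' j)) * resonance
                n R j z z')" .
      qed
      finally show ?thesis using resonance_value[of n R j b] n j by simp
    qed
    \<comment> \<open>Here b R - R = - R/p, so the p-th power supplies 2^(-R), which n (R+1) =
      2^(R-1) cancels up to 1/2; what remains is R + 1 = 2^t to the power p - 1.\<close>
    have "M \<le> (2 powr (p - 1)) ^ t / (2 * 8 powr p)" using Mt by (simp add: field_simps)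
    also have "\<dots> = real n * ((real R + 1) / (8 * 2 ^ R) * 2 powr (b * real R)) powr p"
    proof -
      have "(real R + 1) / (8 * 2 ^ R) * 2 powr (b * real R) = (real R + 1) / 8 * 2 powr (- real R
          / p)"
        by (simp add: b_def powr_realpow[symmetric] powr_diff left_diff_distrib powr_minus_divide)
      then have "((real R + 1) / (8 * 2 ^ R) * 2 powr (b * real R)) powr p = ((real R + 1) / 8)
          powr p * 2 powr (- real R / p * p)"
        by (simp only: powr_mult powr_powr)
      also have "2 powr (- real R / p * p) = 1 / 2 ^ R" using p by (simp add: powr_minus_divide
          powr_realpow)
      also have "((real R + 1) / 8) powr p = (real R + 1) powr (p - 1) * (real R + 1) / 8 powr p"
        by (simp add: powr_divide powr_diff)
      also have "real n * ((real R + 1) powr (p - 1) * (real R + 1) / 8 powr p * (1 / 2 ^ R))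
          = (real R + 1) powr (p - 1) / 8 powr p * (real n * (real R + 1) / 2 ^ R)" by simp
      also have "\<dots> = (real R + 1) powr (p - 1) / (2 * 8 powr p)" unfolding n by simp
      also have "(real R + 1) powr (p - 1) = (2 powr (p - 1)) ^ t"
        unfolding R1 by (simp add: powr_realpow[symmetric] powr_powr mult.commute)
      finally show ?thesis ..
    qed
    also have "\<dots> = (\<Sum>j<n. ((real R + 1) / (8 * 2 ^ R) * 2 powr (b * real R)) powr p)" by simp
    also have "\<dots> \<le> (\<Sum>j<n. \<bar>\<Sum>u<?U. \<Sum>v<?U. x j u * x j v * S u v\<bar> powr p)"
    proof (intro sum_mono powr_mono2)
      fix j assume "j \<in> {..<n}"
      then show "(real R + 1) / (8 * 2 ^ R) * 2 powr (b * real R) \<le> \<bar>\<Sum>u<?U. \<Sum>v<?U. x j u * x j v *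
          S u v\<bar>"
        using val[of j] by simp
    qed (use p in auto)
    finally have "M \<le> (\<Sum>j<n. \<bar>\<Sum>u<?U. \<Sum>v<?U. x j u * x j v * S u v\<bar> powr p)" .
    then show ?thesis using S xw by blast
  qed
  then show ?thesis using K(1) by blast
qed

section \<open>Forms with bounded kernels on l_1, and finitely supported weakly summable
  sequences\<close>

definition pairing :: "(nat \<Rightarrow> 'k::{real_normed_field,banach}) \<Rightarrow> (nat \<Rightarrow> 'k) \<Rightarrow> 'k" where
  "pairing f h = (\<Sum>u. f u * h u)"

lemma pairing_summable:
  fixes f :: "nat \<Rightarrow> 'k::{real_normed_field,banach}"
  assumes "f \<in> ell 1" "\<And>u. norm (h u) \<le> B"
  shows "summable (\<lambda>u. norm (f u * h u))" "summable (\<lambda>u. f u * h u)"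
proof -
  show "summable (\<lambda>u. norm (f u * h u))"
    using assms unfolding ell_one_iff by (rule summable_norm_mult_bounded)
  then show "summable (\<lambda>u. f u * h u)" by (rule summable_norm_cancel)
qed

lemma pairing_norm_le:
  assumes "f \<in> ell 1" "\<And>u. norm (h u) \<le> B"
  shows "norm (pairing f h) \<le> ell_norm 1 f * B"
proof -
  have "norm (pairing f h) \<le> (\<Sum>u. norm (f u * h u))"
    unfolding pairing_def by (rule summable_norm[OF pairing_summable(1)[OF assms]])
  also have "\<dots> \<le> (\<Sum>u. norm (f u) * B)"
  proof (rule suminf_le[OF _ pairing_summable(1)[OF assms]])
    show "norm (f u * h u) \<le> norm (f u) * B" for u
      using assms(2)[of u] by (simp add: norm_mult mult_left_mono)
    show "summable (\<lambda>u. norm (f u) * B)" using assms(1) unfolding ell_one_iff by (rule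
        summable_mult2)
  qed
  also have "\<dots> = ell_norm 1 f * B"
    using assms(1) by (simp add: ell_norm_one ell_one_iff suminf_mult2)
  finally show ?thesis .
qed

lemma pairing_linear_left:
  assumes "f \<in> ell 1" "g \<in> ell 1" "\<And>u. norm (h u) \<le> B"
  shows "pairing (\<lambda>i. a * f i + b * g i) h = a * pairing f h + b * pairing g h"
proof -
  have "(\<lambda>u. a * (f u * h u) + b * (g u * h u)) sums (a * pairing f h + b * pairing g h)"
    unfolding pairing_def
    by (intro sums_add sums_mult summable_sums pairing_summable(2)[OF assms(1,3)]
        pairing_summable(2)[OF assms(2,3)])
  moreover have "(\<lambda>u. a * (f u * h u) + b * (g u * h u)) = (\<lambda>u. (a * f u + b * g u) * h u)"
    by (intro ext) (simp add: algebra_simps)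
  ultimately show ?thesis unfolding pairing_def by (simp add: sums_iff)
qed

lemma pairing_linear_right:
  assumes "f \<in> ell 1" "\<And>u. norm (h u) \<le> B" "\<And>u. norm (h' u) \<le> B'"
  shows "pairing f (\<lambda>u. a * h u + b * h' u) = a * pairing f h + b * pairing f h'"
proof -
  have "(\<lambda>u. a * (f u * h u) + b * (f u * h' u)) sums (a * pairing f h + b * pairing f h')"
    unfolding pairing_def
    by (intro sums_add sums_mult summable_sums pairing_summable(2)[OF assms(1,2)]
        pairing_summable(2)[OF assms(1,3)])
  moreover have "(\<lambda>u. a * (f u * h u) + b * (f u * h' u)) = (\<lambda>u. f u * (a * h u + b * h' u))"
    by (intro ext) (simp add: algebra_simps)
  ultimately show ?thesis unfolding pairing_def by (simp add: sums_iff)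
qed

lemma pairing_comb:
  fixes n :: nat
  shows "pairing (\<lambda>u. \<Sum>a<n. c a * unit_seq (h a) u) H = (\<Sum>a<n. c a * H (h a))"
proof -
  have "(\<lambda>u. unit_seq w u * H u) sums H w" for w
  proof -
    have "(\<lambda>u. unit_seq w u * H u) = (\<lambda>u. if u = w then H u else 0)" by (auto simp: unit_seq_def)
    then show ?thesis using sums_single[of w H] by simp
  qed
  then have "(\<lambda>u. \<Sum>a<n. c a * (unit_seq (h a) u * H u)) sums (\<Sum>a<n. c a * H (h a))"
    by (intro sums_sum sums_mult)
  then show ?thesis unfolding pairing_def by (simp add: sums_iff sum_distrib_right mult.assoc)
qed

lemma ell_one_zero: "(\<lambda>_. 0) \<in> ell 1"
  by (simp add: ell_one_iff)

lemma ell_one_comb: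
  fixes n :: nat
  shows "(\<lambda>u. \<Sum>a<n. c a * unit_seq (h a) u) \<in> (ell 1 :: (nat \<Rightarrow> 'k::real_normed_field) set)"
proof (induction n)
  case (Suc n)
  from ell_one_lincomb[OF Suc unit_seq_ell, of 1 "c n" "h n"] show ?case by simp
qed (simp add: ell_one_zero)

lemma dual_unit_ballD:
  assumes "f \<in> dual_unit_ball r"
  shows "\<lbrakk>x \<in> ell r; y \<in> ell r\<rbrakk> \<Longrightarrow> f (\<lambda>i. a * x i + b * y i) = a * f x + b * f y"
    "x \<in> ell r \<Longrightarrow> norm (f x) \<le> ell_norm r x"
  using assms by (simp_all add: dual_unit_ball_def)

lemma dual_unit_ball_zero:
  fixes f :: "(nat \<Rightarrow> 'k::{real_normed_field,banach}) \<Rightarrow> 'k"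
  assumes "f \<in> dual_unit_ball 1"
  shows "f (\<lambda>_. 0) = 0"
proof -
  have "f (\<lambda>i. 0 * 0 + 0 * 0) = 0 * f (\<lambda>_. 0) + 0 * f (\<lambda>_. 0)"
    by (rule dual_unit_ballD(1)[OF assms ell_one_zero ell_one_zero])
  then show ?thesis by simp
qed

lemma dual_unit_ball_comb:
  fixes f :: "(nat \<Rightarrow> 'k::{real_normed_field,banach}) \<Rightarrow> 'k" and n :: nat
  assumes f: "f \<in> dual_unit_ball 1"
  shows "f (\<lambda>u. \<Sum>a<n. c a * unit_seq (h a) u) = (\<Sum>a<n. c a * f (unit_seq (h a)))"
proof (induction n)
  case 0
  then show ?case using dual_unit_ball_zero[OF f] by simp
next
  case (Suc n)
  have "f (\<lambda>u. 1 * (\<Sum>a<n. c a * unit_seq (h a) u) + c n * unit_seq (h n) u)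
      = 1 * f (\<lambda>u. \<Sum>a<n. c a * unit_seq (h a) u) + c n * f (unit_seq (h n))"
    by (rule dual_unit_ballD(1)[OF f ell_one_comb unit_seq_ell])
  then show ?case using Suc by simp
qed

lemma dual_unit_ball_unit_seq:
  fixes f :: "(nat \<Rightarrow> 'k::{real_normed_field,banach}) \<Rightarrow> 'k"
  assumes "f \<in> dual_unit_ball 1"
  shows "norm (f (unit_seq a)) \<le> 1"
proof -
  have "norm (f (unit_seq a)) \<le> ell_norm 1 (unit_seq a :: nat \<Rightarrow> 'k)"
    by (rule dual_unit_ballD(2)[OF assms unit_seq_ell])
  then show ?thesis by (simp add: ell_norm_unit_seq)
qed

lemma weak_ellI:
  fixes x :: "nat \<Rightarrow> nat \<Rightarrow> 'k::{real_normed_field,banach}"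
  assumes x: "\<And>j. x j \<in> ell 1" "\<And>j. j \<ge> n \<Longrightarrow> x j = (\<lambda>_. 0)" and p: "p > 0"
    and b: "\<And>f. f \<in> dual_unit_ball 1 \<Longrightarrow> (\<Sum>j<n. norm (f (x j)) powr p) \<le> B"
  shows "x \<in> weak_ell p 1" "weak_norm p 1 x \<le> B powr (1 / p)"
proof -
  have z: "norm (f (x j)) powr p = 0" if "f \<in> dual_unit_ball 1" "j \<ge> n" for f j
    using x(2)[OF that(2)] dual_unit_ball_zero[OF that(1)] by simp
  have s: "summable (\<lambda>j. norm (f (x j)) powr p)" if "f \<in> dual_unit_ball 1" for f
    using z[OF that] by (intro summable_finite[of "{..<n}"]) auto
  have "(\<Sum>j. norm (f (x j)) powr p) = (\<Sum>j<n. norm (f (x j)) powr p)" if "f \<in> dual_unit_ball 1" for f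
    using z[OF that] by (intro suminf_finite) auto
  then have le: "(\<Sum>j. norm (f (x j)) powr p) powr (1 / p) \<le> B powr (1 / p)" if "f \<in> dual_unit_ball
      1" for f
    using b[OF that] that p by (intro powr_mono2) (auto intro: sum_nonneg)
  show "x \<in> weak_ell p 1"
    unfolding weak_ell_def
  proof (intro CollectI conjI allI ballI)
    show "bdd_above ((\<lambda>f. (\<Sum>j. norm (f (x j)) powr p) powr (1 / p)) ` dual_unit_ball 1)"
      by (rule bdd_aboveI2) (rule le)
  qed (use x s in auto)
  have "(\<lambda>y\<in>ell 1. \<Sum>a. 0 *\<^sub>R y a) \<in> (dual_unit_ball 1 :: ((nat \<Rightarrow> 'k) \<Rightarrow> 'k) set)"
    by (rule weighted_sum_dual) simp
  then show "weak_norm p 1 x \<le> B powr (1 / p)"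
    unfolding weak_norm_def by (intro cSUP_least le) auto
qed

text \<open>A functional in the dual ball enters only through its values at unit vectors, which have
  modulus at most 1. Their real and imaginary parts are real tests, each contributing at most K; the
  factor 2 powr p comes from adding the two parts.\<close>

lemma (in scalar_parts) weak_ell_comb:
  fixes c :: "nat \<Rightarrow> nat \<Rightarrow> real"
  assumes w: "wkf p K {..<n} {..<U} c" and p: "p > 0"
    and x: "x = (\<lambda>j u. \<Sum>a<U. of_real (if j < n then c j a else 0) * (unit_seq (h a) u :: 'k))"
  shows "x \<in> weak_ell p 1" "weak_norm p 1 x \<le> (2 powr p * (2 * K)) powr (1 / p)"
proof -
  have xe: "x j \<in> ell 1" for j unfolding x by (rule ell_one_comb)
  have x0: "x j = (\<lambda>_. 0)" if "j \<ge> n" for j using that by (simp add: x)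
  have b: "(\<Sum>j<n. norm (f (x j)) powr p) \<le> 2 powr p * (2 * K)" if f: "f \<in> dual_unit_ball 1" for f
  proof -
    define \<psi> where "\<psi> a = f (unit_seq (h a))" for a
    have psi: "norm (\<psi> a) \<le> 1" for a unfolding \<psi>_def by (rule dual_unit_ball_unit_seq[OF f])
    have t: "norm (f (x j)) powr p \<le> 2 powr p * (\<bar>\<Sum>a<U. c j a * re (\<psi> a)\<bar> powr p + \<bar>\<Sum>a<U. c j a *
        im (\<psi> a)\<bar> powr p)"
      if j: "j < n" for j
    proof -
      have fx: "f (x j) = (\<Sum>a<U. of_real (c j a) * \<psi> a)"
        unfolding x dual_unit_ball_comb[OF f] using j by (simp add: \<psi>_def)
      have lin: "g (f (x j)) = (\<Sum>a<U. c j a * g (\<psi> a))" if "bounded_linear g" for g :: "'k \<Rightarrow> real"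
        unfolding fx using bounded_linear.linear[OF that]
        by (simp add: linear_sum linear_cmul scaleR_conv_of_real[symmetric])
      have "norm (f (x j)) powr p \<le> (\<bar>re (f (x j))\<bar> + \<bar>im (f (x j))\<bar>) powr p"
        using p by (intro powr_mono2 norm_le_parts) auto
      also have "\<dots> \<le> 2 powr p * (\<bar>re (f (x j))\<bar> powr p + \<bar>im (f (x j))\<bar> powr p)"
        using p by (intro powr_add_le_two) auto
      finally show ?thesis by (simp only: lin[OF re] lin[OF im])
    qed
    have "(\<Sum>j<n. norm (f (x j)) powr p) \<le> (\<Sum>j<n. 2 powr p * (\<bar>\<Sum>a<U. c j a * re (\<psi> a)\<bar> powr p +
        \<bar>\<Sum>a<U. c j a * im (\<psi> a)\<bar> powr p))"
      by (intro sum_mono t) simp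
    also have "\<dots> = 2 powr p * ((\<Sum>j<n. \<bar>\<Sum>a<U. c j a * re (\<psi> a)\<bar> powr p) + (\<Sum>j<n. \<bar>\<Sum>a<U. c j a * im
        (\<psi> a)\<bar> powr p))"
      by (simp only: sum.distrib flip: sum_distrib_left)
    also have "\<dots> \<le> 2 powr p * (K + K)"
      by (intro mult_left_mono add_mono wkfD[OF w] order.trans[OF re_le] order.trans[OF im_le]
          psi) simp
    finally show ?thesis by simp
  qed
  show "x \<in> weak_ell p 1" "weak_norm p 1 x \<le> (2 powr p * (2 * K)) powr (1 / p)"
    by (rule weak_ellI[of x n p "2 powr p * (2 * K)"], rule xe, erule x0, rule p, erule b)+
qed

lemma prod_split_two:
  fixes f :: "nat \<Rightarrow> 'a::comm_monoid_mult"
  assumes "m \<ge> 2"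
  shows "(\<Prod>k<m. f k) = f 0 * (f 1 * (\<Prod>k\<in>{2..<m}. f k))"
proof -
  have "{..<m} = insert 0 (insert 1 {2..<m})" using assms by auto
  then show ?thesis by simp
qed

text \<open>The variables beyond the second enter through their coordinate 0, and the result is
  placed in coordinate 0 of l_2; thus a bounded real kernel yields an m-linear operator over either
  field.\<close>

definition bilinear_op :: "nat \<Rightarrow> (nat \<Rightarrow> nat \<Rightarrow> real) \<Rightarrow> (nat \<Rightarrow> nat \<Rightarrow> 'k::{real_normed_field,banach})
    \<Rightarrow> nat \<Rightarrow> 'k" where
  "bilinear_op m s = (\<lambda>x\<in>{..<m} \<rightarrow>\<^sub>E ell 1. \<lambda>i. if i = 0 then
     pairing (x 0) (\<lambda>u. pairing (x 1) (\<lambda>v. of_real (s u v))) * (\<Prod>k\<in>{2..<m}. x k 0) else 0)"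

lemma bilinear_op_ell:
  assumes "x \<in> {..<m} \<rightarrow>\<^sub>E ell 1"
  shows "bilinear_op m s x \<in> ell 2" "ell_norm 2 (bilinear_op m s x) = norm (bilinear_op m s x 0)"
proof -
  have z: "bilinear_op m s x i = 0" if "i \<noteq> 0" for i using assms that by (simp add: bilinear_op_def)
  show e: "bilinear_op m s x \<in> ell 2"
    unfolding ell_two_iff by (rule summable_finite[of "{0}"]) (auto simp: z)
  have "(\<Sum>i. (norm (bilinear_op m s x i))\<^sup>2) = (\<Sum>i\<in>{0}. (norm (bilinear_op m s x i))\<^sup>2)"
    by (rule suminf_finite) (auto simp: z)
  then show "ell_norm 2 (bilinear_op m s x) = norm (bilinear_op m s x 0)"
    by (simp add: ell_norm_two[OF e])
qed

lemma bilinear_op_bounded: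
  assumes m: "m \<ge> 2" and s: "\<And>u v. \<bar>s u v\<bar> \<le> 1"
  shows "(bilinear_op m s :: (nat \<Rightarrow> nat \<Rightarrow> 'k::{real_normed_field,banach}) \<Rightarrow> _) \<in>
      bounded_multilinear_ops m 1 2"
  unfolding bounded_multilinear_ops_def
proof (intro CollectI conjI ballI allI impI)
  have sb: "norm (of_real (s u v) :: 'k) \<le> 1" for u v using s by simp
  have hb: "norm (pairing f (\<lambda>v. of_real (s u v))) \<le> ell_norm 1 f" if "f \<in> ell 1" for f :: "nat \<Rightarrow>
      'k" and u
    using pairing_norm_le[OF that sb] by simp
  show "(bilinear_op m s :: (nat \<Rightarrow> nat \<Rightarrow> 'k) \<Rightarrow> _) \<in> ({..<m} \<rightarrow>\<^sub>E ell 1) \<rightarrow>\<^sub>E ell 2"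
  proof (rule PiE_I)
    show "bilinear_op m s x \<in> ell 2" if "x \<in> {..<m} \<rightarrow>\<^sub>E ell 1" for x :: "nat \<Rightarrow> nat \<Rightarrow> 'k"
      using that by (rule bilinear_op_ell(1))
    show "bilinear_op m s x = undefined" if "x \<notin> {..<m} \<rightarrow>\<^sub>E ell 1" for x :: "nat \<Rightarrow> nat \<Rightarrow> 'k"
      using that by (simp only: bilinear_op_def restrict_apply if_False)
  qed
  {
    fix x :: "nat \<Rightarrow> nat \<Rightarrow> 'k" and k and u v :: "nat \<Rightarrow> 'k" and a b
    assume x: "x \<in> {..<m} \<rightarrow>\<^sub>E ell 1" and k: "k < m" and u: "u \<in> ell 1" and v: "v \<in> ell 1"
    have x01: "x 0 \<in> ell 1" "x 1 \<in> ell 1" using PiE_mem[OF x] m by simp_all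
    let ?w = "\<lambda>i. a * u i + b * v i"
    note in_ell = PiE_upd_ell[OF x k u] PiE_upd_ell[OF x k v] PiE_upd_ell[OF x k
        ell_one_lincomb[OF u v, of a b]]
    have main: "bilinear_op m s (x(k := ?w)) 0 = a * bilinear_op m s (x(k := u)) 0 + b *
        bilinear_op m s (x(k := v)) 0"
    proof -
      consider "k = 0" | "k = 1" | "k \<ge> 2" by linarith
      then show ?thesis
      proof cases
        case 1
        have "(\<Prod>l\<in>{2..<m}. (x(k := y)) l 0) = (\<Prod>l\<in>{2..<m}. x l 0)" for y
          using 1 by (intro prod.cong) auto
        then show ?thesis using in_ell 1 pairing_linear_left[OF u v hb[OF x01(2)], of a b]
          by (simp add: bilinear_op_def algebra_simps)
      next
        case 2
        have pr: "(\<Prod>l\<in>{2..<m}. (x(k := y)) l 0) = (\<Prod>l\<in>{2..<m}. x l 0)" for y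
          using 2 by (intro prod.cong) auto
        have "pairing (x 0) (\<lambda>i. pairing ?w (\<lambda>v. of_real (s i v)))
            = pairing (x 0) (\<lambda>i. a * pairing u (\<lambda>v. of_real (s i v)) + b * pairing v (\<lambda>v. of_real
                (s i v)))"
          by (simp add: pairing_linear_left[OF u v sb])
        also have "\<dots> = a * pairing (x 0) (\<lambda>i. pairing u (\<lambda>v. of_real (s i v))) + b * pairing (x 0)
            (\<lambda>i. pairing v (\<lambda>v. of_real (s i v)))"
          by (rule pairing_linear_right[OF x01(1) hb[OF u] hb[OF v]])
        finally show ?thesis using in_ell 2 pr by (simp add: bilinear_op_def algebra_simps)
      next
        case 3
        then have kin: "k \<in> {2..<m}" using k by auto
        have "(\<Prod>l\<in>{2..<m}. (x(k := y)) l 0) = y 0 * (\<Prod>l\<in>{2..<m} - {k}. x l 0)" for y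
          using kin by (subst prod.remove[of _ k]) auto
        then show ?thesis using in_ell 3 by (simp add: bilinear_op_def algebra_simps)
      qed
    qed
    show "bilinear_op m s (x(k := ?w)) = (\<lambda>i. a * bilinear_op m s (x(k := u)) i + b * bilinear_op
        m s (x(k := v)) i)"
    proof
      fix i
      show "bilinear_op m s (x(k := ?w)) i = a * bilinear_op m s (x(k := u)) i + b * bilinear_op m
          s (x(k := v)) i"
      proof (cases "i = 0")
        case True
        then show ?thesis using main by simp
      next
        case False
        then show ?thesis using in_ell by (simp add: bilinear_op_def)
      qed
    qed
  }
  show "\<exists>C. \<forall>x\<in>{..<m} \<rightarrow>\<^sub>E ell 1. ell_norm 2 (bilinear_op m s (x :: nat \<Rightarrow> nat \<Rightarrow> 'k)) \<le> C * (\<Prod>k<m.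
      ell_norm 1 (x k))"
  proof (intro exI ballI)
    fix x :: "nat \<Rightarrow> nat \<Rightarrow> 'k" assume x: "x \<in> {..<m} \<rightarrow>\<^sub>E ell 1"
    have xk: "x k \<in> ell 1" if "k < m" for k using x that by auto
    have x01: "x 0 \<in> ell 1" "x 1 \<in> ell 1" using xk m by auto
    have c: "norm (x k 0) \<le> ell_norm 1 (x k)" if "k < m" for k
      using sum_le_suminf[of "\<lambda>i. norm (x k i)" "{0}"] xk[OF that] by (simp add: ell_norm_one
          ell_one_iff)
    have "ell_norm 2 (bilinear_op m s x) = norm (pairing (x 0) (\<lambda>u. pairing (x 1) (\<lambda>v. of_real (s
        u v)))) * (\<Prod>k\<in>{2..<m}. norm (x k 0))"
      unfolding bilinear_op_ell(2)[OF x] using x by (simp add: bilinear_op_def norm_mult prod_norm)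
    also have "\<dots> \<le> (ell_norm 1 (x 0) * ell_norm 1 (x 1)) * (\<Prod>k\<in>{2..<m}. ell_norm 1 (x k))"
      using c by (intro mult_mono prod_mono pairing_norm_le[OF x01(1)] hb[OF x01(2)])
        (auto simp: ell_norm_nonneg intro!: prod_nonneg mult_nonneg_nonneg)
    also have "\<dots> = 1 * (\<Prod>k<m. ell_norm 1 (x k))" unfolding prod_split_two[OF m] by simp
    finally show "ell_norm 2 (bilinear_op m s x) \<le> 1 * (\<Prod>k<m. ell_norm 1 (x k))" .
  qed
qed

text \<open>A single operator has to defeat every constant. The common constant K of the finite
  examples bounds the weak norms independently of t, whereas the sums on the left are at least
  t.\<close>

lemma (in scalar_parts) not_all_multiple_summing:
  assumes m: "m \<ge> 2" and p: "2 < p"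
  shows "\<exists>T \<in> bounded_multilinear_ops m 1 2. (T :: (nat \<Rightarrow> nat \<Rightarrow> 'k) \<Rightarrow> nat \<Rightarrow> 'k) \<notin>
      multiple_summing_ops m p p 1 2"
proof -
  from scalar_finite_example[OF p] obtain K where K: "K > 0" and
    ex: "\<forall>M. \<exists>n U (S :: nat \<Rightarrow> nat \<Rightarrow> real) x. (\<forall>u<U. \<forall>v<U. \<bar>S u v\<bar> \<le> 1) \<and>
     wkf p K {..<n::nat} {..<U} x \<and> M \<le> (\<Sum>j<n. \<bar>\<Sum>u<U. \<Sum>v<U. x j u * x j v * S u v\<bar> powr p)" by blast
  have "\<forall>t::nat. \<exists>n U (S :: nat \<Rightarrow> nat \<Rightarrow> real) x. (\<forall>u<U. \<forall>v<U. \<bar>S u v\<bar> \<le> 1) \<and>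
     wkf p K {..<n::nat} {..<U} x \<and> real t \<le> (\<Sum>j<n. \<bar>\<Sum>u<U. \<Sum>v<U. x j u * x j v * S u v\<bar> powr p)"
    using ex by blast
  then obtain n U :: "nat \<Rightarrow> nat" and S x where S: "\<And>t u v. u < U t \<Longrightarrow> v < U t \<Longrightarrow> \<bar>S t u v :: real\<bar> \<le>
      1"
    and w: "\<And>t. wkf p K {..<n t :: nat} {..<U t} (x t)"
    and big: "\<And>t. real t \<le> (\<Sum>j<n t. \<bar>\<Sum>u<U t. \<Sum>v<U t. x t j u * x t j v * S t u v\<bar> powr p)"
    unfolding choice_iff by blast
  \<comment> \<open>The finite examples for all \<open>t\<close> are the diagonal blocks of one infinite matrix.\<close>
  define s where "s u v = (if fst (prod_decode u) = fst (prod_decode v) \<and> snd (prod_decode u) < U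
      (fst (prod_decode u))
      \<and> snd (prod_decode v) < U (fst (prod_decode u))
    then S (fst (prod_decode u)) (snd (prod_decode u)) (snd (prod_decode v)) else 0)" for u v
  have s1: "\<bar>s u v\<bar> \<le> 1" for u v unfolding s_def using S by auto
  have sS: "s (prod_encode (t, a)) (prod_encode (t, b)) = S t a b" if "a < U t" "b < U t" for t a b
    using that by (simp add: s_def)
  define T where "T = (bilinear_op m s :: (nat \<Rightarrow> nat \<Rightarrow> 'k) \<Rightarrow> nat \<Rightarrow> 'k)"
  have T: "T \<in> bounded_multilinear_ops m 1 2" unfolding T_def by (rule bilinear_op_bounded[OF m s1])
  have "T \<notin> multiple_summing_ops m p p 1 2"
  proof
    assume "T \<in> multiple_summing_ops m p p 1 2"
    then obtain C where C: "C > 0" "\<forall>y. (\<forall>k<m. y k \<in> weak_ell p 1) \<longrightarrow>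
       (\<lambda>j. ell_norm 2 (T (\<lambda>k\<in>{..<m}. y k (j k))) powr p) summable_on ({..<m} \<rightarrow>\<^sub>E UNIV) \<and>
       (\<Sum>\<^sub>\<infinity>j\<in>{..<m} \<rightarrow>\<^sub>E UNIV. ell_norm 2 (T (\<lambda>k\<in>{..<m}. y k (j k))) powr p) powr (1 / p)
         \<le> C * (\<Prod>k<m. weak_norm p 1 (y k))"
      unfolding multiple_summing_ops_def by blast
    define K' where "K' = (2 powr p * (2 * K)) powr (1 / p)"
    have bound: "real t \<le> (C * (K' * K')) powr p" for t
    proof -
      define X where "X = (\<lambda>j u. \<Sum>a<U t. of_real (if j < n t then x t j a else 0) * (unit_seq
          (prod_encode (t, a)) u :: 'k))"
      \<comment> \<open>The m - 2 idle variables receive one unit vector followed by zeros: its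
        coordinate 0 is 1, and the weak norm is at most 1.\<close>
      define Y where "Y j = (if j = 0 then unit_seq 0 else (\<lambda>_. 0 :: 'k))" for j :: nat
      have X: "X \<in> weak_ell p 1" "weak_norm p 1 X \<le> K'"
        using weak_ell_comb[OF w[of t] _ X_def] p by (auto simp: K'_def)
      have Ye: "Y j \<in> ell 1" for j by (simp add: Y_def unit_seq_ell ell_one_zero)
      have Y: "Y \<in> weak_ell p 1" "weak_norm p 1 Y \<le> 1 powr (1 / p)"
      proof -
        have b: "(\<Sum>j<1. norm (f (Y j)) powr p) \<le> 1" if "f \<in> dual_unit_ball 1" for f
          using dual_unit_ball_unit_seq[OF that, of 0] p by (simp add: Y_def powr_le_one_le
              powr_mono2[of p _ 1, simplified])
        have Y0: "Y j = (\<lambda>_. 0)" if "j \<ge> 1" for j using that by (simp add: Y_def)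
        have p0: "p > 0" using p by simp
        show "Y \<in> weak_ell p 1" "weak_norm p 1 Y \<le> 1 powr (1 / p)"
          by (rule weak_ellI[of Y 1 p 1], rule Ye, erule Y0, rule p0, erule b)+
      qed
      define y where "y k = (if k < 2 then X else Y)" for k :: nat
      have yw: "\<forall>k<m. y k \<in> weak_ell p 1" using X Y by (simp add: y_def)
      \<comment> \<open>Only the multi-indices (j, j, 0, ..., 0) are used for the lower bound; the
        other terms are nonnegative.\<close>
      define c where "c j = (\<lambda>k\<in>{..<m}. if k < 2 then j else (0::nat))" for j
      have cinj: "inj_on c {..<n t}"
      proof (rule inj_onI)
        fix i j assume "c i = c j"
        then have "c i 0 = c j 0" by simp
        then show "i = j" using m by (simp add: c_def)
      qed
      let ?f = "\<lambda>j. ell_norm 2 (T (\<lambda>k\<in>{..<m}. y k (j k))) powr p"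
      from C(2) yw have sm: "?f summable_on ({..<m} \<rightarrow>\<^sub>E UNIV)"
        and le: "(\<Sum>\<^sub>\<infinity>j\<in>{..<m} \<rightarrow>\<^sub>E UNIV. ?f j) powr (1 / p) \<le> C * (\<Prod>k<m. weak_norm p 1 (y k))" by
            blast+
      have fc: "?f (c j) = \<bar>\<Sum>u<U t. \<Sum>v<U t. x t j u * x t j v * S t u v\<bar> powr p" if j: "j < n t"
          for j
      proof -
        define z where "z = (\<lambda>k\<in>{..<m}. y k (c j k))"
        have z: "z \<in> {..<m} \<rightarrow>\<^sub>E ell 1"
          using X(1) Ye by (auto simp: z_def y_def c_def weak_ell_def)
        have z0: "z 0 = X j" "z 1 = X j" using m by (simp_all add: z_def y_def c_def)
        have zk: "(\<Prod>k\<in>{2..<m}. z k 0) = 1"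
          by (intro prod.neutral) (auto simp: z_def y_def c_def Y_def unit_seq_def)
        have "T z 0 = pairing (X j) (\<lambda>u. pairing (X j) (\<lambda>v. of_real (s u v)))"
          using z z0 zk by (simp add: T_def bilinear_op_def)
        also have "\<dots> = (\<Sum>a<U t. of_real (x t j a) * (\<Sum>b<U t. of_real (x t j b) * of_real (s
            (prod_encode (t, a)) (prod_encode (t, b)))))"
          unfolding X_def pairing_comb using j by simp
        also have "\<dots> = of_real (\<Sum>a<U t. x t j a * (\<Sum>b<U t. x t j b * s (prod_encode (t, a))
            (prod_encode (t, b))))"
          by simp
        also have "(\<Sum>a<U t. x t j a * (\<Sum>b<U t. x t j b * s (prod_encode (t, a)) (prod_encode (t,
            b))))
            = (\<Sum>a<U t. \<Sum>b<U t. x t j a * x t j b * S t a b)"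
          unfolding sum_distrib_left by (intro sum.cong refl) (simp add: sS mult.assoc)
        finally have "norm (T z 0) = \<bar>\<Sum>u<U t. \<Sum>v<U t. x t j u * x t j v * S t u v\<bar>" by (simp only:
            norm_of_real)
        moreover have "ell_norm 2 (T z) = norm (T z 0)" unfolding T_def by (rule
            bilinear_op_ell(2)[OF z])
        ultimately show ?thesis by (simp add: z_def)
      qed
      have "real t \<le> (\<Sum>j<n t. ?f (c j))" using big[of t] fc by simp
      also have "\<dots> = sum ?f (c ` {..<n t})" by (rule sum.reindex[OF cinj, unfolded o_def,
          symmetric])
      also have "\<dots> \<le> (\<Sum>\<^sub>\<infinity>j\<in>{..<m} \<rightarrow>\<^sub>E UNIV. ?f j)"
      proof (rule finite_sum_le_infsum[OF sm])
        show "c ` {..<n t} \<subseteq> {..<m} \<rightarrow>\<^sub>E UNIV"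
          unfolding c_def by (intro image_subsetI) (simp add: restrict_PiE_iff)
      qed simp_all
      finally have t_le: "real t \<le> (\<Sum>\<^sub>\<infinity>j\<in>{..<m} \<rightarrow>\<^sub>E UNIV. ?f j)" .
      have "(\<Prod>k<m. weak_norm p 1 (y k)) \<le> K' * (K' * 1)"
        unfolding prod_split_two[OF m]
      proof (intro mult_mono)
        show "weak_norm p 1 (y 0) \<le> K'" "weak_norm p 1 (y 1) \<le> K'" using X by (simp_all add: y_def)
        have "(\<Prod>k\<in>{2..<m}. weak_norm p 1 (y k)) \<le> (\<Prod>k\<in>{2..<m}. 1)"
          using Y weak_norm_nonneg[OF Y(1)] by (intro prod_mono) (auto simp: y_def)
        then show "(\<Prod>k\<in>{2..<m}. weak_norm p 1 (y k)) \<le> 1" by simp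
      qed (use m yw in \<open>auto simp: K'_def intro!: mult_nonneg_nonneg prod_nonneg weak_norm_nonneg\<close>)
      then have "(\<Sum>\<^sub>\<infinity>j\<in>{..<m} \<rightarrow>\<^sub>E UNIV. ?f j) powr (1 / p) \<le> C * (K' * K')"
        using le C(1) by (simp add: order.trans[OF le mult_left_mono])
      then have "((\<Sum>\<^sub>\<infinity>j\<in>{..<m} \<rightarrow>\<^sub>E UNIV. ?f j) powr (1 / p)) powr p \<le> (C * (K' * K')) powr p"
        using p by (intro powr_mono2) auto
      moreover have "(\<Sum>\<^sub>\<infinity>j\<in>{..<m} \<rightarrow>\<^sub>E UNIV. ?f j) \<ge> 0" by (intro infsum_nonneg) simp
      ultimately show ?thesis using t_le p by (simp add: powr_powr)
    qed
    obtain t :: nat where "(C * (K' * K')) powr p < real t" using reals_Archimedean2 by blast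
    then show False using bound[of t] by simp
  qed
  then show ?thesis using T by blast
qed

subsection \<open>The characterization\<close>

lemma (in scalar_parts) multiple_summing_eq_iff:
  assumes m: "m \<ge> 2" and pq: "1 \<le> p" "p \<le> q"
  shows "(multiple_summing_ops m q p 1 2 :: ((nat \<Rightarrow> nat \<Rightarrow> 'k) \<Rightarrow> nat \<Rightarrow> 'k) set)
    = bounded_multilinear_ops m 1 2 \<longleftrightarrow> p \<le> 2 \<or> (q > p \<and> p > 2)"
proof
  assume eq: "(multiple_summing_ops m q p 1 2 :: ((nat \<Rightarrow> nat \<Rightarrow> 'k) \<Rightarrow> nat \<Rightarrow> 'k) set)
    = bounded_multilinear_ops m 1 2"
  show "p \<le> 2 \<or> (q > p \<and> p > 2)"
  proof (rule ccontr)
    assume "\<not> (p \<le> 2 \<or> (q > p \<and> p > 2))"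
    then have "2 < p" "q = p" using pq by auto
    with not_all_multiple_summing[OF m] eq show False by blast
  qed
next
  assume h: "p \<le> 2 \<or> (q > p \<and> p > 2)"
  have "T \<in> multiple_summing_ops m q p 1 2" if "T \<in> bounded_multilinear_ops m 1 2"
    for T :: "(nat \<Rightarrow> nat \<Rightarrow> 'k) \<Rightarrow> nat \<Rightarrow> 'k"
  proof -
    interpret bounded_multilinear_op_parts m T re im \<iota>
      by unfold_locales (rule that)
    have "m > 0" "p > 0" "q > 0" using m pq by simp_all
    then show ?thesis
      using summing_bound_imp_multiple_summing[OF summing_bound_all[OF _ pq h]] by simp
  qed
  moreover have "multiple_summing_ops m q p 1 2 \<subseteq> (bounded_multilinear_ops m 1 2
      :: ((nat \<Rightarrow> nat \<Rightarrow> 'k) \<Rightarrow> nat \<Rightarrow> 'k) set)"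
    by (auto simp: multiple_summing_ops_def)
  ultimately show "(multiple_summing_ops m q p 1 2 :: ((nat \<Rightarrow> nat \<Rightarrow> 'k) \<Rightarrow> nat \<Rightarrow> 'k) set)
    = bounded_multilinear_ops m 1 2" by blast
qed

interpretation real_parts: scalar_parts "\<lambda>x::real. x" "\<lambda>_. 0" 0
  by (intro scalar_parts.intro bounded_linear_ident bounded_linear_zero) auto

interpretation complex_parts: scalar_parts Re Im \<i>
  by (intro scalar_parts.intro bounded_linear_Re bounded_linear_Im)
    (simp_all add: abs_Re_le_cmod abs_Im_le_cmod complex_eq[symmetric])

theorem theorem4p1:
  fixes m :: nat and p q :: real
  assumes "m \<ge> 2" and "1 \<le> p" and "p \<le> q"
  shows "((multiple_summing_ops m q p 1 2 :: ((nat \<Rightarrow> nat \<Rightarrow> real) \<Rightarrow> nat \<Rightarrow> real) set)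
            = bounded_multilinear_ops m 1 2 \<longleftrightarrow> p \<le> 2 \<or> (q > p \<and> p > 2)) \<and>
         ((multiple_summing_ops m q p 1 2 :: ((nat \<Rightarrow> nat \<Rightarrow> complex) \<Rightarrow> nat \<Rightarrow> complex) set)
            = bounded_multilinear_ops m 1 2 \<longleftrightarrow> p \<le> 2 \<or> (q > p \<and> p > 2))"
  using real_parts.multiple_summing_eq_iff[OF assms] complex_parts.multiple_summing_eq_iff[OF assms]
  by (rule conjI)

end
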